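(* Let $t\ge2$ be an integer and let $\mathbf{c}=(c_i)_{i\ge1}$ be a sequence of nonnegative real numbers such that $c_i\ge1$ and $c_{i+1}-c_i\le c_t$ for all $i\ge t$. Then for every $\rho>0$ there exists $n_0=n_0(\rho,c_t)$ such that for every $n>n_0$ and every $n$-vertex graph $G$, $\mathrm{dec}_t(G,\mathbf{c})\le\mathrm{dec}^*_t(G,\mathbf{c})+\rho n^t$.
   Context: All graphs are finite and simple. A clique of $G$ is a nonempty set of pairwise adjacent vertices; $\mathcal{K}(G)$ is the set of cliques of $G$ and $\mathcal{K}_t(G)$ the set of cliques with exactly $t$ vertices. For $f:\mathcal{K}(G)\to\mathbb{R}$, its $\mathbf{c}$-cost is $\|f\|_{\mathbf{c}}=\sum_{K\in\mathcal{K}(G)}c_{|K|}f(K)$. A $t$-clique decomposition of $G$ is $f:\mathcal{K}(G)\to\{0,1\}$ with $\sum_{K\in\mathcal{K}(G),\,T\subseteq K}f(K)=1$ for every $T\in\mathcal{K}_t(G)$; a fractional $t$-clique decomposition allows $f:\mathcal{K}(G)\to\mathbb{R}_{\ge0}$. $\mathrm{dec}_t(G,\mathbf{c})$ and $\mathrm{dec}^*_t(G,\mathbf{c})$ denote the minimum $\mathbf{c}$-cost of a $t$-clique decomposition and of a fractional $t$-clique decomposition of $G$. *)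

theory Defs
  imports "HOL-Analysis.Analysis" "Graph_Theory.Pair_Digraph"
begin

text \<open>
  Finite simple graphs are the \<open>pair_graph\<close>s of the AFP entry Graph\_Theory: finite loopless digraphs
  whose arc set is symmetric, so that an edge \<open>uv\<close> is the pair of arcs \<open>(u, v)\<close>, \<open>(v, u)\<close>.
\<close>

definition cliques :: "'a pair_pre_digraph \<Rightarrow> 'a set set" where
  "cliques G = {K. K \<noteq> {} \<and> K \<subseteq> pverts G \<and> (\<forall>u\<in>K. \<forall>v\<in>K. u \<noteq> v \<longrightarrow> (u, v) \<in> parcs G)}"

definition cliques_of_size :: "nat \<Rightarrow> 'a pair_pre_digraph \<Rightarrow> 'a set set" where
  "cliques_of_size t G = {K \<in> cliques G. card K = t}"

definition clique_cost :: "'a pair_pre_digraph \<Rightarrow> (nat \<Rightarrow> real) \<Rightarrow> ('a set \<Rightarrow> real) \<Rightarrow> real" where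
  "clique_cost G c f = (\<Sum>K\<in>cliques G. c (card K) * f K)"

text \<open>
  Functions on the cliques are represented by total functions on vertex sets, whose values outside
  \<open>cliques G\<close> play no role.
\<close>

definition covers_cliques_once :: "nat \<Rightarrow> 'a pair_pre_digraph \<Rightarrow> ('a set \<Rightarrow> real) \<Rightarrow> bool" where
  "covers_cliques_once t G f \<longleftrightarrow>
     (\<forall>T\<in>cliques_of_size t G. (\<Sum>K\<in>{K \<in> cliques G. T \<subseteq> K}. f K) = 1)"

definition clique_decomposition :: "nat \<Rightarrow> 'a pair_pre_digraph \<Rightarrow> ('a set \<Rightarrow> real) \<Rightarrow> bool" where
  "clique_decomposition t G f \<longleftrightarrow>
     (\<forall>K\<in>cliques G. f K \<in> {0, 1}) \<and> covers_cliques_once t G f"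

definition fractional_clique_decomposition ::
    "nat \<Rightarrow> 'a pair_pre_digraph \<Rightarrow> ('a set \<Rightarrow> real) \<Rightarrow> bool" where
  "fractional_clique_decomposition t G f \<longleftrightarrow>
     (\<forall>K\<in>cliques G. 0 \<le> f K) \<and> covers_cliques_once t G f"

text \<open>
  The two minimum costs are written as infima. For \<open>t \<ge> 1\<close> and costs that are nonnegative from
  index 1 on they are attained, see \<open>dec_is_min\<close> and \<open>frac_dec_is_min\<close> below.
\<close>

definition dec :: "nat \<Rightarrow> 'a pair_pre_digraph \<Rightarrow> (nat \<Rightarrow> real) \<Rightarrow> real" where
  "dec t G c = Inf (clique_cost G c ` {f. clique_decomposition t G f})"

definition frac_dec :: "nat \<Rightarrow> 'a pair_pre_digraph \<Rightarrow> (nat \<Rightarrow> real) \<Rightarrow> real" where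
  "frac_dec t G c = Inf (clique_cost G c ` {f. fractional_clique_decomposition t G f})"

lemma cliques_subset_Pow: "cliques G \<subseteq> Pow (pverts G)"
  by (auto simp: cliques_def)

lemma finite_cliques:
  assumes "pair_graph G"
  shows "finite (cliques G)"
proof -
  interpret pair_graph G by fact
  show ?thesis
    using cliques_subset_Pow[of G] pair_finite_verts by (meson finite_Pow_iff finite_subset)
qed

lemma finite_clique:
  assumes "pair_graph G" and "K \<in> cliques G"
  shows "finite K" and "card K \<ge> 1"
proof -
  interpret pair_graph G by fact
  show fin: "finite K"
    using assms(2) cliques_subset_Pow[of G] pair_finite_verts by (meson PowD finite_subset subsetD)
  show "card K \<ge> 1"
    using fin assms(2) by (auto simp: cliques_def Suc_le_eq card_gt_0_iff)
qed

lemma clique_cost_mono: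
  assumes "pair_graph G" and "\<And>i. i \<ge> 1 \<Longrightarrow> 0 \<le> c i" and "\<And>K. K \<in> cliques G \<Longrightarrow> f K \<le> g K"
  shows "clique_cost G c f \<le> clique_cost G c g"
  unfolding clique_cost_def
  using assms finite_clique(2)[OF assms(1)] by (intro sum_mono mult_left_mono) blast+

lemma clique_decomposition_trivial:
  assumes "pair_graph G"
  shows "clique_decomposition t G (\<lambda>K. if card K = t then 1 else 0)"
proof -
  have "(\<Sum>K\<in>{K \<in> cliques G. T \<subseteq> K}. if card K = t then 1 else 0) = (1::real)"
    if T: "T \<in> cliques_of_size t G" for T
  proof -
    have eq: "(if card K = t then 1 else 0) = (if K = T then 1 else (0::real))"
      if "K \<in> {K \<in> cliques G. T \<subseteq> K}" for K
      proof -
      have "finite K" "T \<subseteq> K" "card T = t"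
        using that T finite_clique(1)[OF assms, of K] by (simp_all add: cliques_of_size_def)
      then have "card K = t \<longleftrightarrow> K = T"
        using card_subset_eq[of K T] by metis
      then show ?thesis
        by simp
    qed
    have "(\<Sum>K\<in>{K \<in> cliques G. T \<subseteq> K}. if card K = t then 1 else 0) =
          (\<Sum>K\<in>{K \<in> cliques G. T \<subseteq> K}. if K = T then 1 else (0::real))"
      using eq by (intro sum.cong) auto
    also have "\<dots> = 1"
      using T finite_cliques[OF assms] by (simp add: sum.delta cliques_of_size_def)
    finally show ?thesis .
  qed
  then show ?thesis
    by (auto simp: clique_decomposition_def covers_cliques_once_def)
qed

lemma fractional_if_clique_decomposition:
  "clique_decomposition t G f \<Longrightarrow> fractional_clique_decomposition t G f"
  unfolding clique_decomposition_def fractional_clique_decomposition_def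
  by force

lemma fractional_clique_decomposition_le_1:
  assumes G: "pair_graph G" and f: "fractional_clique_decomposition t G f"
    and K: "K \<in> cliques G" and t: "1 \<le> t" "t \<le> card K"
  shows "f K \<le> 1"
proof -
  obtain T where T: "T \<subseteq> K" "card T = t"
    using obtain_subset_with_card_n[OF t(2)] by metis
  have T': "T \<in> cliques_of_size t G"
    proof -
    have "T \<noteq> {}"
      using T(2) t(1) by auto
    moreover have "T \<subseteq> pverts G"
      by (rule subset_trans[OF T(1)]) (use K in \<open>simp add: cliques_def\<close>)
    moreover have "(u, v) \<in> parcs G" if "u \<in> T" "v \<in> T" "u \<noteq> v" for u v
      using K that subsetD[OF T(1)] by (simp add: cliques_def)
    ultimately show ?thesis
      using T(2) by (simp add: cliques_of_size_def cliques_def)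
  qed
  have "f K \<le> (\<Sum>L\<in>{L \<in> cliques G. T \<subseteq> L}. f L)"
    by (rule member_le_sum)
       (use f K T finite_cliques[OF G] in \<open>auto simp: fractional_clique_decomposition_def\<close>)
  also have "\<dots> = 1"
    using f T' by (simp add: fractional_clique_decomposition_def covers_cliques_once_def)
  finally show ?thesis .
qed

lemma finite_clique_decomposition_costs:
  assumes "pair_graph G"
  shows "finite (clique_cost G c ` {f. clique_decomposition t G f})"
proof (rule finite_subset)
  show "clique_cost G c ` {f. clique_decomposition t G f} \<subseteq>
        clique_cost G c ` (cliques G \<rightarrow>\<^sub>E {0, 1})"
  proof clarify
    fix f assume f: "clique_decomposition t G f"
    have "clique_cost G c f = clique_cost G c (restrict f (cliques G))"
      by (simp add: clique_cost_def)
    moreover have "restrict f (cliques G) \<in> cliques G \<rightarrow>\<^sub>E {0, 1}"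
      using f by (simp add: clique_decomposition_def)
    ultimately show "clique_cost G c f \<in> clique_cost G c ` (cliques G \<rightarrow>\<^sub>E {0, 1})"
      by blast
  qed
  show "finite (clique_cost G c ` (cliques G \<rightarrow>\<^sub>E {0, 1}))"
    by (intro finite_imageI finite_PiE finite_cliques assms) auto
qed

lemma dec_is_min:
  assumes "pair_graph G"
  shows "\<exists>f. clique_decomposition t G f \<and> clique_cost G c f = dec t G c" (is ?thesis1)
    and "clique_decomposition t G g \<Longrightarrow> dec t G c \<le> clique_cost G c g"
proof -
  let ?S = "clique_cost G c ` {f. clique_decomposition t G f}"
  have fin: "finite ?S"
    by (rule finite_clique_decomposition_costs) fact
  have ne: "?S \<noteq> {}"
    using clique_decomposition_trivial[OF assms] by blast
  have Min: "dec t G c = Min ?S"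
    unfolding dec_def using fin ne by (rule cInf_eq_Min)
  show ?thesis1
    using Min_in[OF fin ne] unfolding Min image_iff by (metis mem_Collect_eq)
  show "dec t G c \<le> clique_cost G c g" if "clique_decomposition t G g"
    using Min_le[OF fin] that unfolding Min by blast
qed

lemma frac_dec_is_min:
  assumes G: "pair_graph G" and t: "t \<ge> 1" and c: "\<And>i. i \<ge> 1 \<Longrightarrow> 0 \<le> c i"
  shows "\<exists>f. fractional_clique_decomposition t G f \<and> clique_cost G c f = frac_dec t G c" (is ?thesis1)
    and "fractional_clique_decomposition t G g \<Longrightarrow> frac_dec t G c \<le> clique_cost G c g"
proof -
  define S where "S = {f. fractional_clique_decomposition t G f}"
  define B where "B = Pi UNIV (\<lambda>_. {0..1}) \<inter> {f. covers_cliques_once t G f}"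
  have cont: "continuous_on UNIV (\<lambda>f::'a set \<Rightarrow> real. f K)" for K
    by simp
  have "compactin (product_topology (\<lambda>_. euclidean) UNIV) (PiE UNIV (\<lambda>_::'a set. {0..1::real}))"
    by (simp add: compactin_PiE)
  then have "compact (Pi UNIV (\<lambda>_::'a set. {0..1::real}))"
    unfolding euclidean_product_topology PiE_UNIV_domain by (simp only: compactin_euclidean_iff)
  moreover have "closed {f. covers_cliques_once t G f}"
    proof -
    have "closed {f::'a set \<Rightarrow> real. (\<Sum>K\<in>{K \<in> cliques G. T \<subseteq> K}. f K) = 1}" for T
      by (rule closed_Collect_eq) (rule continuous_on_sum, rule cont, rule continuous_on_const)
    moreover have "{f. covers_cliques_once t G f} =
        (\<Inter>T\<in>cliques_of_size t G. {f. (\<Sum>K\<in>{K \<in> cliques G. T \<subseteq> K}. f K) = 1})"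
      unfolding covers_cliques_once_def by blast
    ultimately show ?thesis
      by (simp only:) (rule closed_INT, blast)
  qed
  ultimately have "compact B"
    unfolding B_def by (rule compact_Int_closed)
  moreover have "continuous_on B (clique_cost G c)"
    unfolding clique_cost_def[abs_def]
    by (rule continuous_on_sum, rule continuous_on_mult, rule continuous_on_const,
        rule continuous_on_subset[OF cont], rule subset_UNIV)
  moreover have triv: "(\<lambda>K. if card K = t then 1 else 0) \<in> B"
    using clique_decomposition_trivial[OF G, of t] by (auto simp: B_def clique_decomposition_def)
  ultimately obtain f where f: "f \<in> B" and f_min: "\<And>g. g \<in> B \<Longrightarrow> clique_cost G c f \<le> clique_cost G c g"
    using continuous_attains_inf[of B "clique_cost G c"] by blast
  have fS: "f \<in> S"
    using f by (auto simp: B_def S_def fractional_clique_decomposition_def)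
  have le: "clique_cost G c f \<le> clique_cost G c g" if g: "g \<in> S" for g
  proof -
    define h where "h K = (if K \<in> cliques G \<and> t \<le> card K then g K else 0)" for K
    have gf: "fractional_clique_decomposition t G g"
      using g by (simp add: S_def)
    have "(\<Sum>K\<in>{K \<in> cliques G. T \<subseteq> K}. h K) = (\<Sum>K\<in>{K \<in> cliques G. T \<subseteq> K}. g K)"
      if "T \<in> cliques_of_size t G" for T
      using that finite_clique(1)[OF G] card_mono
      by (intro sum.cong) (auto simp: h_def cliques_of_size_def)
    then have "covers_cliques_once t G h"
      using gf by (simp add: fractional_clique_decomposition_def covers_cliques_once_def)
    moreover have "h K \<in> {0..1}" for K
      using fractional_clique_decomposition_le_1[OF G gf _ t, of K] gf
      by (auto simp: h_def fractional_clique_decomposition_def)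
    ultimately have "h \<in> B"
      by (auto simp: B_def)
    then have "clique_cost G c f \<le> clique_cost G c h"
      by (rule f_min)
    also have "\<dots> \<le> clique_cost G c g"
      by (rule clique_cost_mono) (use G c gf in \<open>auto simp: h_def fractional_clique_decomposition_def\<close>)
    finally show ?thesis .
  qed
  have eq: "frac_dec t G c = clique_cost G c f"
    unfolding frac_dec_def S_def[symmetric]
    by (rule cInf_eq_minimum) (use fS le in auto)
  show ?thesis1
    using fS eq by (auto simp: S_def)
  show "frac_dec t G c \<le> clique_cost G c g" if "fractional_clique_decomposition t G g"
    using le[of g] that eq by (simp add: S_def)
qed

end

theory Submission
  imports Defs
begin

text \<open>
  Write \<open>b\<^sub>k = (k choose t) c\<^sub>t - c\<^sub>k\<close> for the saving made by using one clique on \<open>k\<close> vertices instead of all its \<open>t\<close>-subcliques.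
  The hypothesis makes \<open>b\<^sub>k\<close> nonnegative, so that both sides of the inequality amount to maximising the total saving over
  \<open>t\<close>-disjoint packings of cliques, integral on the left and fractional on the right. Cliques on more than \<open>s\<close> vertices can
  be given up, because costs grow at most linearly and numbers of \<open>t\<close>-subsets at least quadratically.

  A regular partition of the graph then allows one to spread a fractional packing evenly over all cliques with the same
  pattern of cells: by the counting lemma almost all \<open>t\<close>-cliques of a pattern lie in about equally many of them, so that the
  loads change little. In the spread packing two distinct \<open>t\<close>-cliques have negligible common weight, and a weighted
  version of the Roedl nibble turns it into an integral packing. Each round of the nibble is analysed in expectation
  only: loads exceeding 1 are trimmed and paid for by their expected total excess.
\<close>

section \<open>A weighted nibble\<close>

text \<open>The obstacle to rounding directly is that a fractional packing may be concentrated: two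
  \<open>t\<close>-cliques can share almost all of their weight, and the nibble needs small
  codegrees. After spreading, a clique on \<open>k\<close> vertices has weight at most a constant
  over \<open>n ^ (k - t)\<close>, and two distinct \<open>t\<close>-cliques span at least
  \<open>t + 1\<close> vertices, so their common weight is of order \<open>1 / n\<close>. The saving
  depends on the size alone, which is constant on a pattern, so the spreading itself loses no value.
  Excess loads are paid for in total and never vertex by vertex. Hence an \<open>L1\<close> bound on
  extension counts is enough, and regularity is needed only in its cut-norm form, for cells of
  arbitrary sizes. The threshold may depend on the costs only through \<open>c t\<close>. Therefore
  the size cutoff \<open>s\<close> is fixed from \<open>t\<close>, \<open>c t\<close> and \<rho>,
  the savings up to size \<open>s\<close> are divided by \<open>2 ^ s * c t\<close>, and rounding is
  proved uniformly for all value functions with values in the unit interval.\<close>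

lemma exists_trimmed_weight:
  fixes w b :: "'x set \<Rightarrow> real"
  assumes X: "finite X" and E: "E \<subseteq> Pow X" and w_nonneg: "\<forall>e\<in>E. 0 \<le> w e"
    and b_range: "\<forall>e\<in>E. 0 \<le> b e \<and> b e \<le> 1"
  shows "\<exists>w'. (\<forall>e\<in>E. 0 \<le> w' e \<and> w' e \<le> w e) \<and> (\<forall>x\<in>X. (\<Sum>e\<in>{e \<in> E. x \<in> e}. w' e) \<le> 1) \<and>
    (\<Sum>e\<in>E. b e * w e) - (\<Sum>x\<in>X. max 0 ((\<Sum>e\<in>{e \<in> E. x \<in> e}. w e) - 1)) \<le> (\<Sum>e\<in>E. b e * w' e)"
proof -
  note w = w_nonneg[rule_format] and b = b_range[rule_format]
  define l where "l x = (\<Sum>e\<in>{e \<in> E. x \<in> e}. w e)" for x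
  \<comment> \<open>Every edge pays a factor 1 / load for each overloaded vertex on it. One such
    factor already brings the load of its vertex down to 1, and the others only help.\<close>
  define m where "m x = 1 / max 1 (l x)" for x
  define w' where "w' e = w e * (\<Prod>x\<in>e. m x)" for e
  have finE: "finite E" and fine: "\<And>e. e \<in> E \<Longrightarrow> finite e"
    using X E by (auto intro: finite_subset)
  have m01: "0 \<le> m x" "m x \<le> 1" for x
    by (auto simp: m_def)
  have P01: "0 \<le> (\<Prod>x\<in>e. m x)" "(\<Prod>x\<in>e. m x) \<le> 1" for e
    using m01 by (auto intro: prod_nonneg prod_le_1)
  show ?thesis
  proof (intro exI[of _ w'] conjI ballI)
    show "0 \<le> w' e" "w' e \<le> w e" if "e \<in> E" for e
      using w[OF that] P01[of e] by (auto simp: w'_def mult_left_le)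
  next
    fix x assume x: "x \<in> X"
    have "(\<Sum>e\<in>{e \<in> E. x \<in> e}. w' e) \<le> (\<Sum>e\<in>{e \<in> E. x \<in> e}. w e * m x)"
    proof (rule sum_mono)
      fix e assume "e \<in> {e \<in> E. x \<in> e}"
      then have e: "e \<in> E" "x \<in> e" by auto
      have "(\<Prod>y\<in>e. m y) = m x * (\<Prod>y\<in>e - {x}. m y)"
        using fine[OF e(1)] e(2) by (simp add: prod.remove)
      also have "\<dots> \<le> m x"
        using m01 P01[of "e - {x}"] by (simp add: mult_left_le)
      finally show "w' e \<le> w e * m x"
        using w[OF e(1)] by (simp add: w'_def mult_left_mono)
    qed
    also have "\<dots> = l x * m x"
      by (simp add: l_def sum_distrib_right)
    also have "\<dots> \<le> 1"
      by (auto simp: m_def divide_simps)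
    finally show "(\<Sum>e\<in>{e \<in> E. x \<in> e}. w' e) \<le> 1" .
  next
    have ex: "l x * (1 - m x) = max 0 (l x - 1)" for x
      by (cases "l x \<le> 1") (auto simp: m_def max_def field_simps)
    have "(\<Sum>e\<in>E. b e * w e) - (\<Sum>e\<in>E. b e * w' e) = (\<Sum>e\<in>E. b e * (w e - w' e))"
      by (simp add: sum_subtractf algebra_simps)
    also have "\<dots> \<le> (\<Sum>e\<in>E. w e * (\<Sum>x\<in>e. 1 - m x))"
    proof (rule sum_mono)
      fix e assume e: "e \<in> E"
      \<comment> \<open>A union bound in product form: the loss on \<open>e\<close> splits over its
        vertices. Summed over the edges at \<open>x\<close> it is \<open>l x * (1 - m x)\<close>,
        exactly the excess at \<open>x\<close>.\<close>
      have "1 - (\<Sum>x\<in>e. 1 - m x) \<le> (\<Prod>x\<in>e. 1 - (1 - m x))"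
        using m01 by (intro Weierstrass_prod_ineq) auto
      then have "w e * (1 - (\<Prod>x\<in>e. m x)) \<le> w e * (\<Sum>x\<in>e. 1 - m x)"
        using w[OF e] by (intro mult_left_mono) auto
      moreover have "b e * (w e - w' e) \<le> w e - w' e"
        using b[OF e] w[OF e] P01[of e] by (intro mult_left_le_one_le) (auto simp: w'_def mult_left_le)
      ultimately show "b e * (w e - w' e) \<le> w e * (\<Sum>x\<in>e. 1 - m x)"
        by (simp add: w'_def algebra_simps)
    qed
    also have "\<dots> = (\<Sum>e\<in>E. \<Sum>x\<in>{x \<in> X. x \<in> e}. w e * (1 - m x))"
    proof (rule sum.cong)
      fix e assume "e \<in> E"
      then have "{x \<in> X. x \<in> e} = e" using E by auto
      then show "w e * (\<Sum>x\<in>e. 1 - m x) = (\<Sum>x\<in>{x \<in> X. x \<in> e}. w e * (1 - m x))"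
        by (simp add: sum_distrib_left)
    qed simp
    also have "\<dots> = (\<Sum>x\<in>X. \<Sum>e\<in>{e \<in> E. x \<in> e}. w e * (1 - m x))"
      by (rule sum.swap_restrict[OF finE X])
    also have "\<dots> = (\<Sum>x\<in>X. max 0 (l x - 1))"
      unfolding ex[symmetric] by (simp add: l_def sum_distrib_right)
    finally show "(\<Sum>e\<in>E. b e * w e) - (\<Sum>x\<in>X. max 0 ((\<Sum>e\<in>{e \<in> E. x \<in> e}. w e) - 1)) \<le> (\<Sum>e\<in>E. b e * w' e)"
      unfolding l_def by linarith
  qed
qed

section \<open>Expectations over independent random subsets of a finite set\<close>

definition subset_prob :: "'i set \<Rightarrow> ('i \<Rightarrow> real) \<Rightarrow> 'i set \<Rightarrow> real" where
  "subset_prob A u R = (\<Prod>i\<in>R. 1 - u i) * (\<Prod>i\<in>A - R. u i)"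

definition expct :: "'i set \<Rightarrow> ('i \<Rightarrow> real) \<Rightarrow> ('i set \<Rightarrow> real) \<Rightarrow> real" where
  "expct A u h = (\<Sum>R\<in>Pow A. subset_prob A u R * h R)"

text \<open>Here \<open>u i\<close> is the probability that \<open>i\<close> is left out, so
  avoiding \<open>F\<close> multiplies these numbers over \<open>F\<close>. The coordinates outside
  \<open>F\<close> sum to 1 by expanding the product of \<open>(1 - u i) + u i\<close>; the case
  \<open>F = {}\<close> gives total mass 1.\<close>

lemma expct_avoiding:
  assumes A: "finite A" and F: "F \<subseteq> A"
  shows "expct A u (\<lambda>R. of_bool (R \<inter> F = {})) = (\<Prod>i\<in>F. u i)"
proof -
  have fin: "finite F" "finite (A - F)" using A F finite_subset by auto
  have "expct A u (\<lambda>R. of_bool (R \<inter> F = {})) = (\<Sum>R\<in>Pow (A - F). subset_prob A u R)"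
    unfolding expct_def using A by (intro sum.mono_neutral_cong_right) auto
  also have "\<dots> = (\<Sum>R\<in>Pow (A - F). (\<Prod>i\<in>F. u i) * ((\<Prod>i\<in>R. 1 - u i) * (\<Prod>i\<in>(A - F) - R. u i)))"
  proof (rule sum.cong)
    fix R assume R: "R \<in> Pow (A - F)"
    then have "A - R = F \<union> ((A - F) - R)" using F by auto
    moreover have "(\<Prod>i\<in>F \<union> ((A - F) - R). u i) = (\<Prod>i\<in>F. u i) * (\<Prod>i\<in>(A - F) - R. u i)"
      using fin by (intro prod.union_disjoint) auto
    ultimately show "subset_prob A u R = (\<Prod>i\<in>F. u i) * ((\<Prod>i\<in>R. 1 - u i) * (\<Prod>i\<in>(A - F) - R. u i))"
      by (simp add: subset_prob_def)
  qed simp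
  also have "\<dots> = (\<Prod>i\<in>F. u i) * (\<Prod>i\<in>A - F. (1 - u i) + u i)"
    unfolding prod_add[OF fin(2)] by (simp add: sum_distrib_left)
  finally show ?thesis by simp
qed

lemma expct_const:
  "finite A \<Longrightarrow> expct A u (\<lambda>R. k) = k"
  using expct_avoiding[of A "{}" u]
  by (simp add: expct_def flip: sum_distrib_right)

lemma expct_add: "expct A u (\<lambda>R. g R + h R) = expct A u g + expct A u h"
  by (simp add: expct_def distrib_left sum.distrib)

lemma expct_diff: "expct A u (\<lambda>R. g R - h R) = expct A u g - expct A u h"
  by (simp add: expct_def right_diff_distrib sum_subtractf)

lemma expct_cmult: "expct A u (\<lambda>R. k * h R) = k * expct A u h"
  by (simp add: expct_def sum_distrib_left mult_ac)

lemma expct_sum: "expct A u (\<lambda>R. \<Sum>i\<in>I. h i R) = (\<Sum>i\<in>I. expct A u (h i))"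
  unfolding expct_def sum_distrib_left by (rule sum.swap)

lemma expct_cong: "(\<And>R. R \<subseteq> A \<Longrightarrow> g R = h R) \<Longrightarrow> expct A u g = expct A u h"
  by (simp add: expct_def)

lemma subset_prob_nonneg:
  assumes "R \<subseteq> A" "\<And>i. i \<in> A \<Longrightarrow> 0 \<le> u i \<and> u i \<le> 1"
  shows "0 \<le> subset_prob A u R"
  unfolding subset_prob_def using assms by (intro mult_nonneg_nonneg prod_nonneg) auto

lemma expct_mono:
  assumes "\<And>i. i \<in> A \<Longrightarrow> 0 \<le> u i \<and> u i \<le> 1" and "\<And>R. R \<subseteq> A \<Longrightarrow> g R \<le> h R"
  shows "expct A u g \<le> expct A u h"
  unfolding expct_def using assms subset_prob_nonneg[of _ A u] by (intro sum_mono mult_left_mono) auto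

lemma exists_ge_expct:
  assumes A: "finite A" and u: "\<And>i. i \<in> A \<Longrightarrow> 0 \<le> u i \<and> u i \<le> 1"
  shows "\<exists>R\<subseteq>A. expct A u h \<le> h R"
proof -
  have fin: "finite (h ` Pow A)" and ne: "h ` Pow A \<noteq> {}"
    using A by auto
  obtain R where R: "R \<in> Pow A" "h R = Max (h ` Pow A)"
    using Max_in[OF fin ne] by (metis imageE)
  then have max: "h S \<le> h R" if "S \<subseteq> A" for S
    using Max_ge[OF fin] that by simp
  have "expct A u h \<le> expct A u (\<lambda>_. h R)"
    by (rule expct_mono) (use u max in auto)
  then show ?thesis using R expct_const[OF A] by auto
qed

section \<open>One round of the nibble\<close>

locale weighted_hypergraph =
  fixes X :: "'x set" and E :: "'x set set" and w :: "'x set \<Rightarrow> real" and r :: nat and \<delta> :: real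
  assumes finite_vertices: "finite X"
    and edges: "e \<in> E \<Longrightarrow> e \<subseteq> X \<and> 2 \<le> card e \<and> card e \<le> r"
    and w_nonneg: "e \<in> E \<Longrightarrow> 0 \<le> w e"
    and load_le: "x \<in> X \<Longrightarrow> (\<Sum>e\<in>{e \<in> E. x \<in> e}. w e) \<le> 1"
    and codegree_le: "x \<in> X \<Longrightarrow> y \<in> X \<Longrightarrow> x \<noteq> y \<Longrightarrow> (\<Sum>e\<in>{e \<in> E. x \<in> e \<and> y \<in> e}. w e) \<le> \<delta>"
    and codegree_bound_nonneg: "0 \<le> \<delta>" and rank_pos: "1 \<le> r"
begin

text \<open>Edges have at least two vertices, so the added singletons are new and can carry weights
  of their own.\<close>

definition A :: "'x set set" where "A = E \<union> (\<lambda>x. {x}) ` X"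

text \<open>Singletons absorb the missing load, so that every vertex has load exactly 1 and is hit in one round of the
  nibble with the same probability.\<close>

definition W :: "'x set \<Rightarrow> real" where
  "W e = (if card e = 1 then 1 - (\<Sum>g\<in>{g \<in> E. the_elem e \<in> g}. w g) else w e)"

lemma finite_E: "finite E"
  using finite_vertices edges by (meson Pow_iff finite_Pow_iff finite_subset subsetI)

lemma finite_A: "finite A"
  using finite_E finite_vertices by (simp add: A_def)

lemma padded_edgeD:
  assumes "e \<in> A"
  shows "e \<subseteq> X" "e \<noteq> {}" "finite e" "1 \<le> card e" "card e \<le> r" "0 \<le> W e"
proof -
  show sub: "e \<subseteq> X" and ne: "e \<noteq> {}"
    using assms edges by (fastforce simp: A_def)+
  show fin: "finite e" by (rule finite_subset[OF sub finite_vertices])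
  show "1 \<le> card e" using fin ne by (simp add: Suc_le_eq card_gt_0_iff)
  show "card e \<le> r"
    using assms edges rank_pos by (auto simp: A_def)
  show "0 \<le> W e"
  proof (cases "e \<in> E")
    case True
    then show ?thesis using edges[OF True] w_nonneg by (simp add: W_def)
  next
    case False
    then obtain x where "e = {x}" "x \<in> X" using assms by (auto simp: A_def)
    then show ?thesis using load_le by (simp add: W_def)
  qed
qed

lemma W_edge: "e \<in> E \<Longrightarrow> W e = w e"
  using edges[of e] by (auto simp: W_def)

lemma E_sub_A: "E \<subseteq> A"
  by (simp add: A_def)

lemma padded_edges_containing:
  assumes "x \<in> X"
  shows "{e \<in> A. x \<in> e} = insert {x} {e \<in> E. x \<in> e}" and "{x} \<notin> E"
  using assms edges[of "{x}"] by (auto simp: A_def)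

lemma padded_load: "x \<in> X \<Longrightarrow> (\<Sum>e\<in>{e \<in> A. x \<in> e}. W e) = 1"
  using finite_E padded_edges_containing[of x] by (simp add: W_edge) (simp add: W_def)

lemma padded_codegree_le:
  assumes "x \<in> X" "y \<in> X" "x \<noteq> y"
  shows "(\<Sum>e\<in>{e \<in> A. x \<in> e \<and> y \<in> e}. W e) \<le> \<delta>"
proof -
  have "{e \<in> A. x \<in> e \<and> y \<in> e} = {e \<in> E. x \<in> e \<and> y \<in> e}"
    using assms by (auto simp: A_def)
  then show ?thesis using codegree_le[OF assms] by (simp add: W_edge)
qed

text \<open>\<open>p * touch S\<close> is the exponent of the probability that no selected edge
  meets \<open>S\<close>, see \<open>mean_alive\<close>. With unit loads and small codegrees
  \<open>touch S\<close> is nearly \<open>card S\<close>.\<close>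

definition touch :: "'x set \<Rightarrow> real" where
  "touch S = (\<Sum>g\<in>{g \<in> A. g \<inter> S \<noteq> {}}. W g)"

text \<open>The edges that are new at \<open>x\<close> are those through \<open>x\<close> that avoid
  \<open>S\<close>. All edges through \<open>x\<close> together weigh 1, and those that also hit
  \<open>S\<close> weigh at most \<open>card S * \<delta>\<close> by a union bound over
  codegrees.\<close>

lemma touch_insert:
  assumes "x \<in> X" "x \<notin> S" "S \<subseteq> X"
  shows "touch (insert x S) \<le> touch S + 1"
    and "touch S + 1 - real (card S) * \<delta> \<le> touch (insert x S)"
proof -
  let ?B = "{g \<in> A. x \<in> g \<and> g \<inter> S = {}}" and ?C = "{g \<in> A. x \<in> g \<and> g \<inter> S \<noteq> {}}"
  have finS: "finite S" using assms finite_vertices finite_subset by auto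
  have "{g \<in> A. g \<inter> insert x S \<noteq> {}} = {g \<in> A. g \<inter> S \<noteq> {}} \<union> ?B" by auto
  then have eq: "touch (insert x S) = touch S + sum W ?B"
    unfolding touch_def using finite_A by (simp add: sum.union_disjoint disjoint_iff)
  have "{e \<in> A. x \<in> e} = ?B \<union> ?C" by auto
  then have BC: "sum W ?B + sum W ?C = 1"
    using padded_load[OF assms(1)] finite_A by (simp add: sum.union_disjoint disjoint_iff)
  have "sum W ?C \<ge> 0" by (rule sum_nonneg) (auto intro: padded_edgeD)
  then show "touch (insert x S) \<le> touch S + 1" using eq BC by linarith
  have "sum W ?C \<le> (\<Sum>g\<in>?C. \<Sum>y\<in>{y \<in> S. y \<in> g}. W g)"
  proof (rule sum_mono)
    fix g assume g: "g \<in> ?C"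
    then obtain y where "y \<in> S" "y \<in> g" by auto
    then show "W g \<le> (\<Sum>y\<in>{y \<in> S. y \<in> g}. W g)"
      using finS g by (intro member_le_sum[of y _ "\<lambda>_. W g"]) (auto intro: padded_edgeD)
  qed
  also have "\<dots> = (\<Sum>y\<in>S. \<Sum>g\<in>{g \<in> ?C. y \<in> g}. W g)"
    by (rule sum.swap_restrict) (use finite_A finS in auto)
  also have "\<dots> = (\<Sum>y\<in>S. \<Sum>g\<in>{g \<in> A. x \<in> g \<and> y \<in> g}. W g)"
    by (intro sum.cong refl) auto
  also have "\<dots> \<le> (\<Sum>y\<in>S. \<delta>)"
    by (rule sum_mono, rule padded_codegree_le) (use assms in auto)
  finally show "touch S + 1 - real (card S) * \<delta> \<le> touch (insert x S)"
    using eq BC by simp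
qed

lemma touch_bounds:
  assumes "S \<subseteq> X"
  shows "touch S \<le> card S" and "real (card S) - (real (card S))\<^sup>2 * \<delta> \<le> touch S"
proof -
  have "finite S" using assms finite_vertices finite_subset by auto
  then have "touch S \<le> card S \<and> real (card S) - (real (card S))\<^sup>2 * \<delta> \<le> touch S"
    using assms
  proof (induction S)
    case empty
    then show ?case by (simp add: touch_def)
  next
    case (insert x S)
    have "real (card S) * \<delta> \<ge> 0" using codegree_bound_nonneg by simp
    with insert touch_insert[of x S] codegree_bound_nonneg show ?case
      by (auto simp: power2_eq_square algebra_simps)
  qed
  then show "touch S \<le> card S" and "real (card S) - (real (card S))\<^sup>2 * \<delta> \<le> touch S" by auto
qed

lemma touch_singleton: "x \<in> X \<Longrightarrow> touch {x} = 1"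
  unfolding touch_def by (simp add: padded_load)

definition alive :: "'x set \<Rightarrow> 'x set set \<Rightarrow> real" where
  "alive S R = of_bool (\<forall>g\<in>R. g \<inter> S = {})"

lemma alive_mult: "alive S R * alive S' R = alive (S \<union> S') R"
  by (auto simp: alive_def)

text \<open>Each padded edge is selected independently with probability
  \<open>1 - exp (- (p * W e))\<close>, as if by a Poisson clock run for time \<open>p\<close>.
  Avoidance probabilities become exact exponentials, and every single vertex survives with
  probability exactly \<open>exp (- p)\<close>.\<close>

abbreviation mean :: "real \<Rightarrow> ('x set set \<Rightarrow> real) \<Rightarrow> real" where
  "mean p \<equiv> expct A (\<lambda>e. exp (- (p * W e)))"

lemma mean_avoid:
  assumes "F \<subseteq> A"
  shows "mean p (\<lambda>R. of_bool (R \<inter> F = {})) = exp (- (p * sum W F))"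
  using finite_subset[OF assms finite_A]
  by (simp add: expct_avoiding[OF finite_A assms] exp_sum[symmetric] sum_negf sum_distrib_left)

lemma mean_alive: "mean p (alive S) = exp (- (p * touch S))"
proof -
  have "mean p (alive S) = mean p (\<lambda>R. of_bool (R \<inter> {g \<in> A. g \<inter> S \<noteq> {}} = {}))"
    by (rule expct_cong) (auto simp: alive_def)
  then show ?thesis using mean_avoid[of "{g \<in> A. g \<inter> S \<noteq> {}}" p] by (simp add: touch_def)
qed

text \<open>Padding singletons compete as well: \<open>e\<close> is discarded when the singleton of
  one of its vertices is selected.\<close>

definition chosen :: "'x set set \<Rightarrow> 'x set set" where
  "chosen R = {e \<in> E. e \<in> R \<and> (\<forall>g\<in>R. g \<noteq> e \<longrightarrow> g \<inter> e = {})}"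

lemma mean_chosen:
  assumes e: "e \<in> E" and p: "0 \<le> p" "p \<le> 1"
  shows "p * w e * (1 - p * real r) \<le> mean p (\<lambda>R. of_bool (e \<in> chosen R))"
proof -
  have eA: "e \<in> A" using e E_sub_A by auto
  let ?F = "{g \<in> A. g \<inter> e \<noteq> {}}"
  have eF: "e \<in> ?F" using padded_edgeD[OF eA] eA by auto
  have "sum W ?F = W e + sum W (?F - {e})"
    using eF finite_A by (subst sum.remove[of _ e]) auto
  then have S: "sum W (?F - {e}) = touch e - w e"
    using W_edge[OF e] by (simp add: touch_def)
  \<comment> \<open>Being the only selected edge that meets \<open>e\<close> is the event of
    avoiding all the others, minus the event of avoiding \<open>e\<close> too. Both have exponential
    probabilities.\<close>
  have "mean p (\<lambda>R. of_bool (e \<in> chosen R))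
      = mean p (\<lambda>R. of_bool (R \<inter> (?F - {e}) = {}) - of_bool (R \<inter> ?F = {}))"
    by (rule expct_cong) (use e eF in \<open>auto simp: chosen_def\<close>)
  also have "\<dots> = exp (- (p * (touch e - w e))) - exp (- (p * touch e))"
    by (simp only: expct_diff, subst (1 2) mean_avoid) (auto simp: S touch_def[symmetric])
  also have "\<dots> = exp (- (p * touch e)) * (exp (p * w e) - 1)"
    by (simp add: algebra_simps exp_add[symmetric])
  also have "\<dots> \<ge> (1 - p * real r) * (p * w e)"
  proof -
    have "touch e \<le> r" using touch_bounds(1)[of e] padded_edgeD[OF eA] by linarith
    then have "p * touch e \<le> p * r" using p by (intro mult_left_mono) auto
    then have 1: "1 - p * real r \<le> exp (- (p * touch e))"
      using exp_ge_add_one_self[of "- (p * touch e)"] by linarith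
    have 2: "p * w e \<le> exp (p * w e) - 1"
      using exp_ge_add_one_self[of "p * w e"] by linarith
    have "0 \<le> p * w e" using p w_nonneg[OF e] by simp
    with 1 2 show ?thesis
      by (meson exp_ge_zero mult_mono mult_right_mono order_trans mult_left_mono)
  qed
  finally show ?thesis by (simp add: mult_ac)
qed

text \<open>An edge through a surviving vertex survives with probability about \<open>exp (- p)\<close> per further vertex; this factor
  compensates for the loss, so that loads are preserved on average.\<close>

definition up :: "real \<Rightarrow> 'x set \<Rightarrow> real" where
  "up p e = W e * exp (p * (real (card e) - 1))"

lemma up_nonneg: "e \<in> A \<Longrightarrow> 0 \<le> up p e"
  using padded_edgeD by (simp add: up_def)

lemma mean_up_alive:
  assumes "e \<in> A" and p: "0 \<le> p"
  shows "exp (- p) * W e \<le> up p e * mean p (alive e)"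
proof -
  have "touch e \<le> card e" using touch_bounds(1) padded_edgeD[OF assms(1)] by auto
  then have "p * touch e \<le> p * card e" using p by (rule mult_left_mono)
  then have "exp (- p) \<le> exp (p * (real (card e) - 1)) * exp (- (p * touch e))"
    by (simp add: exp_add[symmetric] algebra_simps)
  from mult_right_mono[OF this padded_edgeD(6)[OF assms(1)]] show ?thesis
    by (simp only: up_def mean_alive mult_ac)
qed

text \<open>Survival probabilities of two edges through \<open>x\<close> are almost independent given that \<open>x\<close> survives;
  the error comes from pairs meeting outside \<open>x\<close>, which the codegree bound makes rare.\<close>

lemma second_moment:
  assumes x: "x \<in> X" and p: "0 \<le> p"
  shows "(\<Sum>e\<in>{e \<in> A. x \<in> e}. \<Sum>g\<in>{g \<in> A. x \<in> g}. up p e * up p g * mean p (alive (e \<union> g)))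
     \<le> exp (- p) * exp (4 * p * (real r)\<^sup>2 * \<delta>) * (1 + real r * \<delta> * exp (p * real r))"
proof -
  let ?A = "{e \<in> A. x \<in> e}"
  let ?c = "exp (- p) * exp (4 * p * (real r)\<^sup>2 * \<delta>)"
  have term_le: "up p e * up p g * mean p (alive (e \<union> g))
       \<le> ?c * (W e * W g * (1 + exp (p * real r) * (\<Sum>y\<in>e - {x}. of_bool (y \<in> g))))"
    if e: "e \<in> ?A" and g: "g \<in> ?A" for e g
  proof -
    have fe: "finite e" "finite g" "e \<subseteq> X" "g \<subseteq> X" "0 \<le> W e" "0 \<le> W g" "card e \<le> r" "card g \<le> r"
      using e g padded_edgeD by auto
    let ?k = "card (e \<inter> g)" and ?u = "card (e \<union> g)"
    \<comment> \<open>The two compensating factors and the survival probability leave the exponent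
      \<open>card e + card g - card (e \<union> g) - 2\<close> times \<open>p\<close>, that is,
      \<open>- p\<close> plus \<open>p\<close> times the overlap beyond \<open>x\<close>.\<close>
    have cards: "real (card e) + real (card g) = real ?u + real ?k"
      using card_Un_Int[OF fe(1,2)] by linarith
    have "?u \<le> 2 * r" using card_Un_le[of e g] fe by linarith
    then have "(real ?u)\<^sup>2 \<le> (2 * real r)\<^sup>2" by (intro power_mono) auto
    then have "(real ?u)\<^sup>2 * \<delta> \<le> 4 * (real r)\<^sup>2 * \<delta>"
      using codegree_bound_nonneg by (intro mult_right_mono) (auto simp: power_mult_distrib)
    then have "real ?u - 4 * (real r)\<^sup>2 * \<delta> \<le> touch (e \<union> g)"
      using touch_bounds(2)[of "e \<union> g"] fe by auto
    then have "p * (real ?u - 4 * (real r)\<^sup>2 * \<delta>) \<le> p * touch (e \<union> g)"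
      using p by (rule mult_left_mono)
    then have "exp (p * (real (card e) - 1)) * exp (p * (real (card g) - 1)) * mean p (alive (e \<union> g))
        \<le> exp (p * (real (card e) - 1)) * exp (p * (real (card g) - 1)) * exp (- (p * (real ?u - 4 * (real r)\<^sup>2 * \<delta>)))"
      by (simp add: mean_alive)
    also have "\<dots> = exp (p * (real (card e) + real (card g) - real ?u - 2) + 4 * p * (real r)\<^sup>2 * \<delta>)"
      unfolding exp_add[symmetric] by (rule arg_cong[where f=exp]) (simp add: algebra_simps)
    also have "\<dots> = ?c * exp (p * (real ?k - 1))"
      unfolding exp_add[symmetric] cards by (rule arg_cong[where f=exp]) (simp add: algebra_simps)
    \<comment> \<open>If the edges share only \<open>x\<close>, the factor is 1. Otherwise the sum
      of indicators is at least 1, and in this form the contribution of such \<open>g\<close> can be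
      summed by codegrees.\<close>
    also have "exp (p * (real ?k - 1)) \<le> 1 + exp (p * real r) * (\<Sum>y\<in>e - {x}. of_bool (y \<in> g))"
    proof (cases "e \<inter> g = {x}")
      case True
      then have "?k = 1" by simp
      then show ?thesis by (simp add: sum_nonneg)
    next
      case False
      then obtain y where y: "y \<in> e - {x}" "y \<in> g" using e g by auto
      have "(1::real) = of_bool (y \<in> g)" using y by simp
      also have "\<dots> \<le> (\<Sum>y\<in>e - {x}. of_bool (y \<in> g))"
        using y fe by (intro member_le_sum) auto
      finally have s: "(1::real) \<le> (\<Sum>y\<in>e - {x}. of_bool (y \<in> g))" .
      have "?k \<le> r" using card_mono[of e "e \<inter> g"] fe by auto
      then have "p * (real ?k - 1) \<le> p * real r" using p by (intro mult_left_mono) auto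
      then have "exp (p * (real ?k - 1)) \<le> exp (p * real r) * 1" by simp
      also have "\<dots> \<le> exp (p * real r) * (\<Sum>y\<in>e - {x}. of_bool (y \<in> g))"
        using s by (intro mult_left_mono) auto
      finally show ?thesis by linarith
    qed
    finally have "exp (p * (real (card e) - 1)) * exp (p * (real (card g) - 1)) * mean p (alive (e \<union> g))
        \<le> ?c * (1 + exp (p * real r) * (\<Sum>y\<in>e - {x}. of_bool (y \<in> g)))"
      by simp
    then have "(W e * W g) * (exp (p * (real (card e) - 1)) * exp (p * (real (card g) - 1)) * mean p (alive (e \<union> g)))
        \<le> (W e * W g) * (?c * (1 + exp (p * real r) * (\<Sum>y\<in>e - {x}. of_bool (y \<in> g))))"
      using fe by (intro mult_left_mono) auto
    then show ?thesis by (simp add: up_def mult_ac)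
  qed
  have inner: "(\<Sum>g\<in>?A. W g * (\<Sum>y\<in>e - {x}. of_bool (y \<in> g))) \<le> real r * \<delta>" if e: "e \<in> ?A" for e
  proof -
    have fe: "finite e" "e \<subseteq> X" "card e \<le> r" using e padded_edgeD by auto
    have "(\<Sum>g\<in>?A. W g * (\<Sum>y\<in>e - {x}. of_bool (y \<in> g)))
        = (\<Sum>y\<in>e - {x}. \<Sum>g\<in>?A. W g * of_bool (y \<in> g))"
      unfolding sum_distrib_left by (rule sum.swap)
    also have "\<dots> = (\<Sum>y\<in>e - {x}. \<Sum>g\<in>{g \<in> A. x \<in> g \<and> y \<in> g}. W g)"
    proof (rule sum.cong[OF refl])
      fix y
      have "{g \<in> A. x \<in> g \<and> y \<in> g} = ?A \<inter> {g. y \<in> g}" by auto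
      then show "(\<Sum>g\<in>?A. W g * of_bool (y \<in> g)) = (\<Sum>g\<in>{g \<in> A. x \<in> g \<and> y \<in> g}. W g)"
        using finite_A by (simp add: sum.inter_restrict of_bool_def if_distrib cong: if_cong)
    qed
    also have "\<dots> \<le> (\<Sum>y\<in>e - {x}. \<delta>)"
      by (rule sum_mono, rule padded_codegree_le) (use x fe in auto)
    also have "\<dots> \<le> real r * \<delta>"
      using card_mono[of e "e - {x}"] fe codegree_bound_nonneg by (auto intro!: mult_right_mono)
    finally show ?thesis .
  qed
  have "(\<Sum>e\<in>?A. \<Sum>g\<in>?A. up p e * up p g * mean p (alive (e \<union> g)))
      \<le> (\<Sum>e\<in>?A. \<Sum>g\<in>?A. ?c * (W e * W g * (1 + exp (p * real r) * (\<Sum>y\<in>e - {x}. of_bool (y \<in> g)))))"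
    by (intro sum_mono term_le)
  also have "\<dots> = ?c * (\<Sum>e\<in>?A. W e * ((\<Sum>g\<in>?A. W g) + exp (p * real r) * (\<Sum>g\<in>?A. W g * (\<Sum>y\<in>e - {x}. of_bool (y \<in> g)))))"
    unfolding sum_distrib_left sum.distrib[symmetric] by (intro sum.cong refl) (simp add: algebra_simps sum_distrib_left)
  also have "\<dots> \<le> ?c * (\<Sum>e\<in>?A. W e * (1 + exp (p * real r) * (real r * \<delta>)))"
    by (intro mult_left_mono sum_mono add_mono) (use inner padded_load[OF x] padded_edgeD in auto)
  also have "\<dots> = ?c * (1 + exp (p * real r) * (real r * \<delta>))"
    by (simp add: sum_distrib_right[symmetric] padded_load[OF x])
  finally show ?thesis by (simp add: mult_ac)
qed

text \<open>The relative error of the second moment over the value \<open>exp (- p)\<close> of exact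
  conditional independence. For fixed \<open>p\<close> and \<open>r\<close> it vanishes as \<delta>
  tends to 0.\<close>

definition discrepancy :: "real \<Rightarrow> real" where
  "discrepancy p = exp (4 * p * (real r)\<^sup>2 * \<delta>) * (1 + real r * \<delta> * exp (p * real r)) - 1"

text \<open>The first moment of the surviving padded load is at least \<open>exp (- p)\<close>.
  Together with the bound on the second moment this leaves, on the event that \<open>x\<close>
  survives, a mean square distance from 1 of at most
  \<open>exp (- p) * discrepancy p\<close>.\<close>

lemma expected_excess:
  assumes x: "x \<in> X" and p: "0 \<le> p" and \<eta>: "0 < \<eta>" "discrepancy p \<le> \<eta>\<^sup>2"
  shows "mean p (\<lambda>R. alive {x} R * max 0 ((\<Sum>e\<in>{e \<in> E. x \<in> e}. up p e * alive e R) - 1)) \<le> \<eta>"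
proof -
  let ?A = "{e \<in> A. x \<in> e}"
  let ?q = "exp (- p)"
  define L where "L R = (\<Sum>e\<in>?A. up p e * alive e R)" for R
  have "1 * 1 \<le> exp (4 * p * (real r)\<^sup>2 * \<delta>) * (1 + real r * \<delta> * exp (p * real r))"
    using p codegree_bound_nonneg by (intro mult_mono) auto
  then have disc0: "0 \<le> discrepancy p" by (simp add: discrepancy_def)
  have alive_x: "alive {x} R * alive e R = alive e R" if "e \<in> ?A" for e R
    using that by (simp add: alive_mult insert_absorb)
  have sq: "alive {x} R * (L R - 1)\<^sup>2
      = (\<Sum>e\<in>?A. \<Sum>g\<in>?A. up p e * up p g * alive (e \<union> g) R) - 2 * (\<Sum>e\<in>?A. up p e * alive e R) + alive {x} R" for R
  proof -
    have xL: "alive {x} R * L R = L R"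
      unfolding L_def sum_distrib_left
    proof (intro sum.cong refl)
      fix e assume "e \<in> ?A"
      from alive_x[OF this, of R] show "alive {x} R * (up p e * alive e R) = up p e * alive e R"
        by (metis mult.left_commute)
    qed
    have LL: "L R * L R = (\<Sum>e\<in>?A. \<Sum>g\<in>?A. up p e * up p g * alive (e \<union> g) R)"
      unfolding L_def sum_product by (intro sum.cong refl) (simp add: alive_mult[symmetric])
    have "alive {x} R * (L R - 1)\<^sup>2 = (alive {x} R * L R) * L R - 2 * (alive {x} R * L R) + alive {x} R"
      by (simp add: power2_eq_square algebra_simps)
    then show ?thesis unfolding xL LL by (simp only: L_def)
  qed
  have "mean p (\<lambda>R. alive {x} R * (L R - 1)\<^sup>2)
      = (\<Sum>e\<in>?A. \<Sum>g\<in>?A. up p e * up p g * mean p (alive (e \<union> g)))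
        - 2 * (\<Sum>e\<in>?A. up p e * mean p (alive e)) + mean p (alive {x})"
    unfolding sq by (simp only: expct_add expct_diff expct_cmult expct_sum)
  also have "\<dots> \<le> ?q * (discrepancy p + 1) - 2 * (\<Sum>e\<in>?A. ?q * W e) + ?q"
  proof -
    have "(\<Sum>e\<in>?A. ?q * W e) \<le> (\<Sum>e\<in>?A. up p e * mean p (alive e))"
      by (rule sum_mono) (use mean_up_alive p in auto)
    moreover have "mean p (alive {x}) = ?q"
      using x by (simp add: mean_alive touch_singleton)
    moreover have "(\<Sum>e\<in>?A. \<Sum>g\<in>?A. up p e * up p g * mean p (alive (e \<union> g))) \<le> ?q * (discrepancy p + 1)"
      using second_moment[OF x p] by (simp add: discrepancy_def mult.assoc)
    ultimately show ?thesis by linarith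
  qed
  also have "\<dots> = ?q * discrepancy p"
    by (simp add: sum_distrib_left[symmetric] padded_load[OF x] algebra_simps)
  also have "\<dots> \<le> 1 * \<eta>\<^sup>2"
    using \<eta> p disc0 by (intro mult_mono) auto
  finally have var: "mean p (\<lambda>R. alive {x} R * (L R - 1)\<^sup>2) \<le> \<eta>\<^sup>2" by simp
  have u01: "0 \<le> exp (- (p * W e)) \<and> exp (- (p * W e)) \<le> 1" if "e \<in> A" for e
    using padded_edgeD[OF that] p by simp
  have "mean p (\<lambda>R. alive {x} R * max 0 ((\<Sum>e\<in>{e \<in> E. x \<in> e}. up p e * alive e R) - 1))
      \<le> mean p (\<lambda>R. \<eta> / 2 + 1 / (2 * \<eta>) * (alive {x} R * (L R - 1)\<^sup>2))"
  proof (rule expct_mono[OF u01])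
    fix R
    \<comment> \<open>Dropping the padding singleton of \<open>x\<close> only lowers the
      load.\<close>
    have "(\<Sum>e\<in>{e \<in> E. x \<in> e}. up p e * alive e R) \<le> L R"
      unfolding L_def using finite_A E_sub_A
      by (intro sum_mono2) (auto intro!: mult_nonneg_nonneg up_nonneg simp: alive_def)
    \<comment> \<open>AM-GM in place of a tail estimate: a bound on the mean square becomes a bound
      on the expected positive part.\<close>
    moreover have "L R - 1 \<le> \<eta> / 2 + 1 / (2 * \<eta>) * (L R - 1)\<^sup>2"
    proof -
      have "0 \<le> (\<eta> - (L R - 1))\<^sup>2 / (2 * \<eta>)" using \<eta> by simp
      also have "\<dots> = \<eta> / 2 + 1 / (2 * \<eta>) * (L R - 1)\<^sup>2 - (L R - 1)"
        using \<eta> by (simp add: power2_eq_square field_simps)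
      finally show ?thesis by simp
    qed
    moreover have "0 \<le> \<eta> / 2 + 1 / (2 * \<eta>) * (L R - 1)\<^sup>2" using \<eta> by simp
    ultimately have "max 0 ((\<Sum>e\<in>{e \<in> E. x \<in> e}. up p e * alive e R) - 1) \<le> \<eta> / 2 + 1 / (2 * \<eta>) * (L R - 1)\<^sup>2"
      by linarith
    then show "alive {x} R * max 0 ((\<Sum>e\<in>{e \<in> E. x \<in> e}. up p e * alive e R) - 1)
        \<le> \<eta> / 2 + 1 / (2 * \<eta>) * (alive {x} R * (L R - 1)\<^sup>2)"
      using \<eta> by (cases "alive {x} R = 0") (auto simp: alive_def)
  qed
  also have "\<dots> = \<eta> / 2 + 1 / (2 * \<eta>) * mean p (\<lambda>R. alive {x} R * (L R - 1)\<^sup>2)"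
    by (simp only: expct_add expct_cmult expct_const[OF finite_A])
  also have "\<dots> \<le> \<eta> / 2 + 1 / (2 * \<eta>) * \<eta>\<^sup>2"
    using \<eta> var by (intro add_left_mono mult_left_mono) auto
  also have "\<dots> = \<eta>" using \<eta> by (simp add: power2_eq_square field_simps)
  finally show ?thesis .
qed

text \<open>Edges are nonempty, so the total weight is at most the total load. This pays for the
  quadratic loss of a round and starts the iteration with the empty matching.\<close>

lemma value_le_card:
  assumes b: "\<And>e. e \<in> E \<Longrightarrow> 0 \<le> b e \<and> b e \<le> 1"
  shows "(\<Sum>e\<in>E. b e * w e) \<le> card X"
proof -
  have "(\<Sum>e\<in>E. b e * w e) \<le> (\<Sum>e\<in>E. \<Sum>x\<in>{x \<in> X. x \<in> e}. w e)"
  proof (rule sum_mono)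
    fix e assume e: "e \<in> E"
    have "{x \<in> X. x \<in> e} = e" using edges[OF e] by auto
    moreover have "1 * w e \<le> real (card e) * w e"
      using edges[OF e] w_nonneg[OF e] by (intro mult_right_mono) auto
    moreover have "b e * w e \<le> w e" using b[OF e] w_nonneg[OF e] by (simp add: mult_left_le_one_le)
    ultimately show "b e * w e \<le> (\<Sum>x\<in>{x \<in> X. x \<in> e}. w e)" by simp
  qed
  also have "\<dots> = (\<Sum>x\<in>X. \<Sum>e\<in>{e \<in> E. x \<in> e}. w e)"
    by (rule sum.swap_restrict[OF finite_E finite_vertices])
  also have "\<dots> \<le> (\<Sum>x\<in>X. 1)" by (rule sum_mono) (rule load_le)
  finally show ?thesis by simp
qed

text \<open>A single outcome must serve all terms at once, so matched value, surviving value,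
  trimming loss and a deficit of \<epsilon> per survivor are combined into one function
  \<open>h\<close>. In expectation at most a fraction \<open>1 - p / 2\<close> of the vertices
  survives, which is what makes the deficit contract.\<close>

lemma nibble_round:
  assumes b_range: "\<forall>e\<in>E. 0 \<le> b e \<and> b e \<le> 1" and p: "0 \<le> p" "p \<le> 1"
    and \<eta>: "0 < \<eta>" "discrepancy p \<le> \<eta>\<^sup>2" and \<epsilon>: "0 \<le> \<epsilon>"
  shows "\<exists>M X' E' w'. M \<subseteq> E \<and> pairwise disjnt M \<and> (\<forall>e\<in>M. e \<inter> X' = {}) \<and> E' \<subseteq> E
     \<and> weighted_hypergraph X' E' w' r (\<delta> * exp (p * real r))
     \<and> (\<Sum>e\<in>E. b e * w e) - (p\<^sup>2 * real r + \<eta> + \<epsilon> * (1 - p / 2)) * real (card X)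
         \<le> (\<Sum>e\<in>M. b e) + ((\<Sum>e\<in>E'. b e * w' e) - \<epsilon> * real (card X'))"
proof -
  note b = b_range[rule_format]
  let ?q = "exp (- p)" and ?V = "\<Sum>e\<in>E. b e * w e"
  define h where "h R = (\<Sum>e\<in>E. b e * of_bool (e \<in> chosen R)) + (\<Sum>e\<in>E. b e * (up p e * alive e R))
     - (\<Sum>x\<in>X. alive {x} R * max 0 ((\<Sum>e\<in>{e \<in> E. x \<in> e}. up p e * alive e R) - 1))
     - \<epsilon> * (\<Sum>x\<in>X. alive {x} R)" for R
  have V0: "0 \<le> ?V" using b w_nonneg by (intro sum_nonneg) auto
  have u01: "0 \<le> exp (- (p * W e)) \<and> exp (- (p * W e)) \<le> 1" if "e \<in> A" for e
    using padded_edgeD[OF that] p by simp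
  obtain R where R: "R \<subseteq> A" "mean p h \<le> h R"
    using exists_ge_expct[OF finite_A u01, of "\<lambda>e. e" h] by auto
  have "mean p h = (\<Sum>e\<in>E. b e * mean p (\<lambda>R. of_bool (e \<in> chosen R))) + (\<Sum>e\<in>E. b e * (up p e * mean p (alive e)))
     - (\<Sum>x\<in>X. mean p (\<lambda>R. alive {x} R * max 0 ((\<Sum>e\<in>{e \<in> E. x \<in> e}. up p e * alive e R) - 1)))
     - \<epsilon> * (\<Sum>x\<in>X. mean p (alive {x}))"
    unfolding h_def by (simp only: expct_add expct_diff expct_cmult expct_sum)
  also have "\<dots> \<ge> (\<Sum>e\<in>E. b e * (p * w e * (1 - p * real r))) + (\<Sum>e\<in>E. b e * (?q * w e))
     - (\<Sum>x\<in>X. \<eta>) - \<epsilon> * (\<Sum>x\<in>X. 1 - p / 2)"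
  proof -
    have "?q \<le> 1 - p / 2"
    proof -
      have "1 + p \<le> exp p" by (rule exp_ge_add_one_self)
      then have "?q \<le> 1 / (1 + p)" using p by (simp add: exp_minus divide_simps)
      also have "\<dots> \<le> 1 - p / 2"
        using p mult_right_le_one_le[of p p] by (simp add: field_simps)
      finally show ?thesis .
    qed
    then have 1: "\<epsilon> * (\<Sum>x\<in>X. mean p (alive {x})) \<le> \<epsilon> * (\<Sum>x\<in>X. 1 - p / 2)"
      using \<epsilon> by (intro mult_left_mono sum_mono) (auto simp: mean_alive touch_singleton)
    have 2: "(\<Sum>x\<in>X. mean p (\<lambda>R. alive {x} R * max 0 ((\<Sum>e\<in>{e \<in> E. x \<in> e}. up p e * alive e R) - 1))) \<le> (\<Sum>x\<in>X. \<eta>)"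
      by (intro sum_mono expected_excess p \<eta>)
    have 3: "(\<Sum>e\<in>E. b e * (?q * w e)) \<le> (\<Sum>e\<in>E. b e * (up p e * mean p (alive e)))"
      by (intro sum_mono mult_left_mono) (use b mean_up_alive[OF _ p(1)] E_sub_A W_edge in fastforce)+
    have 4: "(\<Sum>e\<in>E. b e * (p * w e * (1 - p * real r))) \<le> (\<Sum>e\<in>E. b e * mean p (\<lambda>R. of_bool (e \<in> chosen R)))"
      by (intro sum_mono mult_left_mono mean_chosen p) (use b in auto)
    from 1 2 3 4 show ?thesis by linarith
  qed
  finally have "(\<Sum>e\<in>E. b e * (p * w e * (1 - p * real r))) + (\<Sum>e\<in>E. b e * (?q * w e))
     - (\<Sum>x\<in>X. \<eta>) - \<epsilon> * (\<Sum>x\<in>X. 1 - p / 2) \<le> h R" using R by linarith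
  moreover have "(\<Sum>e\<in>E. b e * (p * w e * (1 - p * real r))) = p * (1 - p * real r) * ?V"
    by (simp add: sum_distrib_left mult_ac)
  moreover have "(\<Sum>e\<in>E. b e * (?q * w e)) = ?q * ?V"
    by (simp add: sum_distrib_left mult_ac)
  \<comment> \<open>The matched fraction \<open>p * (1 - p * r)\<close> and the surviving fraction
    \<open>1 - p\<close> add up to \<open>1 - p\<^sup>2 * r\<close>: the loss is quadratic in
    \<open>p\<close>, while the number of vertices shrinks linearly.\<close>
  moreover have "(1 - p) * ?V \<le> ?q * ?V"
    using exp_ge_add_one_self[of "- p"] V0 by (intro mult_right_mono) auto
  moreover have "p\<^sup>2 * real r * ?V \<le> p\<^sup>2 * real r * card X"
    by (intro mult_left_mono value_le_card b) auto
  ultimately have hR: "?V - (p\<^sup>2 * real r + \<eta> + \<epsilon> * (1 - p / 2)) * real (card X) \<le> h R"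
    by (simp add: algebra_simps power2_eq_square)
  define X' where "X' = {x \<in> X. \<forall>g\<in>R. x \<notin> g}"
  define E' where "E' = {e \<in> E. e \<subseteq> X'}"
  have X'X: "X' \<subseteq> X" and E'E: "E' \<subseteq> E" by (auto simp: X'_def E'_def)
  have finX': "finite X'" and finE': "finite E'"
    using X'X E'E finite_vertices finite_E finite_subset by auto
  have alive_edge: "alive e R = of_bool (e \<in> E')" if "e \<in> E" for e
    using edges[OF that] that by (auto simp: alive_def E'_def X'_def)
  have alive_vertex: "alive {x} R = of_bool (x \<in> X')" if "x \<in> X" for x
    using that by (auto simp: alive_def X'_def)
  have M1: "(\<Sum>e\<in>E. b e * of_bool (e \<in> chosen R)) = (\<Sum>e\<in>chosen R. b e)"
    using finite_E by (intro sum.mono_neutral_cong_right) (auto simp: chosen_def)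
  have M2: "(\<Sum>e\<in>E. b e * (up p e * alive e R)) = (\<Sum>e\<in>E'. b e * up p e)"
    using finite_E E'E by (intro sum.mono_neutral_cong_right) (auto simp: alive_edge)
  have lo: "(\<Sum>e\<in>{e \<in> E. x \<in> e}. up p e * alive e R) = (\<Sum>e\<in>{e \<in> E'. x \<in> e}. up p e)" for x
    using finite_E E'E by (intro sum.mono_neutral_cong_right) (auto simp: alive_edge)
  have M3: "(\<Sum>x\<in>X. alive {x} R * max 0 ((\<Sum>e\<in>{e \<in> E. x \<in> e}. up p e * alive e R) - 1))
      = (\<Sum>x\<in>X'. max 0 ((\<Sum>e\<in>{e \<in> E'. x \<in> e}. up p e) - 1))"
    using finite_vertices X'X by (intro sum.mono_neutral_cong_right) (auto simp: alive_vertex lo)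
  have "(\<Sum>x\<in>X. alive {x} R) = (\<Sum>x\<in>X'. 1)"
    using finite_vertices X'X by (intro sum.mono_neutral_cong_right) (auto simp: alive_vertex)
  then have M4: "(\<Sum>x\<in>X. alive {x} R) = card X'" by simp
  have upE: "0 \<le> up p e" if "e \<in> E'" for e using that E'E E_sub_A up_nonneg by blast
  have "E' \<subseteq> Pow X'" "\<forall>e\<in>E'. 0 \<le> b e \<and> b e \<le> 1" "\<forall>e\<in>E'. 0 \<le> up p e"
    using b E'E upE by (auto simp: E'_def)
  from exists_trimmed_weight[where w = "up p" and b = b, OF finX' this(1,3,2)]
  obtain w' where w': "\<forall>e\<in>E'. 0 \<le> w' e \<and> w' e \<le> up p e"
    "\<forall>x\<in>X'. (\<Sum>e\<in>{e \<in> E'. x \<in> e}. w' e) \<le> 1"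
    "(\<Sum>e\<in>E'. b e * up p e) - (\<Sum>x\<in>X'. max 0 ((\<Sum>e\<in>{e \<in> E'. x \<in> e}. up p e) - 1)) \<le> (\<Sum>e\<in>E'. b e * w' e)"
    by (elim exE conjE)
  \<comment> \<open>The compensation in \<open>up\<close> is at most \<open>exp (p * r)\<close>, the
    factor by which codegrees may grow in one round.\<close>
  have up_le: "up p e \<le> w e * exp (p * real r)" if e: "e \<in> E" for e
    using edges[OF e] p w_nonneg[OF e] by (auto simp: up_def W_edge[OF e] intro!: mult_left_mono)
  have hyp: "weighted_hypergraph X' E' w' r (\<delta> * exp (p * real r))"
  proof
    show "finite X'" by fact
    show "e \<subseteq> X' \<and> 2 \<le> card e \<and> card e \<le> r" if "e \<in> E'" for e
      using that edges by (auto simp: E'_def)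
    show "0 \<le> w' e" if "e \<in> E'" for e using w'(1) that by simp
    show "(\<Sum>e\<in>{e \<in> E'. x \<in> e}. w' e) \<le> 1" if "x \<in> X'" for x using w'(2) that by simp
    show "0 \<le> \<delta> * exp (p * real r)" using codegree_bound_nonneg by simp
    show "1 \<le> r" by (rule rank_pos)
    fix x y assume xy: "x \<in> X'" "y \<in> X'" "x \<noteq> y"
    have "(\<Sum>e\<in>{e \<in> E'. x \<in> e \<and> y \<in> e}. w' e) \<le> (\<Sum>e\<in>{e \<in> E'. x \<in> e \<and> y \<in> e}. w e * exp (p * real r))"
    proof (rule sum_mono)
      fix e assume "e \<in> {e \<in> E'. x \<in> e \<and> y \<in> e}"
      then have "e \<in> E'" "e \<in> E" using E'E by auto
      then show "w' e \<le> w e * exp (p * real r)"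
        using w'(1) up_le[of e] by (meson order_trans)
    qed
    also have "\<dots> \<le> (\<Sum>e\<in>{e \<in> E. x \<in> e \<and> y \<in> e}. w e * exp (p * real r))"
      by (rule sum_mono2) (use E'E finite_E w_nonneg in auto)
    also have "\<dots> = (\<Sum>e\<in>{e \<in> E. x \<in> e \<and> y \<in> e}. w e) * exp (p * real r)"
      by (simp add: sum_distrib_right)
    also have "\<dots> \<le> \<delta> * exp (p * real r)"
      using codegree_le[of x y] xy X'X by (intro mult_right_mono) auto
    finally show "(\<Sum>e\<in>{e \<in> E'. x \<in> e \<and> y \<in> e}. w' e) \<le> \<delta> * exp (p * real r)" .
  qed
  show ?thesis
  proof (intro exI conjI)
    show "chosen R \<subseteq> E" by (auto simp: chosen_def)
    show "pairwise disjnt (chosen R)" by (auto simp: chosen_def pairwise_def disjnt_def)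
    show "\<forall>e\<in>chosen R. e \<inter> X' = {}" by (auto simp: chosen_def X'_def)
    show "E' \<subseteq> E" by fact
    show "weighted_hypergraph X' E' w' r (\<delta> * exp (p * real r))" by fact
    show "?V - (p\<^sup>2 * real r + \<eta> + \<epsilon> * (1 - p / 2)) * real (card X)
         \<le> (\<Sum>e\<in>chosen R. b e) + ((\<Sum>e\<in>E'. b e * w' e) - \<epsilon> * real (card X'))"
      using hR w'(3) unfolding h_def M1 M2 M3 M4 by linarith
  qed
qed

end

section \<open>Iterating the nibble\<close>

lemma weighted_hypergraph_mono:
  "weighted_hypergraph X E w r \<delta> \<Longrightarrow> \<delta> \<le> \<delta>' \<Longrightarrow> weighted_hypergraph X E w r \<delta>'"
  unfolding weighted_hypergraph_def by (safe; (blast | fastforce))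

text \<open>The hypergraph is quantified inside, so its vertex type does not occur in the other
  arguments; the type token fixes it for the whole iteration.\<close>

definition matching_deficit :: "'x itself \<Rightarrow> nat \<Rightarrow> real \<Rightarrow> bool" where
  "matching_deficit _ r \<epsilon> \<longleftrightarrow> (\<exists>\<delta>>0. \<forall>(X :: 'x set) E w b. weighted_hypergraph X E w r \<delta> \<longrightarrow>
     (\<forall>e\<in>E. 0 \<le> b e \<and> b e \<le> 1) \<longrightarrow>
     (\<exists>M\<subseteq>E. pairwise disjnt M \<and> (\<Sum>e\<in>E. b e * w e) - \<epsilon> * real (card X) \<le> (\<Sum>e\<in>M. b e)))"

lemma matching_deficit_one: "matching_deficit TYPE('x) r 1"
  unfolding matching_deficit_def
proof (intro exI[of _ 1] conjI allI impI)
  fix X :: "'x set" and E w and b :: "'x set \<Rightarrow> real"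
  assume hyp: "weighted_hypergraph X E w r 1" and b: "\<forall>e\<in>E. 0 \<le> b e \<and> b e \<le> 1"
  have "(\<Sum>e\<in>E. b e * w e) \<le> card X"
    by (rule weighted_hypergraph.value_le_card[OF hyp]) (use b in auto)
  then show "\<exists>M\<subseteq>E. pairwise disjnt M \<and> (\<Sum>e\<in>E. b e * w e) - 1 * real (card X) \<le> (\<Sum>e\<in>M. b e)"
    by (intro exI[of _ "{}"]) auto
qed simp

text \<open>Of the added term, \<open>r * p\<^sup>2\<close> is the quadratic loss of the round and
  \<open>p\<^sup>2\<close> is the excess allowed per vertex.\<close>

lemma matching_deficit_step:
  assumes md: "matching_deficit TYPE('x) r \<epsilon>" and p: "0 < p" "p \<le> 1" and \<epsilon>: "0 \<le> \<epsilon>"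
  shows "matching_deficit TYPE('x) r (\<epsilon> * (1 - p / 2) + (real r + 1) * p\<^sup>2)"
proof -
  from md[unfolded matching_deficit_def]
  obtain \<delta> where \<delta>: "\<delta> > 0" and IH: "\<forall>(X :: 'x set) E w b. weighted_hypergraph X E w r \<delta> \<longrightarrow>
     (\<forall>e\<in>E. 0 \<le> b e \<and> b e \<le> 1) \<longrightarrow>
     (\<exists>M\<subseteq>E. pairwise disjnt M \<and> (\<Sum>e\<in>E. b e * w e) - \<epsilon> * real (card X) \<le> (\<Sum>e\<in>M. b e))"
    by (elim exE conjE)
  \<comment> \<open>\<open>D\<close> is the discrepancy as a function of the codegree bound. It is
    pushed below the square of the allowed excess \<open>p\<^sup>2\<close>, while \<open>d\<close>
    is also small enough to stay below \<delta> after growing by \<open>exp (p * r)\<close>.\<close>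
  define D where "D d = exp (4 * p * (real r)\<^sup>2 * d) * (1 + real r * d * exp (p * real r)) - 1" for d :: real
  have "(D \<longlongrightarrow> exp (4 * p * (real r)\<^sup>2 * 0) * (1 + real r * 0 * exp (p * real r)) - 1) (at_right 0)"
    unfolding D_def by (intro tendsto_intros)
  then have "(D \<longlongrightarrow> 0) (at_right 0)" by simp
  moreover have "(p\<^sup>2)\<^sup>2 > 0" using p by simp
  ultimately have "\<forall>\<^sub>F d in at_right 0. D d < (p\<^sup>2)\<^sup>2" by (rule order_tendstoD(2))
  moreover have "\<forall>\<^sub>F d in at_right 0. d < \<delta> / exp (p * real r)"
    by (rule order_tendstoD(2)[OF tendsto_ident_at]) (use \<delta> in simp)
  moreover have "\<forall>\<^sub>F d::real in at_right 0. 0 < d" by (rule eventually_at_right_less)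
  ultimately have "\<forall>\<^sub>F d in at_right 0. D d < (p\<^sup>2)\<^sup>2 \<and> d < \<delta> / exp (p * real r) \<and> 0 < d"
    by eventually_elim simp
  then obtain d where d: "D d < (p\<^sup>2)\<^sup>2" "d < \<delta> / exp (p * real r)" "0 < d"
    using eventually_happens'[OF trivial_limit_at_right_real] by blast
  have d\<delta>: "d * exp (p * real r) \<le> \<delta>" using d by (simp add: field_simps)
  show ?thesis
    unfolding matching_deficit_def
  proof (intro exI[of _ d] conjI allI impI)
    fix X :: "'x set" and E w and b :: "'x set \<Rightarrow> real"
    assume hyp: "weighted_hypergraph X E w r d" and b: "\<forall>e\<in>E. 0 \<le> b e \<and> b e \<le> 1"
    interpret weighted_hypergraph X E w r d by fact
    have disc: "discrepancy p \<le> (p\<^sup>2)\<^sup>2" using d(1) by (simp add: discrepancy_def D_def)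
    have "0 < p\<^sup>2" using p by simp
    from nibble_round[where b = b, OF b less_imp_le[OF p(1)] p(2) this disc \<epsilon>]
    obtain M X' E' w' where M: "M \<subseteq> E" "pairwise disjnt M" "\<forall>e\<in>M. e \<inter> X' = {}" and E': "E' \<subseteq> E"
      and hyp': "weighted_hypergraph X' E' w' r (d * exp (p * real r))"
      and val: "(\<Sum>e\<in>E. b e * w e) - (p\<^sup>2 * real r + p\<^sup>2 + \<epsilon> * (1 - p / 2)) * real (card X)
         \<le> (\<Sum>e\<in>M. b e) + ((\<Sum>e\<in>E'. b e * w' e) - \<epsilon> * real (card X'))"
      by (elim exE conjE)
    have "weighted_hypergraph X' E' w' r \<delta>"
      using weighted_hypergraph_mono[OF hyp' d\<delta>] .
    then obtain M' where M': "M' \<subseteq> E'" "pairwise disjnt M'"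
      "(\<Sum>e\<in>E'. b e * w' e) - \<epsilon> * real (card X') \<le> (\<Sum>e\<in>M'. b e)"
      using IH[rule_format, of X' E' w' b] b E' by blast
    have sub: "e \<subseteq> X'" "e \<noteq> {}" if "e \<in> M'" for e
      using M'(1) that weighted_hypergraph.edges[OF hyp', of e] by auto
    then have disj: "M \<inter> M' = {}" using M(3) by fastforce
    have fin: "finite M" "finite M'"
      using M(1) M'(1) E' finite_E finite_subset by (metis, metis)
    show "\<exists>M\<subseteq>E. pairwise disjnt M \<and> (\<Sum>e\<in>E. b e * w e) - (\<epsilon> * (1 - p / 2) + (real r + 1) * p\<^sup>2) * real (card X) \<le> (\<Sum>e\<in>M. b e)"
    proof (intro exI[of _ "M \<union> M'"] conjI)
      show "M \<union> M' \<subseteq> E" using M M' E' by auto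
      show "pairwise disjnt (M \<union> M')"
      proof (rule pairwiseI)
        have cross: "disjnt e g" if "e \<in> M" "g \<in> M'" for e g
          using M(3) sub(1)[OF that(2)] that(1) unfolding disjnt_def by blast
        fix e g assume "e \<in> M \<union> M'" "g \<in> M \<union> M'" "e \<noteq> g"
        then show "disjnt e g"
          using cross pairwiseD[OF M(2)] pairwiseD[OF M'(2)] disjnt_sym by (metis Un_iff)
      qed
      have "sum b (M \<union> M') = sum b M + sum b M'"
        using fin disj by (rule sum.union_disjoint)
      then show "(\<Sum>e\<in>E. b e * w e) - (\<epsilon> * (1 - p / 2) + (real r + 1) * p\<^sup>2) * real (card X) \<le> (\<Sum>e\<in>M \<union> M'. b e)"
        using val M'(3) by (simp add: algebra_simps)
    qed
  qed (rule d)
qed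

lemma matching_deficit_mono:
  assumes "matching_deficit TYPE('x) r \<epsilon>" "\<epsilon> \<le> \<epsilon>'"
  shows "matching_deficit TYPE('x) r \<epsilon>'"
proof -
  from assms(1)[unfolded matching_deficit_def]
  obtain \<delta> where \<delta>: "\<delta> > 0" and md: "\<forall>(X :: 'x set) E w b. weighted_hypergraph X E w r \<delta> \<longrightarrow>
     (\<forall>e\<in>E. 0 \<le> b e \<and> b e \<le> 1) \<longrightarrow>
     (\<exists>M\<subseteq>E. pairwise disjnt M \<and> (\<Sum>e\<in>E. b e * w e) - \<epsilon> * real (card X) \<le> (\<Sum>e\<in>M. b e))"
    by (elim exE conjE)
  show ?thesis
    unfolding matching_deficit_def
  proof (intro exI[of _ \<delta>] conjI allI impI)
    fix X :: "'x set" and E w and b :: "'x set \<Rightarrow> real"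
    assume "weighted_hypergraph X E w r \<delta>" "\<forall>e\<in>E. 0 \<le> b e \<and> b e \<le> 1"
    then have "\<exists>M\<subseteq>E. pairwise disjnt M \<and> (\<Sum>e\<in>E. b e * w e) - \<epsilon> * real (card X) \<le> (\<Sum>e\<in>M. b e)"
      by (rule md[THEN spec, THEN spec, THEN spec, THEN spec, THEN mp, THEN mp])
    then obtain M where "M \<subseteq> E" "pairwise disjnt M" "(\<Sum>e\<in>E. b e * w e) - \<epsilon> * real (card X) \<le> (\<Sum>e\<in>M. b e)"
      by (elim exE conjE)
    moreover have "\<epsilon> * real (card X) \<le> \<epsilon>' * real (card X)"
      using assms(2) by (rule mult_right_mono) simp
    ultimately show "\<exists>M\<subseteq>E. pairwise disjnt M \<and> (\<Sum>e\<in>E. b e * w e) - \<epsilon>' * real (card X) \<le> (\<Sum>e\<in>M. b e)"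
      by (intro exI[of _ M] conjI) linarith+
  qed (rule \<delta>)
qed

theorem nearly_perfect_matching:
  fixes \<epsilon> :: real
  assumes \<epsilon>: "0 < \<epsilon>"
  shows "\<exists>\<delta>>0. \<forall>(X :: 'x set) E w b. weighted_hypergraph X E w r \<delta> \<longrightarrow>
     (\<forall>e\<in>E. 0 \<le> b e \<and> b e \<le> 1) \<longrightarrow>
     (\<exists>M\<subseteq>E. pairwise disjnt M \<and> (\<Sum>e\<in>E. b e * w e) - \<epsilon> * real (card X) \<le> (\<Sum>e\<in>M. b e))"
proof -
  \<comment> \<open>The recursion for the deficit has the fixed point
    \<open>2 * (r + 1) * p\<close>. This \<open>p\<close> makes it at most
    \<open>\<epsilon> / 2\<close>, and the geometric term takes the other half.\<close>
  define p where "p = min 1 (\<epsilon> / (4 * (real r + 1)))"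
  have p: "0 < p" "p \<le> 1" using \<epsilon> by (auto simp: p_def)
  have "matching_deficit TYPE('x) r ((1 - p / 2) ^ j + 2 * (real r + 1) * p)" for j
  proof (induction j)
    case 0
    show ?case
      by (rule matching_deficit_mono[OF matching_deficit_one]) (use p in auto)
  next
    case (Suc j)
    have "matching_deficit TYPE('x) r (((1 - p / 2) ^ j + 2 * (real r + 1) * p) * (1 - p / 2) + (real r + 1) * p\<^sup>2)"
      by (rule matching_deficit_step[OF Suc p]) (use p in auto)
    then show ?case by (simp add: power2_eq_square field_simps)
  qed
  moreover obtain j where "(1 - p / 2) ^ j < \<epsilon> / 2"
    using real_arch_pow_inv[of "\<epsilon> / 2" "1 - p / 2"] \<epsilon> p by auto
  moreover have "2 * (real r + 1) * p \<le> \<epsilon> / 2"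
  proof -
    have "2 * (real r + 1) * p \<le> 2 * (real r + 1) * (\<epsilon> / (4 * (real r + 1)))"
      unfolding p_def by (rule mult_left_mono) auto
    also have "\<dots> = \<epsilon> / 2" by (simp add: divide_simps)
    finally show ?thesis .
  qed
  ultimately have "matching_deficit TYPE('x) r \<epsilon>"
    by (metis (no_types, lifting) add_mono field_sum_of_halves less_imp_le matching_deficit_mono)
  then show ?thesis unfolding matching_deficit_def .
qed

section \<open>Regular partitions\<close>

text \<open>Conditional expectation on the fibres of \<pi>, for the uniform measure on
  \<open>Z\<close>.\<close>

definition avg :: "'z set \<Rightarrow> ('z \<Rightarrow> 'l) \<Rightarrow> ('z \<Rightarrow> real) \<Rightarrow> 'z \<Rightarrow> real" where
  "avg Z \<pi> a z = (\<Sum>z'\<in>{z' \<in> Z. \<pi> z' = \<pi> z}. a z') / real (card {z' \<in> Z. \<pi> z' = \<pi> z})"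

lemma avg_cong_class: "\<pi> z = \<pi> z' \<Longrightarrow> avg Z \<pi> a z = avg Z \<pi> a z'"
  by (simp add: avg_def)

text \<open>Averaging preserves the sum over each fibre, and \<open>g\<close> is constant
  there.\<close>

lemma avg_inner:
  assumes Z: "finite Z" and g: "\<And>z z'. z \<in> Z \<Longrightarrow> z' \<in> Z \<Longrightarrow> \<pi> z = \<pi> z' \<Longrightarrow> g z = g z'"
  shows "(\<Sum>z\<in>Z. g z * avg Z \<pi> a z) = (\<Sum>z\<in>Z. g z * a z)"
proof -
  let ?c = "\<lambda>z. {z' \<in> Z. \<pi> z' = \<pi> z}"
  have "(\<Sum>z\<in>Z. g z * avg Z \<pi> a z) = (\<Sum>z\<in>Z. \<Sum>z'\<in>?c z. g z / real (card (?c z)) * a z')"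
    by (simp add: avg_def sum_distrib_left sum_divide_distrib)
  also have "\<dots> = (\<Sum>z'\<in>Z. \<Sum>z\<in>{z \<in> Z. \<pi> z' = \<pi> z}. g z / real (card (?c z)) * a z')"
    by (rule sum.swap_restrict[OF Z Z])
  also have "\<dots> = (\<Sum>z'\<in>Z. g z' * a z')"
  proof (rule sum.cong[OF refl])
    fix z' assume z': "z' \<in> Z"
    have "(\<Sum>z\<in>{z \<in> Z. \<pi> z' = \<pi> z}. g z / real (card (?c z)) * a z')
        = (\<Sum>z\<in>?c z'. g z' / real (card (?c z')) * a z')"
      using g[OF _ z'] by (intro sum.cong) auto
    also have "\<dots> = g z' * a z'"
    proof -
      have "finite (?c z')" "z' \<in> ?c z'" using Z z' by auto
      then have "card (?c z') \<noteq> 0" by (metis card_eq_0_iff empty_iff)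
      then show ?thesis by simp
    qed
    finally show "(\<Sum>z\<in>{z \<in> Z. \<pi> z' = \<pi> z}. g z / real (card (?c z)) * a z') = g z' * a z'" .
  qed
  finally show ?thesis .
qed

text \<open>The coarse average is the orthogonal projection of the fine one onto the functions that
  are constant on coarse fibres.\<close>

lemma energy_pythagoras:
  assumes Z: "finite Z" and ref: "\<And>z z'. z \<in> Z \<Longrightarrow> z' \<in> Z \<Longrightarrow> \<pi>' z = \<pi>' z' \<Longrightarrow> \<pi> z = \<pi> z'"
  shows "(\<Sum>z\<in>Z. (avg Z \<pi>' a z - avg Z \<pi> a z)\<^sup>2) = (\<Sum>z\<in>Z. (avg Z \<pi>' a z)\<^sup>2) - (\<Sum>z\<in>Z. (avg Z \<pi> a z)\<^sup>2)"
proof -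
  have "(\<Sum>z\<in>Z. avg Z \<pi> a z * avg Z \<pi>' a z) = (\<Sum>z\<in>Z. avg Z \<pi> a z * a z)"
    by (rule avg_inner[OF Z]) (rule avg_cong_class, rule ref)
  also have "\<dots> = (\<Sum>z\<in>Z. avg Z \<pi> a z * avg Z \<pi> a z)"
    by (rule avg_inner[OF Z, symmetric]) (rule avg_cong_class)
  finally have cross: "(\<Sum>z\<in>Z. avg Z \<pi> a z * avg Z \<pi>' a z) = (\<Sum>z\<in>Z. (avg Z \<pi> a z)\<^sup>2)"
    by (simp add: power2_eq_square)
  have "(\<Sum>z\<in>Z. (avg Z \<pi>' a z - avg Z \<pi> a z)\<^sup>2)
      = (\<Sum>z\<in>Z. (avg Z \<pi>' a z)\<^sup>2) + (\<Sum>z\<in>Z. (avg Z \<pi> a z)\<^sup>2) - 2 * (\<Sum>z\<in>Z. avg Z \<pi> a z * avg Z \<pi>' a z)"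
    by (simp add: power2_diff sum.distrib sum_subtractf sum_distrib_left mult_ac)
  then show ?thesis using cross by simp
qed

section \<open>Cut-norm regularity and the energy increment\<close>

definition dens :: "('a \<Rightarrow> 'a \<Rightarrow> real) \<Rightarrow> 'a set \<Rightarrow> 'a set \<Rightarrow> real" where
  "dens a C D = (\<Sum>x\<in>C. \<Sum>y\<in>D. a x y) / (real (card C) * real (card D))"

text \<open>The cut-norm form of regularity: the error is measured against all of \<open>C\<close>
  and \<open>D\<close>, with no size threshold on \<open>A\<close> and \<open>B\<close>. Bilinear
  counting needs nothing stronger.\<close>

definition regular :: "('a \<Rightarrow> 'a \<Rightarrow> real) \<Rightarrow> real \<Rightarrow> 'a set \<Rightarrow> 'a set \<Rightarrow> bool" where
  "regular a \<epsilon> C D \<longleftrightarrow> (\<forall>A B. A \<subseteq> C \<longrightarrow> B \<subseteq> D \<longrightarrow>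
     \<bar>\<Sum>x\<in>A. \<Sum>y\<in>B. (a x y - dens a C D)\<bar> \<le> \<epsilon> * (real (card C) * real (card D)))"

definition cell :: "'a set \<Rightarrow> ('a \<Rightarrow> 'l) \<Rightarrow> 'a \<Rightarrow> 'a set" where
  "cell V p x = {y \<in> V. p y = p x}"

text \<open>The fibres of \<open>label F\<close> are the atoms of the set algebra generated by
  \<open>F\<close>. Refining a partition thus means enlarging \<open>F\<close>, and there are at
  most \<open>2 ^ card F\<close> cells.\<close>

definition label :: "'a set set \<Rightarrow> 'a \<Rightarrow> 'a set set" where
  "label F x = {S \<in> F. x \<in> S}"

lemma label_eq_mono: "F \<subseteq> F' \<Longrightarrow> label F' x = label F' y \<Longrightarrow> label F x = label F y"
  by (auto simp: label_def)

lemma label_eq_iff: "label F x = label F y \<longleftrightarrow> (\<forall>S\<in>F. x \<in> S \<longleftrightarrow> y \<in> S)"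
  by (auto simp: label_def)

lemma avg_pair_eq_dens:
  "avg (V \<times> V) (map_prod p p) (case_prod a) (x, y) = dens a (cell V p x) (cell V p y)"
proof -
  have "{z \<in> V \<times> V. map_prod p p z = map_prod p p (x, y)} = cell V p x \<times> cell V p y"
    by (auto simp: cell_def)
  then show ?thesis
    by (simp add: avg_def dens_def card_cartesian_product sum.cartesian_product)
qed

lemma dens_range:
  assumes "\<And>x y. 0 \<le> a x y \<and> a x y \<le> (1::real)"
  shows "0 \<le> dens a C D" "dens a C D \<le> 1"
proof -
  have "(\<Sum>x\<in>C. \<Sum>y\<in>D. a x y) \<le> (\<Sum>x\<in>C. \<Sum>y\<in>D. 1)"
    using assms by (intro sum_mono) auto
  then show "dens a C D \<le> 1"
    unfolding dens_def by (cases "real (card C) * real (card D) = 0") (auto simp: divide_simps)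
  show "0 \<le> dens a C D"
    unfolding dens_def using assms by (intro divide_nonneg_nonneg sum_nonneg) auto
qed

abbreviation energy :: "'a set \<Rightarrow> ('a \<Rightarrow> 'a \<Rightarrow> real) \<Rightarrow> ('a \<Rightarrow> 'l) \<Rightarrow> real" where
  "energy V a p \<equiv> \<Sum>z\<in>V \<times> V. (avg (V \<times> V) (map_prod p p) (case_prod a) z)\<^sup>2"

lemma energy_le:
  assumes "\<And>x y. 0 \<le> a x y \<and> a x y \<le> (1::real)"
  shows "energy V a p \<le> (real (card V))\<^sup>2"
proof -
  have "energy V a p \<le> (\<Sum>z\<in>V \<times> V. 1)"
    using dens_range[of a] assms by (intro sum_mono) (auto simp: avg_pair_eq_dens power_le_one)
  then show ?thesis by (simp add: power2_eq_square card_cartesian_product)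
qed

text \<open>Counting pairs of vertices instead of pairs of cells weights each pair of cells by its
  size, so the cells need not be equal in size.\<close>

definition irregular_pairs :: "'a set \<Rightarrow> ('a \<Rightarrow> 'a \<Rightarrow> real) \<Rightarrow> real \<Rightarrow> ('a \<Rightarrow> 'l) \<Rightarrow> ('a \<times> 'a) set" where
  "irregular_pairs V a \<epsilon> p = {(x, y) \<in> V \<times> V. \<not> regular a \<epsilon> (cell V p x) (cell V p y)}"

text \<open>Witnesses of irregularity join the family. By Cauchy-Schwarz, every irregular vertex
  pair then gains at least \<open>\<epsilon>\<^sup>2\<close> on average over its pair of cells, and
  there are more than \<open>\<epsilon> * (real (card V))\<^sup>2\<close> such pairs.\<close>

lemma energy_increment:
  assumes V: "finite V" and \<epsilon>: "0 < \<epsilon>" and F: "finite F"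
    and irr: "\<epsilon> * (real (card V))\<^sup>2 < real (card (irregular_pairs V a \<epsilon> (label F)))"
  shows "\<exists>F'. F \<subseteq> F' \<and> finite F' \<and> card F' \<le> card F + 2 * (2 ^ card F * 2 ^ card F)
    \<and> energy V a (label F) + \<epsilon> ^ 3 * (real (card V))\<^sup>2 \<le> energy V a (label F')"
proof -
  let ?p = "label F" and ?Z = "V \<times> V"
  define W where "W = (\<lambda>C D. SOME (A, B). A \<subseteq> C \<and> B \<subseteq> D \<and>
     \<epsilon> * (real (card C) * real (card D)) < \<bar>\<Sum>x\<in>A. \<Sum>y\<in>B. (a x y - dens a C D)\<bar>)"
  have W: "fst (W C D) \<subseteq> C \<and> snd (W C D) \<subseteq> D \<and>
     \<epsilon> * (real (card C) * real (card D)) < \<bar>\<Sum>x\<in>fst (W C D). \<Sum>y\<in>snd (W C D). (a x y - dens a C D)\<bar>"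
    if irreg: "\<not> regular a \<epsilon> C D" for C D
  proof -
    obtain A B where "A \<subseteq> C" "B \<subseteq> D" "\<epsilon> * (real (card C) * real (card D)) < \<bar>\<Sum>x\<in>A. \<Sum>y\<in>B. (a x y - dens a C D)\<bar>"
      using irreg unfolding regular_def by (meson not_le)
    then have "\<exists>z. case z of (A, B) \<Rightarrow> A \<subseteq> C \<and> B \<subseteq> D \<and>
     \<epsilon> * (real (card C) * real (card D)) < \<bar>\<Sum>x\<in>A. \<Sum>y\<in>B. (a x y - dens a C D)\<bar>" by auto
    from someI_ex[OF this] show ?thesis unfolding W_def by (simp add: case_prod_unfold)
  qed
  define P where "P = cell V ?p ` V"
  have cardP: "finite P" "card P \<le> 2 ^ card F"
  proof -
    have "P \<subseteq> (\<lambda>l. {y \<in> V. ?p y = l}) ` Pow F"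
      by (auto simp: P_def cell_def label_def)
    moreover have "finite ((\<lambda>l. {y \<in> V. ?p y = l}) ` Pow F)" using F by simp
    moreover have "card ((\<lambda>l. {y \<in> V. ?p y = l}) ` Pow F) \<le> 2 ^ card F"
      using card_image_le[of "Pow F"] F by (simp add: card_Pow)
    ultimately show "finite P" "card P \<le> 2 ^ card F"
      using finite_subset card_mono order_trans by (blast, meson)
  qed
  \<comment> \<open>Both witnesses for every pair of cells. For regular pairs \<open>W\<close> is an
    arbitrary choice, and enlarging the family by it does no harm.\<close>
  define F' where "F' = F \<union> (case_prod (\<lambda>C D. fst (W C D)) ` (P \<times> P) \<union> case_prod (\<lambda>C D. snd (W C D)) ` (P \<times> P))"
  let ?p' = "label F'"
  have finF': "finite F'" using F cardP by (simp add: F'_def)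
  have "card F' \<le> card F + (card (P \<times> P) + card (P \<times> P))"
    unfolding F'_def using cardP
    by (intro order_trans[OF card_Un_le] add_left_mono add_mono card_image_le) auto
  also have "card (P \<times> P) \<le> 2 ^ card F * 2 ^ card F"
    unfolding card_cartesian_product using cardP by (intro mult_le_mono) auto
  finally have cardF': "card F' \<le> card F + 2 * (2 ^ card F * 2 ^ card F)" by simp
  define u where "u z = avg ?Z (map_prod ?p' ?p') (case_prod a) z - avg ?Z (map_prod ?p ?p) (case_prod a) z" for z
  have finZ: "finite ?Z" using V by simp
  have gain: "\<epsilon>\<^sup>2 \<le> avg ?Z (map_prod ?p ?p) (\<lambda>z. (u z)\<^sup>2) (x, y)" if xy: "(x, y) \<in> irregular_pairs V a \<epsilon> ?p" for x y
  proof -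
    define C where "C = cell V ?p x"
    define D where "D = cell V ?p y"
    have CD: "C \<in> P" "D \<in> P" "\<not> regular a \<epsilon> C D" "x \<in> C" "y \<in> D" "C \<subseteq> V" "D \<subseteq> V"
      using xy by (auto simp: irregular_pairs_def C_def D_def P_def cell_def)
    have finCD: "finite C" "finite D" using CD V finite_subset by auto
    have pos: "0 < real (card C) * real (card D)"
      using finCD CD(4,5) card_gt_0_iff[of C] card_gt_0_iff[of D] by auto
    obtain A B where AB: "A \<subseteq> C" "B \<subseteq> D" "A \<in> F'" "B \<in> F'"
      and big: "\<epsilon> * (real (card C) * real (card D)) < \<bar>\<Sum>x\<in>A. \<Sum>y\<in>B. (a x y - dens a C D)\<bar>"
    proof
      show "fst (W C D) \<subseteq> C" "snd (W C D) \<subseteq> D" using W[OF CD(3)] by auto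
      show "fst (W C D) \<in> F'" "snd (W C D) \<in> F'" using CD(1,2) by (auto simp: F'_def image_iff)
      show "\<epsilon> * (real (card C) * real (card D)) < \<bar>\<Sum>x\<in>fst (W C D). \<Sum>y\<in>snd (W C D). (a x y - dens a C D)\<bar>"
        using W[OF CD(3)] by auto
    qed
    have ABsub: "A \<times> B \<subseteq> C \<times> D" "C \<times> D \<subseteq> ?Z" using AB CD by auto
    have ind: "(\<Sum>z\<in>?Z. of_bool (z \<in> A \<times> B) * h z) = (\<Sum>z\<in>A \<times> B. h z)" for h :: "_ \<Rightarrow> real"
      using finZ ABsub by (intro sum.mono_neutral_cong_right) auto
    \<comment> \<open>\<open>A\<close> and \<open>B\<close> belong to the new family, so the
      indicator of \<open>A \<times> B\<close> is constant on the new fibres and the fine average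
      has the correct sum there.\<close>
    have "(\<Sum>z\<in>A \<times> B. avg ?Z (map_prod ?p' ?p') (case_prod a) z) = (\<Sum>z\<in>A \<times> B. case_prod a z)"
      unfolding ind[symmetric]
    proof (rule avg_inner[OF finZ])
      fix z z' :: "'a \<times> 'a" assume "map_prod ?p' ?p' z = map_prod ?p' ?p' z'"
      then have "label F' (fst z) = label F' (fst z')" "label F' (snd z) = label F' (snd z')"
        by (auto simp: map_prod_def case_prod_unfold)
      then have "fst z \<in> A \<longleftrightarrow> fst z' \<in> A" "snd z \<in> B \<longleftrightarrow> snd z' \<in> B"
        using AB by (auto simp: label_eq_iff)
      then show "of_bool (z \<in> A \<times> B) = (of_bool (z' \<in> A \<times> B) :: real)"
        by (simp add: mem_Times_iff)
    qed
    moreover have "(\<Sum>z\<in>A \<times> B. avg ?Z (map_prod ?p ?p) (case_prod a) z) = (\<Sum>z\<in>A \<times> B. dens a C D)"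
    proof (rule sum.cong[OF refl])
      fix z assume "z \<in> A \<times> B"
      then have "fst z \<in> C" "snd z \<in> D" using AB by auto
      then have "cell V ?p (fst z) = C" "cell V ?p (snd z) = D"
        by (auto simp: C_def D_def cell_def)
      then show "avg ?Z (map_prod ?p ?p) (case_prod a) z = dens a C D"
        using avg_pair_eq_dens[of V ?p a "fst z" "snd z"] by simp
    qed
    ultimately have "(\<Sum>z\<in>A \<times> B. u z) = (\<Sum>z\<in>A \<times> B. case_prod a z - dens a C D)"
      by (simp add: u_def sum_subtractf)
    also have "\<dots> = (\<Sum>x\<in>A. \<Sum>y\<in>B. (a x y - dens a C D))"
      by (simp add: sum.cartesian_product case_prod_unfold)
    finally have "\<epsilon> * (real (card C) * real (card D)) < \<bar>\<Sum>z\<in>A \<times> B. u z\<bar>" using big by simp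
    then have "(\<epsilon> * (real (card C) * real (card D)))\<^sup>2 \<le> \<bar>\<Sum>z\<in>A \<times> B. u z\<bar>\<^sup>2"
      using \<epsilon> by (intro power_mono) auto
    also have "\<dots> = (\<Sum>z\<in>A \<times> B. u z)\<^sup>2" by simp
    also have "\<dots> \<le> (\<Sum>z\<in>A \<times> B. (u z)\<^sup>2) * real (card (A \<times> B))"
      using sum_squared_le_sum_of_squares[of u "A \<times> B"] by (simp add: mult.commute)
    also have "\<dots> \<le> (\<Sum>z\<in>C \<times> D. (u z)\<^sup>2) * real (card (C \<times> D))"
      using ABsub finCD by (intro mult_mono sum_mono2 of_nat_mono card_mono sum_nonneg) auto
    finally have "(\<epsilon>\<^sup>2 * (real (card C) * real (card D))) * (real (card C) * real (card D))
        \<le> (\<Sum>z\<in>C \<times> D. (u z)\<^sup>2) * (real (card C) * real (card D))"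
      by (simp add: power2_eq_square card_cartesian_product mult_ac)
    then have "\<epsilon>\<^sup>2 * (real (card C) * real (card D)) \<le> (\<Sum>z\<in>C \<times> D. (u z)\<^sup>2)"
      using pos by (simp add: mult_le_cancel_right)
    moreover have "{z' \<in> ?Z. map_prod ?p ?p z' = map_prod ?p ?p (x, y)} = C \<times> D"
      by (auto simp: C_def D_def cell_def)
    ultimately show ?thesis
      using pos by (simp add: avg_def card_cartesian_product pos_le_divide_eq)
  qed
  have "\<epsilon>\<^sup>2 * (\<epsilon> * (real (card V))\<^sup>2) \<le> \<epsilon>\<^sup>2 * real (card (irregular_pairs V a \<epsilon> ?p))"
    using irr by (intro mult_left_mono) auto
  also have "\<dots> = (\<Sum>z\<in>irregular_pairs V a \<epsilon> ?p. \<epsilon>\<^sup>2)" by simp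
  also have "\<dots> \<le> (\<Sum>z\<in>irregular_pairs V a \<epsilon> ?p. avg ?Z (map_prod ?p ?p) (\<lambda>z. (u z)\<^sup>2) z)"
    using gain by (intro sum_mono) auto
  also have "\<dots> \<le> (\<Sum>z\<in>?Z. avg ?Z (map_prod ?p ?p) (\<lambda>z. (u z)\<^sup>2) z)"
    using finZ by (intro sum_mono2) (auto simp: irregular_pairs_def avg_def intro!: divide_nonneg_nonneg sum_nonneg)
  also have "\<dots> = (\<Sum>z\<in>?Z. (u z)\<^sup>2)"
    using avg_inner[OF finZ, of "map_prod ?p ?p" "\<lambda>_. 1" "\<lambda>z. (u z)\<^sup>2"] by simp
  also have "\<dots> = energy V a ?p' - energy V a ?p"
    unfolding u_def
  proof (rule energy_pythagoras[OF finZ])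
    fix z z' :: "'a \<times> 'a" assume eq: "map_prod ?p' ?p' z = map_prod ?p' ?p' z'"
    have "F \<subseteq> F'" by (simp add: F'_def)
    note mono = label_eq_mono[OF this]
    have "label F (fst z) = label F (fst z')" "label F (snd z) = label F (snd z')"
      by (rule mono, use eq in \<open>simp add: map_prod_def case_prod_unfold\<close>)+
    then show "map_prod ?p ?p z = map_prod ?p ?p z'"
      by (simp add: map_prod_def case_prod_unfold)
  qed
  finally have "energy V a ?p + \<epsilon> ^ 3 * (real (card V))\<^sup>2 \<le> energy V a ?p'"
    by (simp add: power2_eq_square power3_eq_cube algebra_simps)
  moreover have "F \<subseteq> F'" by (simp add: F'_def)
  ultimately show ?thesis using finF' cardF' by blast
qed

lemma regularity_family:
  assumes \<epsilon>: "0 < \<epsilon>"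
  shows "\<exists>N. \<forall>(V :: 'a set) a F0. finite V \<longrightarrow> (\<forall>x y. 0 \<le> a x y \<and> a x y \<le> 1) \<longrightarrow> finite F0 \<longrightarrow> card F0 \<le> m \<longrightarrow>
    (\<exists>F :: 'a set set. F0 \<subseteq> F \<and> finite F \<and> card F \<le> N \<and>
      real (card (irregular_pairs V a \<epsilon> (label F))) \<le> \<epsilon> * (real (card V))\<^sup>2)"
proof -
  define g where "g k = k + 2 * (2 ^ k * 2 ^ k)" for k :: nat
  have g_mono: "g k \<le> g l" if "k \<le> l" for k l
    using that unfolding g_def by (intro add_mono mult_le_mono power_increasing) auto
  have g_ge: "k \<le> g k" for k by (simp add: g_def)
  \<comment> \<open>Each failure raises the energy by \<open>\<epsilon> ^ 3\<close> times the
    squared number of vertices. As the energy never exceeds that square, fewer than \<open>J\<close>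
    failures are possible.\<close>
  obtain J :: nat where J: "1 / \<epsilon> ^ 3 < real J" using reals_Archimedean2 by auto
  then have J': "1 < real J * \<epsilon> ^ 3" using \<epsilon> by (simp add: field_simps)
  show ?thesis
  proof (intro exI[of _ "(g ^^ J) m"] allI impI)
    fix V :: "'a set" and a :: "'a \<Rightarrow> 'a \<Rightarrow> real" and F0 :: "'a set set"
    assume V: "finite V" and a: "\<forall>x y. 0 \<le> a x y \<and> a x y \<le> 1" and F0: "finite F0" "card F0 \<le> m"
    let ?good = "\<lambda>F :: 'a set set. real (card (irregular_pairs V a \<epsilon> (label F))) \<le> \<epsilon> * (real (card V))\<^sup>2"
    have "\<exists>F :: 'a set set. F0 \<subseteq> F \<and> finite F \<and> card F \<le> (g ^^ j) m \<and>
        (?good F \<or> real j * \<epsilon> ^ 3 * (real (card V))\<^sup>2 \<le> energy V a (label F))" for j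
    proof (induction j)
      case 0
      show ?case using F0 by (intro exI[of _ F0]) (auto intro: sum_nonneg)
    next
      case (Suc j)
      then obtain F where F: "F0 \<subseteq> F" "finite F" "card F \<le> (g ^^ j) m"
        and alt: "?good F \<or> real j * \<epsilon> ^ 3 * (real (card V))\<^sup>2 \<le> energy V a (label F)" by blast
      show ?case
      proof (cases "?good F")
        case True
        then show ?thesis using F g_ge[of "(g ^^ j) m"] by (intro exI[of _ F]) auto
      next
        case False
        then obtain F' where F': "F \<subseteq> F'" "finite F'" "card F' \<le> g (card F)"
          "energy V a (label F) + \<epsilon> ^ 3 * (real (card V))\<^sup>2 \<le> energy V a (label F')"
          using energy_increment[OF V \<epsilon> F(2), of a] unfolding g_def by (metis not_le)
        have "card F' \<le> (g ^^ Suc j) m"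
          using F'(3) g_mono[OF F(3)] by simp
        moreover have "real (Suc j) * \<epsilon> ^ 3 * (real (card V))\<^sup>2 \<le> energy V a (label F')"
          using False alt F'(4) by (simp add: algebra_simps)
        ultimately show ?thesis using F F' by (intro exI[of _ F']) auto
      qed
    qed
    then obtain F where F: "F0 \<subseteq> F" "finite F" "card F \<le> (g ^^ J) m"
      and alt: "?good F \<or> real J * \<epsilon> ^ 3 * (real (card V))\<^sup>2 \<le> energy V a (label F)" by blast
    have "?good F"
    proof (cases "V = {}")
      case True
      then show ?thesis by (simp add: irregular_pairs_def)
    next
      case False
      then have "0 < (real (card V))\<^sup>2" using V by (simp add: card_gt_0_iff)
      then have "1 * (real (card V))\<^sup>2 < real J * \<epsilon> ^ 3 * (real (card V))\<^sup>2"
        using J' by (intro mult_strict_right_mono) auto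
      then show ?thesis using alt energy_le[of a V "label F"] a by auto
    qed
    then show "\<exists>F. F0 \<subseteq> F \<and> finite F \<and> card F \<le> (g ^^ J) m \<and> ?good F" using F by blast
  qed
qed

lemma card_residue_class_le: "card {k. k < n \<and> k mod m = j} \<le> n div m + 1"
proof -
  have "inj_on (\<lambda>k. k div m) {k. k < n \<and> k mod m = j}"
    by (rule inj_onI) (metis (mono_tags, lifting) div_mult_mod_eq mem_Collect_eq)
  moreover have "(\<lambda>k. k div m) ` {k. k < n \<and> k mod m = j} \<subseteq> {..n div m}"
    by (auto intro: div_le_mono)
  ultimately have "card {k. k < n \<and> k mod m = j} \<le> card {..n div m}"
    by (intro card_inj_on_le) auto
  then show ?thesis by simp
qed

text \<open>The vertices are numbered and split by residue modulo \<open>m\<close>. With these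
  classes in the family every later cell is small, so few pairs lie inside one cell; such pairs
  spoil the cliques that should meet each cell at most once.\<close>

lemma exists_chunks:
  assumes V: "finite V" and m: "0 < (m::nat)"
  shows "\<exists>F0. finite F0 \<and> card F0 \<le> m \<and> (\<forall>F. F0 \<subseteq> F \<longrightarrow>
    real (card {(x, y) \<in> V \<times> V. label F x = label F y}) \<le> real (card V) * (real (card V) / real m + 1))"
proof -
  obtain h :: "'a \<Rightarrow> nat" where h: "bij_betw h V {..<card V}"
    using ex_bij_betw_finite_nat[OF V] by (auto simp: atLeast0LessThan)
  let ?S = "\<lambda>j. {x \<in> V. h x mod m = j}"
  define F0 where "F0 = ?S ` {..<m}"
  have S: "real (card (?S j)) \<le> real (card V) / real m + 1" for j
  proof -
    have "inj_on h (?S j)" using h by (auto simp: bij_betw_def inj_on_def)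
    moreover have "h ` ?S j \<subseteq> {k. k < card V \<and> k mod m = j}"
      using h by (auto simp: bij_betw_def)
    ultimately have "card (?S j) \<le> card {k. k < card V \<and> k mod m = j}"
      by (intro card_inj_on_le) auto
    also have "\<dots> \<le> card V div m + 1" by (rule card_residue_class_le)
    finally have "real (card (?S j)) \<le> real (card V div m) + 1" by linarith
    moreover have "real (card V div m) \<le> real (card V) / real m"
    proof -
      have "real (card V div m * m) \<le> real (card V)"
        by (simp only: of_nat_le_iff div_times_less_eq_dividend)
      then show ?thesis using m by (simp add: field_simps)
    qed
    ultimately show ?thesis by linarith
  qed
  show ?thesis
  proof (intro exI[of _ F0] conjI allI impI)
    show "finite F0" by (simp add: F0_def)
    show "card F0 \<le> m" using card_image_le[of "{..<m}" ?S] by (simp add: F0_def)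
    fix F assume F: "F0 \<subseteq> F"
    have "{(x, y) \<in> V \<times> V. label F x = label F y} \<subseteq> Sigma V (\<lambda>x. ?S (h x mod m))"
    proof (rule subsetI)
      fix z assume "z \<in> {(x, y) \<in> V \<times> V. label F x = label F y}"
      then obtain x y where z: "z = (x, y)" and xy: "x \<in> V" "y \<in> V" "label F x = label F y" by auto
      have "\<forall>S\<in>F. x \<in> S \<longleftrightarrow> y \<in> S" using xy(3) by (simp only: label_eq_iff)
      moreover have "?S (h x mod m) \<in> F" using F m by (auto simp: F0_def)
      ultimately have "x \<in> ?S (h x mod m) \<longleftrightarrow> y \<in> ?S (h x mod m)" by (rule bspec)
      then show "z \<in> Sigma V (\<lambda>x. ?S (h x mod m))" using xy z by simp
    qed
    then have "card {(x, y) \<in> V \<times> V. label F x = label F y} \<le> card (Sigma V (\<lambda>x. ?S (h x mod m)))"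
      using V by (intro card_mono) auto
    also have "\<dots> = (\<Sum>x\<in>V. card (?S (h x mod m)))" using V by (intro card_SigmaI) auto
    finally have "real (card {(x, y) \<in> V \<times> V. label F x = label F y}) \<le> (\<Sum>x\<in>V. real (card (?S (h x mod m))))"
      by (simp only: of_nat_sum[symmetric] of_nat_le_iff)
    also have "\<dots> \<le> (\<Sum>x\<in>V. real (card V) / real m + 1)" by (intro sum_mono S)
    finally show "real (card {(x, y) \<in> V \<times> V. label F x = label F y}) \<le> real (card V) * (real (card V) / real m + 1)"
      by simp
  qed
qed

text \<open>The refinement starts from more than \<open>1 / \<epsilon>\<close> residue classes.
  Cells are then renamed by natural numbers below a bound independent of \<open>V\<close>; the order
  of the names later orients the pairs of a pattern.\<close>

lemma regular_partition:
  assumes \<epsilon>: "0 < \<epsilon>"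
  shows "\<exists>K>0. \<forall>(V :: 'a set) a. finite V \<longrightarrow> (\<forall>x y. 0 \<le> a x y \<and> a x y \<le> 1) \<longrightarrow>
    (\<exists>p :: 'a \<Rightarrow> nat. p ` V \<subseteq> {..<K} \<and>
      real (card (irregular_pairs V a \<epsilon> p)) \<le> \<epsilon> * (real (card V))\<^sup>2 \<and>
      real (card {(x, y) \<in> V \<times> V. p x = p y}) \<le> \<epsilon> * (real (card V))\<^sup>2 + real (card V))"
proof -
  obtain m :: nat where m: "1 / \<epsilon> < real m" using reals_Archimedean2 by auto
  have m0: "0 < m" using m \<epsilon> by (metis divide_pos_pos gr0I less_asym of_nat_0 zero_less_one)
  from regularity_family[OF \<epsilon>, where 'a = 'a and m = m] obtain N where
    N: "\<forall>(V :: 'a set) a F0. finite V \<longrightarrow> (\<forall>x y. 0 \<le> a x y \<and> a x y \<le> 1) \<longrightarrow> finite F0 \<longrightarrow> card F0 \<le> m \<longrightarrow>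
    (\<exists>F :: 'a set set. F0 \<subseteq> F \<and> finite F \<and> card F \<le> N \<and>
      real (card (irregular_pairs V a \<epsilon> (label F))) \<le> \<epsilon> * (real (card V))\<^sup>2)" by (elim exE)
  show ?thesis
  proof (intro exI[of _ "2 ^ N"] conjI allI impI)
    fix V :: "'a set" and a :: "'a \<Rightarrow> 'a \<Rightarrow> real"
    assume V: "finite V" and a: "\<forall>x y. 0 \<le> a x y \<and> a x y \<le> 1"
    obtain F0 :: "'a set set" where F0: "finite F0" "card F0 \<le> m" and chunks: "\<And>F. F0 \<subseteq> F \<Longrightarrow>
      real (card {(x, y) \<in> V \<times> V. label F x = label F y}) \<le> real (card V) * (real (card V) / real m + 1)"
      using exists_chunks[OF V m0] by auto
    obtain F where F: "F0 \<subseteq> F" "finite F" "card F \<le> N"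
      and irr: "real (card (irregular_pairs V a \<epsilon> (label F))) \<le> \<epsilon> * (real (card V))\<^sup>2"
      using N[rule_format, of V a F0] V a F0 by auto
    have finL: "finite (label F ` V)" using V by simp
    have cardL: "card (label F ` V) \<le> 2 ^ N"
    proof -
      have "card (label F ` V) \<le> card (Pow F)"
        using F by (intro card_mono) (auto simp: label_def)
      also have "\<dots> \<le> 2 ^ N" using F by (simp add: card_Pow)
      finally show ?thesis .
    qed
    obtain g :: "'a set set \<Rightarrow> nat" where g: "bij_betw g (label F ` V) {..<card (label F ` V)}"
      using ex_bij_betw_finite_nat[OF finL] by (auto simp: atLeast0LessThan)
    let ?p = "\<lambda>x. g (label F x)"
    have p_eq: "?p x = ?p y \<longleftrightarrow> label F x = label F y" if "x \<in> V" "y \<in> V" for x y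
      using g that by (auto simp: bij_betw_def inj_on_def)
    have cells: "cell V ?p x = cell V (label F) x" if "x \<in> V" for x
      using that by (auto simp: cell_def p_eq)
    have "irregular_pairs V a \<epsilon> ?p = irregular_pairs V a \<epsilon> (label F)"
      by (auto simp: irregular_pairs_def cells)
    moreover have "{(x, y) \<in> V \<times> V. ?p x = ?p y} = {(x, y) \<in> V \<times> V. label F x = label F y}"
      by (auto simp: p_eq)
    moreover have "real (card V) * (real (card V) / real m + 1) \<le> \<epsilon> * (real (card V))\<^sup>2 + real (card V)"
    proof -
      have "1 / real m \<le> \<epsilon>" using m m0 \<epsilon> by (simp add: field_simps)
      then have "(real (card V))\<^sup>2 * (1 / real m) \<le> (real (card V))\<^sup>2 * \<epsilon>" by (rule mult_left_mono) simp
      then show ?thesis by (simp add: power2_eq_square algebra_simps)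
    qed
    moreover have "?p ` V \<subseteq> {..<2 ^ N}"
    proof (rule image_subsetI)
      fix x assume "x \<in> V"
      then have "?p x \<in> {..<card (label F ` V)}" using bij_betwE[OF g] by simp
      then show "?p x \<in> {..<2 ^ N}" using cardL by simp
    qed
    ultimately show "\<exists>p :: 'a \<Rightarrow> nat. p ` V \<subseteq> {..<2 ^ N} \<and>
      real (card (irregular_pairs V a \<epsilon> p)) \<le> \<epsilon> * (real (card V))\<^sup>2 \<and>
      real (card {(x, y) \<in> V \<times> V. p x = p y}) \<le> \<epsilon> * (real (card V))\<^sup>2 + real (card V)"
      using irr chunks[OF F(1)] by (intro exI[of _ ?p]) auto
  qed simp
qed

section \<open>The counting lemma through bilinear estimates\<close>

lemma abs_sum_le_two_parts:
  fixes v h :: "'a \<Rightarrow> real"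
  assumes B: "finite B" and v: "\<And>y. \<bar>v y\<bar> \<le> 1" and \<beta>: "\<And>B'. B' \<subseteq> B \<Longrightarrow> \<bar>\<Sum>y\<in>B'. h y\<bar> \<le> \<beta>"
  shows "\<bar>\<Sum>y\<in>B. v y * h y\<bar> \<le> 2 * \<beta>"
proof -
  let ?P = "{y \<in> B. 0 \<le> h y}" and ?N = "{y \<in> B. \<not> 0 \<le> h y}"
  have "\<bar>\<Sum>y\<in>B. v y * h y\<bar> \<le> (\<Sum>y\<in>B. \<bar>v y\<bar> * \<bar>h y\<bar>)"
    using sum_abs[of "\<lambda>y. v y * h y" B] by (simp add: abs_mult)
  also have "\<dots> \<le> (\<Sum>y\<in>B. \<bar>h y\<bar>)"
    using v by (intro sum_mono) (simp add: mult_left_le_one_le)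
  also have "\<dots> = (\<Sum>y\<in>?P. \<bar>h y\<bar>) + (\<Sum>y\<in>?N. \<bar>h y\<bar>)"
    using B by (rule sum.Int_Diff[of B "\<lambda>y. \<bar>h y\<bar>" "{y. 0 \<le> h y}", THEN trans]) (simp add: Int_def set_diff_eq)
  also have "(\<Sum>y\<in>?P. \<bar>h y\<bar>) = (\<Sum>y\<in>?P. h y)" by (intro sum.cong) auto
  also have "(\<Sum>y\<in>?N. \<bar>h y\<bar>) = - (\<Sum>y\<in>?N. h y)"
    unfolding sum_negf[symmetric] by (intro sum.cong) auto
  finally show ?thesis using \<beta>[of ?P] \<beta>[of ?N] by (auto simp: abs_le_iff)
qed

text \<open>The one-variable bound, which splits by the sign of the summand, is applied in each
  coordinate; hence the factor 4. This passes from sets, as in \<open>regular\<close>, to bounded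
  functions.\<close>

lemma abs_bilinear_le:
  fixes u v :: "'a \<Rightarrow> real"
  assumes A: "finite A" and B: "finite B" and u: "\<And>x. \<bar>u x\<bar> \<le> 1" and v: "\<And>y. \<bar>v y\<bar> \<le> 1"
    and \<beta>: "\<And>A' B'. A' \<subseteq> A \<Longrightarrow> B' \<subseteq> B \<Longrightarrow> \<bar>\<Sum>x\<in>A'. \<Sum>y\<in>B'. b x y\<bar> \<le> \<beta>"
  shows "\<bar>\<Sum>x\<in>A. \<Sum>y\<in>B. u x * v y * b x y\<bar> \<le> 4 * \<beta>"
proof -
  have "\<bar>\<Sum>x\<in>A'. \<Sum>y\<in>B. v y * b x y\<bar> \<le> 2 * \<beta>" if A': "A' \<subseteq> A" for A'
  proof -
    have "\<bar>\<Sum>y\<in>B. v y * (\<Sum>x\<in>A'. b x y)\<bar> \<le> 2 * \<beta>"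
    proof (rule abs_sum_le_two_parts[OF B v])
      fix B' assume "B' \<subseteq> B"
      from \<beta>[OF A' this] show "\<bar>\<Sum>y\<in>B'. \<Sum>x\<in>A'. b x y\<bar> \<le> \<beta>"
        by (subst sum.swap)
    qed
    also have "(\<Sum>y\<in>B. v y * (\<Sum>x\<in>A'. b x y)) = (\<Sum>x\<in>A'. \<Sum>y\<in>B. v y * b x y)"
      unfolding sum_distrib_left by (rule sum.swap)
    finally show ?thesis .
  qed
  then have "\<bar>\<Sum>x\<in>A. u x * (\<Sum>y\<in>B. v y * b x y)\<bar> \<le> 2 * (2 * \<beta>)"
    by (rule abs_sum_le_two_parts[OF A u])
  then show ?thesis by (simp add: sum_distrib_left mult.assoc)
qed

lemma sum_PiE_insert:
  assumes "i \<notin> I"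
  shows "(\<Sum>\<phi>\<in>PiE (insert i I) C. H \<phi>) = (\<Sum>x\<in>C i. \<Sum>\<psi>\<in>PiE I C. H (\<psi>(i := x)))"
proof -
  have "inj_on (\<lambda>(y, g). g(i := y)) (C i \<times> PiE I C)"
  proof (rule inj_onI, clarify)
    fix x g y h assume g: "g \<in> PiE I C" "h \<in> PiE I C" and eq: "g(i := x) = h(i := y)"
    have "x = y" using fun_cong[OF eq, of i] by simp
    moreover have "g k = h k" for k
      using fun_cong[OF eq, of k] g assms by (cases "k = i") (auto simp: PiE_def extensional_def)
    ultimately show "x = y \<and> g = h" by auto
  qed
  then show ?thesis
    unfolding PiE_insert_eq by (simp add: sum.reindex sum.cartesian_product case_prod_unfold)
qed

text \<open>With the other coordinates frozen, \<open>F\<close> is a bounded product test function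
  in the coordinates \<open>i\<close> and \<open>j\<close>, the kind that cut-norm regularity
  controls.\<close>

definition separable :: "'i \<Rightarrow> 'i \<Rightarrow> (('i \<Rightarrow> 'a) \<Rightarrow> real) \<Rightarrow> bool" where
  "separable i j F \<longleftrightarrow> (\<forall>\<phi>. \<exists>u v. (\<forall>x. \<bar>u x\<bar> \<le> 1) \<and> (\<forall>y. \<bar>v y\<bar> \<le> 1) \<and> (\<forall>x y. F (\<phi>(i := x, j := y)) = u x * v y))"

lemma separable_mult:
  assumes "separable i j F" "separable i j G"
  shows "separable i j (\<lambda>\<phi>. F \<phi> * G \<phi>)"
  unfolding separable_def
proof
  fix \<phi>
  obtain u v where uv: "\<forall>x. \<bar>u x\<bar> \<le> 1" "\<forall>y. \<bar>v y\<bar> \<le> 1" "\<forall>x y. F (\<phi>(i := x, j := y)) = u x * v y"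
    using assms(1) unfolding separable_def by meson
  obtain u' v' where uv': "\<forall>x. \<bar>u' x\<bar> \<le> 1" "\<forall>y. \<bar>v' y\<bar> \<le> 1" "\<forall>x y. G (\<phi>(i := x, j := y)) = u' x * v' y"
    using assms(2) unfolding separable_def by meson
  show "\<exists>u v. (\<forall>x. \<bar>u x\<bar> \<le> 1) \<and> (\<forall>y. \<bar>v y\<bar> \<le> 1) \<and> (\<forall>x y. F (\<phi>(i := x, j := y)) * G (\<phi>(i := x, j := y)) = u x * v y)"
    by (rule exI[of _ "\<lambda>x. u x * u' x"], rule exI[of _ "\<lambda>y. v y * v' y"])
       (use uv uv' in \<open>auto simp: abs_mult intro!: mult_le_one\<close>)
qed

lemma separable_indep:
  assumes F: "\<And>\<phi>. \<bar>F \<phi>\<bar> \<le> 1" and ind: "(\<forall>\<phi> x. F (\<phi>(i := x)) = F \<phi>) \<or> (\<forall>\<phi> y. F (\<phi>(j := y)) = F \<phi>)"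
  shows "separable i j F"
  unfolding separable_def
proof
  fix \<phi>
  consider "i = j" | "i \<noteq> j" "\<forall>\<phi> x. F (\<phi>(i := x)) = F \<phi>" | "i \<noteq> j" "\<forall>\<phi> y. F (\<phi>(j := y)) = F \<phi>"
    using ind by blast
  then show "\<exists>u v. (\<forall>x. \<bar>u x\<bar> \<le> 1) \<and> (\<forall>y. \<bar>v y\<bar> \<le> 1) \<and> (\<forall>x y. F (\<phi>(i := x, j := y)) = u x * v y)"
  proof cases
    case 1
    then show ?thesis
      by (intro exI[of _ "\<lambda>_. 1"] exI[of _ "\<lambda>y. F (\<phi>(j := y))"]) (use F in auto)
  next
    case 2
    have "F (\<phi>(i := x, j := y)) = F (\<phi>(j := y))" for x y
      using 2 by (metis fun_upd_twist)
    then show ?thesis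
      by (intro exI[of _ "\<lambda>_. 1"] exI[of _ "\<lambda>y. F (\<phi>(j := y))"]) (use F in auto)
  next
    case 3
    then show ?thesis
      by (intro exI[of _ "\<lambda>x. F (\<phi>(i := x))"] exI[of _ "\<lambda>_. 1"]) (use F in auto)
  qed
qed

lemma separable_prod:
  assumes "\<And>e. e \<in> E \<Longrightarrow> separable i j (F e)"
  shows "separable i j (\<lambda>\<phi>. \<Prod>e\<in>E. F e \<phi>)"
  using assms
proof (induction E rule: infinite_finite_induct)
  case (insert e E)
  then show ?case by (simp add: separable_mult)
qed (auto intro!: separable_indep)

text \<open>All coordinates other than \<open>i\<close> and \<open>j\<close> are frozen, and each
  remaining double sum is a bilinear form controlled by regularity.\<close>

lemma count_one_edge:
  assumes I: "finite I" "i \<in> I" "j \<in> I" "i \<noteq> j" and C: "\<And>k. k \<in> I \<Longrightarrow> finite (C k)"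
    and reg: "regular a \<epsilon> (C i) (C j)" and F: "separable i j F"
  shows "\<bar>\<Sum>\<phi>\<in>PiE I C. F \<phi> * (a (\<phi> i) (\<phi> j) - dens a (C i) (C j))\<bar> \<le> 4 * \<epsilon> * (\<Prod>k\<in>I. real (card (C k)))"
proof -
  let ?I = "I - {i, j}" and ?d = "dens a (C i) (C j)"
  have Ieq: "I = insert j (insert i ?I)" using I by auto
  have "(\<Sum>\<phi>\<in>PiE I C. F \<phi> * (a (\<phi> i) (\<phi> j) - ?d))
      = (\<Sum>y\<in>C j. \<Sum>x\<in>C i. \<Sum>\<psi>\<in>PiE ?I C. F (\<psi>(i := x, j := y)) * (a x y - ?d))"
    using I by (subst Ieq, subst sum_PiE_insert, simp, subst sum_PiE_insert) auto
  also have "\<dots> = (\<Sum>\<psi>\<in>PiE ?I C. \<Sum>x\<in>C i. \<Sum>y\<in>C j. F (\<psi>(i := x, j := y)) * (a x y - ?d))"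
    by (subst sum.swap, subst (2) sum.swap, subst sum.swap) simp
  finally have "\<bar>\<Sum>\<phi>\<in>PiE I C. F \<phi> * (a (\<phi> i) (\<phi> j) - ?d)\<bar>
      \<le> (\<Sum>\<psi>\<in>PiE ?I C. \<bar>\<Sum>x\<in>C i. \<Sum>y\<in>C j. F (\<psi>(i := x, j := y)) * (a x y - ?d)\<bar>)"
    by (simp add: sum_abs)
  also have "\<dots> \<le> (\<Sum>\<psi>\<in>PiE ?I C. 4 * (\<epsilon> * (real (card (C i)) * real (card (C j)))))"
  proof (rule sum_mono)
    fix \<psi>
    obtain u v where uv: "\<forall>x. \<bar>u x\<bar> \<le> 1" "\<forall>y. \<bar>v y\<bar> \<le> 1" "\<forall>x y. F (\<psi>(i := x, j := y)) = u x * v y"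
      using F unfolding separable_def by meson
    have "\<bar>\<Sum>x\<in>C i. \<Sum>y\<in>C j. u x * v y * (a x y - ?d)\<bar> \<le> 4 * (\<epsilon> * (real (card (C i)) * real (card (C j))))"
      by (rule abs_bilinear_le) (use I C uv reg in \<open>auto simp: regular_def\<close>)
    then show "\<bar>\<Sum>x\<in>C i. \<Sum>y\<in>C j. F (\<psi>(i := x, j := y)) * (a x y - ?d)\<bar> \<le> 4 * (\<epsilon> * (real (card (C i)) * real (card (C j))))"
      using uv by simp
  qed
  also have "\<dots> = 4 * \<epsilon> * (real (card (C j)) * (real (card (C i)) * (\<Prod>k\<in>?I. real (card (C k)))))"
    using I by (simp add: card_PiE mult_ac)
  also have "real (card (C j)) * (real (card (C i)) * (\<Prod>k\<in>?I. real (card (C k)))) = (\<Prod>k\<in>I. real (card (C k)))"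
  proof -
    have "(\<Prod>k\<in>insert j (insert i ?I). real (card (C k))) = real (card (C j)) * (real (card (C i)) * (\<Prod>k\<in>?I. real (card (C k))))"
      using I by simp
    then show ?thesis by (simp flip: Ieq)
  qed
  finally show ?thesis .
qed

text \<open>A weight \<open>\<sigma>\<close> that depends only on the coordinates in \<open>J\<close> is harmless, since no edge of \<open>E\<close> lies inside \<open>J\<close>.
  Choosing signs for \<open>\<sigma>\<close> turns this estimate into an \<open>L\<^sub>1\<close> bound on extension counts.\<close>

lemma transversal_count_deviation:
  fixes I :: "nat set" and a :: "'a \<Rightarrow> 'a \<Rightarrow> real"
  assumes I: "finite I" and C: "\<And>k. k \<in> I \<Longrightarrow> finite (C k)" and \<epsilon>: "0 \<le> \<epsilon>"
    and a: "\<And>x y. 0 \<le> a x y \<and> a x y \<le> 1"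
    and \<sigma>: "\<And>\<phi>. \<bar>\<sigma> \<phi>\<bar> \<le> 1" "\<And>\<phi> k x. k \<notin> J \<Longrightarrow> \<sigma> (\<phi>(k := x)) = \<sigma> \<phi>"
    and E: "finite E" "E \<subseteq> {(i, j). i \<in> I \<and> j \<in> I \<and> i < j \<and> \<not> (i \<in> J \<and> j \<in> J)}"
    and reg: "\<And>i j. (i, j) \<in> E \<Longrightarrow> regular a \<epsilon> (C i) (C j)"
  shows "\<bar>\<Sum>\<phi>\<in>PiE I C. \<sigma> \<phi> * ((\<Prod>(i, j)\<in>E. a (\<phi> i) (\<phi> j)) - (\<Prod>(i, j)\<in>E. dens a (C i) (C j)))\<bar>
    \<le> real (card E) * (4 * \<epsilon> * (\<Prod>k\<in>I. real (card (C k))))"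
  using E reg
proof (induction E)
  case empty
  then show ?case by simp
next
  case (insert e E)
  obtain i j where e: "e = (i, j)" by fastforce
  have ij: "i \<in> I" "j \<in> I" "i < j" "\<not> (i \<in> J \<and> j \<in> J)" using insert.prems(1) e by auto
  let ?d = "dens a (C i) (C j)" and ?P = "\<lambda>\<phi>. \<Prod>(i, j)\<in>E. a (\<phi> i) (\<phi> j)"
  let ?D = "\<Prod>(i, j)\<in>E. dens a (C i) (C j)" and ?V = "\<Prod>k\<in>I. real (card (C k))"
  have "separable i j \<sigma>" using \<sigma> ij(4) by (intro separable_indep) auto
  moreover have "separable i j ?P"
  proof (rule separable_prod)
    fix g assume g: "g \<in> E"
    obtain k l where kl: "g = (k, l)" by fastforce
    \<comment> \<open>Pairs are increasing, so a pair other than \<open>(i, j)\<close> misses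
      \<open>i\<close> or \<open>j\<close>; its factor depends on at most one of the two
      coordinates.\<close>
    have "k < l" "(k, l) \<noteq> (i, j)" using g kl insert.prems(1) insert.hyps(2) e by auto
    then have "(k \<noteq> i \<and> l \<noteq> i) \<or> (k \<noteq> j \<and> l \<noteq> j)" using ij(3) by auto
    then have "separable i j (\<lambda>\<phi>. a (\<phi> k) (\<phi> l))"
      by (intro separable_indep) (use a in auto)
    then show "separable i j (\<lambda>\<phi>. case g of (i, j) \<Rightarrow> a (\<phi> i) (\<phi> j))" by (simp add: kl)
  qed
  ultimately have sep: "separable i j (\<lambda>\<phi>. \<sigma> \<phi> * ?P \<phi>)" by (rule separable_mult)
  have "\<bar>\<Sum>\<phi>\<in>PiE I C. \<sigma> \<phi> * ?P \<phi> * (a (\<phi> i) (\<phi> j) - ?d)\<bar> \<le> 4 * \<epsilon> * ?V"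
    by (rule count_one_edge) (use I C ij sep insert.prems(2) e in auto)
  moreover have "\<bar>?d * (\<Sum>\<phi>\<in>PiE I C. \<sigma> \<phi> * (?P \<phi> - ?D))\<bar> \<le> real (card E) * (4 * \<epsilon> * ?V)"
  proof -
    have "\<bar>?d * (\<Sum>\<phi>\<in>PiE I C. \<sigma> \<phi> * (?P \<phi> - ?D))\<bar> \<le> \<bar>\<Sum>\<phi>\<in>PiE I C. \<sigma> \<phi> * (?P \<phi> - ?D)\<bar>"
      using dens_range[of a "C i" "C j"] a by (simp add: abs_mult mult_left_le_one_le)
    also have "\<dots> \<le> real (card E) * (4 * \<epsilon> * ?V)"
      by (rule insert.IH) (use insert.prems in auto)
    finally show ?thesis .
  qed
  \<comment> \<open>Telescoping: one adjacency factor at a time is replaced by its density.\<close>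
  moreover have "(\<Sum>\<phi>\<in>PiE I C. \<sigma> \<phi> * ((\<Prod>(i, j)\<in>insert e E. a (\<phi> i) (\<phi> j)) - (\<Prod>(i, j)\<in>insert e E. dens a (C i) (C j))))
      = (\<Sum>\<phi>\<in>PiE I C. \<sigma> \<phi> * ?P \<phi> * (a (\<phi> i) (\<phi> j) - ?d)) + ?d * (\<Sum>\<phi>\<in>PiE I C. \<sigma> \<phi> * (?P \<phi> - ?D))"
    unfolding sum_distrib_left sum.distrib[symmetric] using insert.hyps
    by (intro sum.cong refl) (simp add: e algebra_simps)
  moreover have "real (card (insert e E)) * (4 * \<epsilon> * ?V) = 4 * \<epsilon> * ?V + real (card E) * (4 * \<epsilon> * ?V)"
    using insert.hyps by (simp add: algebra_simps)
  ultimately show ?case by linarith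
qed

section \<open>Counting cliques with a given pattern\<close>

locale labelled_graph =
  fixes G :: "'a pair_pre_digraph" and p :: "'a \<Rightarrow> nat"
  assumes G: "pair_graph G"
begin

abbreviation V :: "'a set" where "V \<equiv> pverts G"

definition adj :: "'a \<Rightarrow> 'a \<Rightarrow> real" where "adj x y = of_bool ((x, y) \<in> parcs G)"

definition C :: "nat \<Rightarrow> 'a set" where "C i = {x \<in> V. p x = i}"

definition typed :: "nat set \<Rightarrow> 'a set set" where
  "typed I = {K \<in> cliques G. inj_on p K \<and> p ` K = I}"

definition pairs :: "nat set \<Rightarrow> (nat \<times> nat) set" where
  "pairs I = {(i, j). i \<in> I \<and> j \<in> I \<and> i < j}"

definition transversals :: "nat set \<Rightarrow> (nat \<Rightarrow> 'a) set" where
  "transversals I = {\<phi> \<in> PiE I C. \<forall>(i, j)\<in>pairs I. (\<phi> i, \<phi> j) \<in> parcs G}"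

definition extensions :: "nat set \<Rightarrow> 'a set \<Rightarrow> 'a set set" where
  "extensions I T = {K \<in> typed I. T \<subseteq> K}"

lemma finite_V: "finite V"
proof -
  interpret pair_graph G by (rule G)
  show ?thesis by (rule pair_finite_verts)
qed

lemma arc_sym: "(x, y) \<in> parcs G \<Longrightarrow> (y, x) \<in> parcs G"
proof -
  interpret pair_graph G by (rule G)
  show "(x, y) \<in> parcs G \<Longrightarrow> (y, x) \<in> parcs G" by (rule arcs_symmetric)
qed

lemma finite_C: "finite (C i)"
  using finite_V by (simp add: C_def)

lemma adj_range: "0 \<le> adj x y \<and> adj x y \<le> 1"
  by (simp add: adj_def)

lemma finite_pairs: "finite I \<Longrightarrow> finite (pairs I)"
  by (rule finite_subset[of _ "I \<times> I"]) (auto simp: pairs_def)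

lemma card_pairs_le: "finite I \<Longrightarrow> card I \<le> s \<Longrightarrow> E \<subseteq> pairs I \<Longrightarrow> card E \<le> s\<^sup>2"
proof -
  assume I: "finite I" "card I \<le> s" and E: "E \<subseteq> pairs I"
  have "card E \<le> card (I \<times> I)"
    using I E by (intro card_mono) (auto simp: pairs_def)
  also have "\<dots> \<le> s * s" using I by (simp add: card_cartesian_product mult_le_mono)
  finally show ?thesis by (simp add: power2_eq_square)
qed

lemma label_at: "\<phi> \<in> PiE I C \<Longrightarrow> i \<in> I \<Longrightarrow> p (\<phi> i) = i \<and> \<phi> i \<in> V"
  by (auto simp: C_def dest: PiE_mem)

lemma finite_typed: "finite (typed I)"
  using finite_cliques[OF G] by (simp add: typed_def)

text \<open>A vertex carries its coordinate as its label, so a clique determines its transversal and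
  no factorials enter the counts.\<close>

lemma transversal_image_bij:
  assumes I: "finite I" "I \<noteq> {}"
  shows "bij_betw (\<lambda>\<phi>. \<phi> ` I) (transversals I) (typed I)"
  unfolding bij_betw_def
proof
  show "inj_on (\<lambda>\<phi>. \<phi> ` I) (transversals I)"
  proof (rule inj_onI)
    fix \<phi> \<psi> assume "\<phi> \<in> transversals I" "\<psi> \<in> transversals I" and eq: "\<phi> ` I = \<psi> ` I"
    then have PiE: "\<phi> \<in> PiE I C" "\<psi> \<in> PiE I C" by (auto simp: transversals_def)
    show "\<phi> = \<psi>"
    proof (rule PiE_ext[OF PiE])
      fix i assume i: "i \<in> I"
      then obtain j where "j \<in> I" "\<phi> i = \<psi> j" using eq by (metis image_iff)
      then show "\<phi> i = \<psi> i" using label_at[OF PiE(1) i] label_at[OF PiE(2)] by metis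
    qed
  qed
  show "(\<lambda>\<phi>. \<phi> ` I) ` transversals I = typed I"
  proof (intro equalityI subsetI)
    fix K assume "K \<in> (\<lambda>\<phi>. \<phi> ` I) ` transversals I"
    then obtain \<phi> where \<phi>: "\<phi> \<in> transversals I" and K: "K = \<phi> ` I" by auto
    then have PiE: "\<phi> \<in> PiE I C" by (auto simp: transversals_def)
    note lab = label_at[OF PiE]
    have arcs: "(\<phi> i, \<phi> j) \<in> parcs G" if "i \<in> I" "j \<in> I" "i < j" for i j
      using \<phi> that by (auto simp: transversals_def pairs_def)
    have "(\<phi> i, \<phi> j) \<in> parcs G" if "i \<in> I" "j \<in> I" "i \<noteq> j" for i j
      using arcs[of i j] arcs[of j i] arc_sym that by (metis linorder_neqE_nat)
    then have "K \<in> cliques G"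
      using K I lab unfolding cliques_def by fastforce
    moreover have "inj_on p K" using K lab by (auto simp: inj_on_def)
    moreover have "p ` K = I" using K lab by (force simp: image_iff)
    ultimately show "K \<in> typed I" by (simp add: typed_def)
  next
    fix K assume "K \<in> typed I"
    then have K: "K \<in> cliques G" "inj_on p K" "p ` K = I" by (auto simp: typed_def)
    define \<phi> where "\<phi> = restrict (inv_into K p) I"
    have im: "\<phi> ` I = K"
    proof -
      have "\<phi> ` I = inv_into K p ` (p ` K)" by (simp add: \<phi>_def K(3))
      then show ?thesis using K(2) by (simp add: image_image)
    qed
    have at: "p (\<phi> i) = i" "\<phi> i \<in> K" if "i \<in> I" for i
      using that K(3) by (auto simp: \<phi>_def f_inv_into_f inv_into_into)
    have KV: "K \<subseteq> V" using K(1) by (simp add: cliques_def)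
    have "\<phi> i \<in> C i" if "i \<in> I" for i
      using at[OF that] KV by (auto simp: C_def)
    moreover have "\<phi> \<in> extensional I" by (simp add: \<phi>_def)
    ultimately have "\<phi> \<in> PiE I C" by (simp add: PiE_iff)
    moreover have "(\<phi> i, \<phi> j) \<in> parcs G" if "(i, j) \<in> pairs I" for i j
    proof -
      have ij: "i \<in> I" "j \<in> I" "i \<noteq> j" using that by (auto simp: pairs_def)
      then have "\<phi> i \<noteq> \<phi> j" using at by metis
      then show ?thesis using K(1) at ij by (simp add: cliques_def)
    qed
    ultimately have "\<phi> \<in> transversals I" by (auto simp: transversals_def)
    then show "K \<in> (\<lambda>\<phi>. \<phi> ` I) ` transversals I" using im by blast
  qed
qed

lemma transversal_restrict:
  assumes J: "J \<subseteq> I" and \<phi>: "\<phi> \<in> PiE I C" and \<psi>: "\<psi> \<in> PiE J C"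
  shows "\<psi> ` J \<subseteq> \<phi> ` I \<longleftrightarrow> restrict \<phi> J = \<psi>"
proof
  assume sub: "\<psi> ` J \<subseteq> \<phi> ` I"
  show "restrict \<phi> J = \<psi>"
  proof
    fix j
    show "restrict \<phi> J j = \<psi> j"
    proof (cases "j \<in> J")
      case True
      then obtain i where i: "i \<in> I" "\<psi> j = \<phi> i" using sub by (auto simp: image_subset_iff image_iff)
      then have "i = j" using label_at[OF \<psi> True] label_at[OF \<phi>] by metis
      then show ?thesis using i True by simp
    qed (use \<psi> in \<open>auto simp: PiE_def extensional_def\<close>)
  qed
next
  assume "restrict \<phi> J = \<psi>"
  then have "\<psi> j = \<phi> j" if "j \<in> J" for j using that by auto
  then show "\<psi> ` J \<subseteq> \<phi> ` I" using J by auto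
qed

lemma prod_adj: "finite E \<Longrightarrow> (\<Prod>(i, j)\<in>E. adj (\<phi> i) (\<phi> j)) = of_bool (\<forall>(i, j)\<in>E. (\<phi> i, \<phi> j) \<in> parcs G)"
  by (induction E rule: finite_induct) (auto simp: adj_def)

text \<open>The deviation estimate with constant weight 1 and \<open>J\<close> empty. There are at
  most \<open>s\<^sup>2\<close> pairs and \<open>d \<le> 1\<close>, so the product of the densities
  is at least \<open>d ^ s\<^sup>2\<close>.\<close>

lemma typed_card:
  assumes I: "finite I" "I \<noteq> {}" "card I \<le> s" and \<epsilon>: "0 \<le> \<epsilon>"
    and reg: "\<And>i j. (i, j) \<in> pairs I \<Longrightarrow> regular adj \<epsilon> (C i) (C j)"
    and d: "0 \<le> d" "d \<le> 1" "\<And>i j. (i, j) \<in> pairs I \<Longrightarrow> d \<le> dens adj (C i) (C j)"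
  shows "(d ^ s\<^sup>2 - 4 * real (s\<^sup>2) * \<epsilon>) * (\<Prod>k\<in>I. real (card (C k))) \<le> real (card (typed I))"
proof -
  let ?P = "\<Prod>k\<in>I. real (card (C k))" and ?D = "\<Prod>(i, j)\<in>pairs I. dens adj (C i) (C j)"
  have P0: "0 \<le> ?P" by (simp add: prod_nonneg)
  have finPiE: "finite (PiE I C)" using I finite_C by (intro finite_PiE) auto
  have "\<bar>\<Sum>\<phi>\<in>PiE I C. 1 * ((\<Prod>(i, j)\<in>pairs I. adj (\<phi> i) (\<phi> j)) - ?D)\<bar> \<le> real (card (pairs I)) * (4 * \<epsilon> * ?P)"
    by (rule transversal_count_deviation[where J = "{}"])
       (use I finite_C \<epsilon> adj_range reg finite_pairs in \<open>auto simp: pairs_def\<close>)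
  also have "\<dots> \<le> real (s\<^sup>2) * (4 * \<epsilon> * ?P)"
    using card_pairs_le[OF I(1,3) subset_refl] \<epsilon> P0 by (intro mult_right_mono) auto
  finally have "\<bar>(\<Sum>\<phi>\<in>PiE I C. \<Prod>(i, j)\<in>pairs I. adj (\<phi> i) (\<phi> j)) - ?D * ?P\<bar> \<le> real (s\<^sup>2) * (4 * \<epsilon> * ?P)"
    using I by (simp add: sum_subtractf card_PiE mult.commute)
  moreover have "(\<Sum>\<phi>\<in>PiE I C. \<Prod>(i, j)\<in>pairs I. adj (\<phi> i) (\<phi> j)) = real (card (typed I))"
  proof -
    have "(\<Sum>\<phi>\<in>PiE I C. \<Prod>(i, j)\<in>pairs I. adj (\<phi> i) (\<phi> j)) = (\<Sum>\<phi>\<in>transversals I. 1)"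
      using finPiE I by (intro sum.mono_neutral_cong_right) (auto simp: prod_adj finite_pairs transversals_def)
    also have "\<dots> = real (card (typed I))"
      using bij_betw_same_card[OF transversal_image_bij[OF I(1,2)]] by simp
    finally show ?thesis .
  qed
  moreover have "d ^ s\<^sup>2 * ?P \<le> ?D * ?P"
  proof (rule mult_right_mono[OF _ P0])
    have "d ^ s\<^sup>2 \<le> d ^ card (pairs I)"
      using card_pairs_le[OF I(1,3) subset_refl] d by (intro power_decreasing) auto
    also have "\<dots> = (\<Prod>(i, j)\<in>pairs I. d)" by (simp add: case_prod_unfold)
    also have "\<dots> \<le> ?D" using d by (intro prod_mono) auto
    finally show "d ^ s\<^sup>2 \<le> ?D" .
  qed
  ultimately show ?thesis by (simp add: algebra_simps abs_le_iff)
qed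

lemma extension_count:
  assumes I: "finite I" "card I \<le> s" and J: "J \<subseteq> I" "J \<noteq> {}" and \<epsilon>: "0 \<le> \<epsilon>"
    and reg: "\<And>i j. (i, j) \<in> pairs I \<Longrightarrow> regular adj \<epsilon> (C i) (C j)"
  shows "\<exists>m. (\<Sum>T\<in>typed J. \<bar>real (card (extensions I T)) - m\<bar>) \<le> 4 * real (s\<^sup>2) * \<epsilon> * (\<Prod>k\<in>I. real (card (C k)))"
proof -
  \<comment> \<open>Arcs between coordinates in \<open>J\<close> are already present in
    \<open>T\<close>, so only the other pairs are tested.\<close>
  define E where "E = {(i, j) \<in> pairs I. \<not> (i \<in> J \<and> j \<in> J)}"
  let ?P = "\<Prod>k\<in>I. real (card (C k))" and ?D = "\<Prod>(i, j)\<in>E. dens adj (C i) (C j)"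
  have finJ: "finite J" using I J finite_subset by auto
  have EP: "E \<subseteq> pairs I" by (auto simp: E_def)
  have finE: "finite E" using finite_pairs[OF I(1)] EP finite_subset by auto
  have finPiE: "finite (PiE I C)" using I finite_C by (intro finite_PiE) auto
  define S where "S \<psi> = {\<phi> \<in> PiE I C. restrict \<phi> J = \<psi>}" for \<psi>
  \<comment> \<open>The densities of the tested pairs times the number of choices in the remaining
    cells: a main term that is the same for every \<open>T\<close>.\<close>
  define m where "m = ?D * (\<Prod>k\<in>I - J. real (card (C k)))"
  define c where "c \<psi> = real (card (extensions I (\<psi> ` J))) - m" for \<psi>
  \<comment> \<open>The sign of the deviation at the part over \<open>J\<close>, and 0 if that part
    is not a clique. One signed sum then collects all absolute deviations.\<close>
  define \<sigma> where "\<sigma> \<phi> = (if restrict \<phi> J \<in> transversals J then sgn (c (restrict \<phi> J)) else 0)" for \<phi>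
  have count: "c \<psi> = (\<Sum>\<phi>\<in>S \<psi>. (\<Prod>(i, j)\<in>E. adj (\<phi> i) (\<phi> j)) - ?D)" if \<psi>: "\<psi> \<in> transversals J" for \<psi>
  proof -
    have \<psi>P: "\<psi> \<in> PiE J C" using \<psi> by (simp add: transversals_def)
    have Seq: "S \<psi> = PiE I (\<lambda>k. if k \<in> J then {\<psi> k} else C k)"
    proof (intro equalityI subsetI)
      fix \<phi> assume "\<phi> \<in> S \<psi>"
      then show "\<phi> \<in> PiE I (\<lambda>k. if k \<in> J then {\<psi> k} else C k)"
        using J by (auto simp: S_def PiE_def Pi_def)
    next
      fix \<phi> assume \<phi>: "\<phi> \<in> PiE I (\<lambda>k. if k \<in> J then {\<psi> k} else C k)"
      have "restrict \<phi> J k = \<psi> k" for k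
      proof (cases "k \<in> J")
        case True
        then show ?thesis using PiE_mem[OF \<phi>, of k] J by auto
      qed (use \<psi>P in \<open>auto simp: PiE_def extensional_def\<close>)
      moreover have "\<phi> k \<in> C k" if "k \<in> I" for k
        using PiE_mem[OF \<phi> that] PiE_mem[OF \<psi>P, of k] by (auto split: if_splits)
      ultimately show "\<phi> \<in> S \<psi>" using \<phi> by (auto simp: S_def PiE_def)
    qed
    have "real (card (S \<psi>)) = (\<Prod>k\<in>I. real (card (if k \<in> J then {\<psi> k} else C k)))"
      unfolding Seq using I by (simp add: card_PiE)
    also have "\<dots> = (\<Prod>k\<in>I - J. real (card (C k)))"
      using I by (intro prod.mono_neutral_cong_right) auto
    finally have cardS: "real (card (S \<psi>)) = (\<Prod>k\<in>I - J. real (card (C k)))" .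
    have ext: "bij_betw (\<lambda>\<phi>. \<phi> ` I) {\<phi> \<in> transversals I. restrict \<phi> J = \<psi>} (extensions I (\<psi> ` J))"
    proof -
      have bij: "bij_betw (\<lambda>\<phi>. \<phi> ` I) (transversals I) (typed I)"
        using transversal_image_bij I J by auto
      have iff: "\<psi> ` J \<subseteq> \<phi> ` I \<longleftrightarrow> restrict \<phi> J = \<psi>" if "\<phi> \<in> transversals I" for \<phi>
        using transversal_restrict[OF J(1) _ \<psi>P] that by (simp add: transversals_def)
      have "(\<lambda>\<phi>. \<phi> ` I) ` {\<phi> \<in> transversals I. restrict \<phi> J = \<psi>} = extensions I (\<psi> ` J)"
        unfolding extensions_def bij_betw_imp_surj_on[OF bij, symmetric] using iff by blast
      moreover have "inj_on (\<lambda>\<phi>. \<phi> ` I) {\<phi> \<in> transversals I. restrict \<phi> J = \<psi>}"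
        by (rule inj_on_subset[OF bij_betw_imp_inj_on[OF bij]]) auto
      ultimately show ?thesis by (simp add: bij_betw_def)
    qed
    have "(\<Sum>\<phi>\<in>S \<psi>. \<Prod>(i, j)\<in>E. adj (\<phi> i) (\<phi> j)) = (\<Sum>\<phi>\<in>{\<phi> \<in> transversals I. restrict \<phi> J = \<psi>}. 1)"
    proof (rule sum.mono_neutral_cong_right)
      show "finite (S \<psi>)" using finPiE by (simp add: S_def)
      show "{\<phi> \<in> transversals I. restrict \<phi> J = \<psi>} \<subseteq> S \<psi>" by (auto simp: S_def transversals_def)
      show "(\<Prod>(i, j)\<in>E. adj (\<phi> i) (\<phi> j)) = 1" if "\<phi> \<in> {\<phi> \<in> transversals I. restrict \<phi> J = \<psi>}" for \<phi>
        using that EP by (auto simp: prod_adj[OF finE] transversals_def)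
      show "\<forall>\<phi>\<in>S \<psi> - {\<phi> \<in> transversals I. restrict \<phi> J = \<psi>}. (\<Prod>(i, j)\<in>E. adj (\<phi> i) (\<phi> j)) = 0"
      proof
        fix \<phi> assume \<phi>: "\<phi> \<in> S \<psi> - {\<phi> \<in> transversals I. restrict \<phi> J = \<psi>}"
        then have "\<phi> \<in> PiE I C" and res: "restrict \<phi> J = \<psi>" and "\<phi> \<notin> transversals I"
          by (auto simp: S_def)
        then obtain i j where ij: "(i, j) \<in> pairs I" "(\<phi> i, \<phi> j) \<notin> parcs G"
          by (auto simp: transversals_def)
        have "\<not> (i \<in> J \<and> j \<in> J)"
        proof
          assume "i \<in> J \<and> j \<in> J"
          then have "(\<psi> i, \<psi> j) \<in> parcs G" using \<psi> ij by (auto simp: transversals_def pairs_def)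
          moreover have "\<psi> i = \<phi> i" "\<psi> j = \<phi> j" using res \<open>i \<in> J \<and> j \<in> J\<close> by auto
          ultimately show False using ij by simp
        qed
        then have "(i, j) \<in> E" using ij by (simp add: E_def)
        then show "(\<Prod>(i, j)\<in>E. adj (\<phi> i) (\<phi> j)) = 0" using ij(2) by (auto simp: prod_adj[OF finE])
      qed
    qed
    also have "\<dots> = real (card (extensions I (\<psi> ` J)))"
      using bij_betw_same_card[OF ext] by simp
    finally show ?thesis using cardS by (simp add: c_def m_def sum_subtractf)
  qed
  have "(\<Sum>T\<in>typed J. \<bar>real (card (extensions I T)) - m\<bar>) = (\<Sum>\<psi>\<in>transversals J. \<bar>c \<psi>\<bar>)"
    unfolding c_def
    by (rule sum.reindex_bij_betw[OF transversal_image_bij[OF finJ J(2)], symmetric])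
  also have "\<dots> = (\<Sum>\<psi>\<in>transversals J. \<Sum>\<phi>\<in>S \<psi>. sgn (c \<psi>) * ((\<Prod>(i, j)\<in>E. adj (\<phi> i) (\<phi> j)) - ?D))"
  proof (rule sum.cong[OF refl])
    fix \<psi> assume "\<psi> \<in> transversals J"
    from count[OF this] have "sgn (c \<psi>) * c \<psi> = (\<Sum>\<phi>\<in>S \<psi>. sgn (c \<psi>) * ((\<Prod>(i, j)\<in>E. adj (\<phi> i) (\<phi> j)) - ?D))"
      by (metis (no_types, lifting) sum.cong sum_distrib_left)
    then show "\<bar>c \<psi>\<bar> = (\<Sum>\<phi>\<in>S \<psi>. sgn (c \<psi>) * ((\<Prod>(i, j)\<in>E. adj (\<phi> i) (\<phi> j)) - ?D))"
      by (simp add: abs_sgn mult.commute)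
  qed
  also have "\<dots> = (\<Sum>\<phi>\<in>PiE I C. \<Sum>\<psi>\<in>{\<psi> \<in> transversals J. restrict \<phi> J = \<psi>}. sgn (c \<psi>) * ((\<Prod>(i, j)\<in>E. adj (\<phi> i) (\<phi> j)) - ?D))"
    unfolding S_def
  proof (rule sum.swap_restrict[OF _ finPiE])
    show "finite (transversals J)"
      by (rule finite_subset[of _ "PiE J C"]) (use finJ finite_C in \<open>auto simp: transversals_def intro!: finite_PiE\<close>)
  qed
  also have "\<dots> = (\<Sum>\<phi>\<in>PiE I C. \<sigma> \<phi> * ((\<Prod>(i, j)\<in>E. adj (\<phi> i) (\<phi> j)) - ?D))"
  proof (rule sum.cong[OF refl])
    fix \<phi>
    have "{\<psi> \<in> transversals J. restrict \<phi> J = \<psi>} = (if restrict \<phi> J \<in> transversals J then {restrict \<phi> J} else {})"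
      by auto
    then show "(\<Sum>\<psi>\<in>{\<psi> \<in> transversals J. restrict \<phi> J = \<psi>}. sgn (c \<psi>) * ((\<Prod>(i, j)\<in>E. adj (\<phi> i) (\<phi> j)) - ?D))
        = \<sigma> \<phi> * ((\<Prod>(i, j)\<in>E. adj (\<phi> i) (\<phi> j)) - ?D)"
      by (simp add: \<sigma>_def)
  qed
  also have "\<dots> \<le> \<bar>\<dots>\<bar>" by simp
  also have "\<dots> \<le> real (card E) * (4 * \<epsilon> * ?P)"
  proof (rule transversal_count_deviation[where J = J])
    show "\<bar>\<sigma> \<phi>\<bar> \<le> 1" for \<phi> by (simp add: \<sigma>_def sgn_if)
    show "\<sigma> (\<phi>(k := x)) = \<sigma> \<phi>" if "k \<notin> J" for \<phi> k x
    proof -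
      have "restrict (\<phi>(k := x)) J = restrict \<phi> J" using that by (auto simp: restrict_def)
      then show ?thesis by (simp add: \<sigma>_def)
    qed
    show "E \<subseteq> {(i, j). i \<in> I \<and> j \<in> I \<and> i < j \<and> \<not> (i \<in> J \<and> j \<in> J)}" by (auto simp: E_def pairs_def)
  qed (use I finite_C \<epsilon> adj_range finE reg EP in auto)
  also have "\<dots> \<le> real (s\<^sup>2) * (4 * \<epsilon> * ?P)"
    using card_pairs_le[OF I EP] \<epsilon> by (intro mult_right_mono) (auto intro!: mult_nonneg_nonneg prod_nonneg)
  finally show ?thesis by (intro exI[of _ m]) (simp add: mult_ac)
qed

end

section \<open>Spreading a fractional packing\<close>

lemma card_supersets_le:
  assumes V: "finite V" and U: "U \<subseteq> V" "card U \<le> m"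
  shows "card {K. U \<subseteq> K \<and> K \<subseteq> V \<and> card K = m} \<le> card V ^ (m - card U)"
proof -
  let ?A = "{K. U \<subseteq> K \<and> K \<subseteq> V \<and> card K = m}" and ?B = "{B. B \<subseteq> V \<and> card B = m - card U}"
  have finU: "finite U" using U V finite_subset by auto
  have "inj_on (\<lambda>K. K - U) ?A" by (auto simp: inj_on_def)
  moreover have "(\<lambda>K. K - U) ` ?A \<subseteq> ?B"
    using finU by (auto simp: card_Diff_subset)
  moreover have "finite ?B" using V by simp
  ultimately have "card ?A \<le> card ?B" by (rule card_inj_on_le)
  also have "\<dots> = card V choose (m - card U)" by (rule n_subsets[OF V])
  also have "\<dots> \<le> card V ^ (m - card U)"
    by (cases "m - card U \<le> card V") (auto intro: binomial_le_pow simp: binomial_eq_0)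
  finally show ?thesis .
qed

lemma subclique:
  assumes "K \<in> cliques G" "T \<subseteq> K" "T \<noteq> {}"
  shows "T \<in> cliques G"
proof -
  have "T \<subseteq> pverts G"
    by (rule subset_trans[OF assms(2)]) (use assms(1) in \<open>simp add: cliques_def\<close>)
  then show ?thesis
    using assms(1,3) subsetD[OF assms(2)] by (simp add: cliques_def)
qed

lemma card_cliques_of_size_le:
  assumes G: "pair_graph G"
  shows "card (cliques_of_size m G) \<le> card (pverts G) ^ m"
proof -
  interpret pair_graph G by (rule G)
  have "card (cliques_of_size m G) \<le> card {K. {} \<subseteq> K \<and> K \<subseteq> pverts G \<and> card K = m}"
    using pair_finite_verts by (intro card_mono) (auto simp: cliques_of_size_def cliques_def)
  also have "\<dots> \<le> card (pverts G) ^ (m - card ({} :: 'a set))"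
    by (rule card_supersets_le[OF pair_finite_verts]) auto
  finally show ?thesis by simp
qed

text \<open>\<open>d\<close> and \<mu> are the thresholds below which a pair of cells counts as
  sparse and a cell as small. \<open>\<epsilon>_small\<close> keeps the counting bound for cliques
  of a good pattern positive.\<close>

locale spread_setup = labelled_graph G p for G :: "'a pair_pre_digraph" and p :: "'a \<Rightarrow> nat" +
  fixes t s :: nat and \<epsilon> d \<mu> :: real and f :: "'a set \<Rightarrow> real"
  assumes t: "2 \<le> t" and \<epsilon>: "0 \<le> \<epsilon>" and d: "0 \<le> d" "d \<le> 1" and \<mu>: "0 < \<mu>" "\<mu> \<le> 1"
    and \<epsilon>_small: "4 * real (s\<^sup>2) * \<epsilon> < d ^ s\<^sup>2"
    and f_nonneg: "\<And>K. K \<in> cliques G \<Longrightarrow> 0 \<le> f K"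
    and f_load: "\<And>T. T \<in> cliques_of_size t G \<Longrightarrow>
      (\<Sum>K\<in>{K \<in> cliques G. t < card K \<and> card K \<le> s \<and> T \<subseteq> K}. f K) \<le> 1"
begin

definition \<kappa> :: real where "\<kappa> = d ^ s\<^sup>2 - 4 * real (s\<^sup>2) * \<epsilon>"

lemma \<kappa>_pos: "0 < \<kappa>" using \<epsilon>_small by (simp add: \<kappa>_def)

definition Q :: "'a set set" where "Q = {K \<in> cliques G. t < card K \<and> card K \<le> s}"

lemma finite_Q: "finite Q" using finite_cliques[OF G] by (simp add: Q_def)

lemma finite_cliques_of_size: "finite (cliques_of_size m G)"
  using finite_cliques[OF G] by (simp add: cliques_of_size_def)

lemma f_nonneg_Q: "K \<in> Q \<Longrightarrow> 0 \<le> f K" using f_nonneg by (simp add: Q_def)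

lemma packing_load_le: "T \<in> cliques_of_size t G \<Longrightarrow> (\<Sum>K\<in>{K \<in> Q. T \<subseteq> K}. f K) \<le> 1"
  using f_load by (simp add: Q_def conj_assoc)

text \<open>Each clique of \<open>S\<close> is charged to a member of \<open>R\<close> inside it,
  and a member of \<open>R\<close> has load at most 1.\<close>

lemma weight_le_card_subcliques:
  assumes S: "S \<subseteq> Q" and R: "R \<subseteq> cliques_of_size t G" and ex: "\<And>K. K \<in> S \<Longrightarrow> \<exists>T\<in>R. T \<subseteq> K"
  shows "(\<Sum>K\<in>S. f K) \<le> real (card R)"
proof -
  have finS: "finite S" using S finite_Q finite_subset by auto
  have finR: "finite R" using R finite_cliques_of_size finite_subset by auto
  have "(\<Sum>K\<in>S. f K) \<le> (\<Sum>K\<in>S. \<Sum>T\<in>{T \<in> R. T \<subseteq> K}. f K)"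
  proof (rule sum_mono)
    fix K assume K: "K \<in> S"
    then obtain T where T: "T \<in> R" "T \<subseteq> K" using ex by blast
    have "0 \<le> f K" using f_nonneg_Q S K by blast
    then show "f K \<le> (\<Sum>T\<in>{T \<in> R. T \<subseteq> K}. f K)"
      using finR T by (intro member_le_sum[of T _ "\<lambda>_. f K"]) auto
  qed
  also have "\<dots> = (\<Sum>T\<in>R. \<Sum>K\<in>{K \<in> S. T \<subseteq> K}. f K)"
    by (rule sum.swap_restrict[OF finS finR])
  also have "\<dots> \<le> (\<Sum>T\<in>R. 1)"
  proof (rule sum_mono)
    fix T assume T: "T \<in> R"
    have "(\<Sum>K\<in>{K \<in> S. T \<subseteq> K}. f K) \<le> (\<Sum>K\<in>{K \<in> Q. T \<subseteq> K}. f K)"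
      using S finite_Q f_nonneg_Q by (intro sum_mono2) auto
    also have "\<dots> \<le> 1" using T R by (intro packing_load_le) auto
    finally show "(\<Sum>K\<in>{K \<in> S. T \<subseteq> K}. f K) \<le> 1" .
  qed
  finally show ?thesis by simp
qed

lemma clique_subset_of_size:
  assumes K: "K \<in> Q" and U: "U \<subseteq> K" "card U \<le> t"
  shows "\<exists>T\<in>cliques_of_size t G. U \<subseteq> T \<and> T \<subseteq> K"
proof -
  have finK: "finite K" using K finite_clique(1)[OF G] by (simp add: Q_def)
  then obtain T where T: "U \<subseteq> T" "T \<subseteq> K" "card T = t"
    using exists_subset_between[of U t K] U K by (auto simp: Q_def)
  moreover have "T \<noteq> {}" using T t by auto
  ultimately show ?thesis
    using subclique[of K G T] K by (auto simp: Q_def cliques_of_size_def)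
qed

lemma total_weight: "(\<Sum>K\<in>Q. f K) \<le> real (card V) ^ t"
proof -
  have "(\<Sum>K\<in>Q. f K) \<le> real (card (cliques_of_size t G))"
    using clique_subset_of_size[of _ "{}"] by (intro weight_le_card_subcliques) auto
  also have "\<dots> \<le> real (card V ^ t)" by (simp only: of_nat_le_iff card_cliques_of_size_le[OF G])
  finally show ?thesis by simp
qed

text \<open>As \<open>t \<ge> 2\<close>, every clique of \<open>Q\<close> through \<open>x\<close>
  and \<open>y\<close> contains a \<open>t\<close>-clique through both, and there are at most
  \<open>card V ^ (t - 2)\<close> of these.\<close>

lemma pair_weight:
  assumes "x \<in> V" "y \<in> V" "x \<noteq> y"
  shows "(\<Sum>K\<in>{K \<in> Q. x \<in> K \<and> y \<in> K}. f K) \<le> real (card V) ^ (t - 2)"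
proof -
  let ?R = "{T \<in> cliques_of_size t G. {x, y} \<subseteq> T}"
  have "(\<Sum>K\<in>{K \<in> Q. x \<in> K \<and> y \<in> K}. f K) \<le> real (card ?R)"
    using clique_subset_of_size[of _ "{x, y}"] assms t by (intro weight_le_card_subcliques) fastforce+
  also have "card ?R \<le> card {K. {x, y} \<subseteq> K \<and> K \<subseteq> V \<and> card K = t}"
    using finite_V by (intro card_mono) (auto simp: cliques_of_size_def cliques_def)
  also have "\<dots> \<le> card V ^ (t - card {x, y})"
    by (rule card_supersets_le[OF finite_V]) (use assms t in auto)
  finally show ?thesis using assms by (simp add: numeral_2_eq_2)
qed

definition good_pair :: "nat \<Rightarrow> nat \<Rightarrow> bool" where
  "good_pair i j \<longleftrightarrow> i \<noteq> j \<and> regular adj \<epsilon> (C i) (C j) \<and> d \<le> dens adj (C i) (C j) \<and>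
     \<mu> * real (card V) \<le> real (card (C i)) \<and> \<mu> * real (card V) \<le> real (card (C j))"

definition good_type :: "nat set \<Rightarrow> bool" where
  "good_type I \<longleftrightarrow> t < card I \<and> card I \<le> s \<and> (\<forall>i\<in>I. \<forall>j\<in>I. i \<noteq> j \<longrightarrow> good_pair i j)"

definition good_types :: "nat set set" where
  "good_types = {I \<in> Pow (p ` V). good_type I}"

definition good_cliques :: "'a set set" where
  "good_cliques = {K \<in> Q. inj_on p K \<and> good_type (p ` K)}"

definition bad_arcs :: "('a \<times> 'a) set" where
  "bad_arcs = {(x, y) \<in> parcs G. \<not> good_pair (p x) (p y)}"

lemma arc_verts: "(x, y) \<in> parcs G \<Longrightarrow> x \<in> V \<and> y \<in> V \<and> x \<noteq> y"
proof -
  interpret pair_graph G by (rule G)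
  show "(x, y) \<in> parcs G \<Longrightarrow> x \<in> V \<and> y \<in> V \<and> x \<noteq> y"
    using in_arcsD1 in_arcsD2 no_loops by fastforce
qed

lemma finite_bad_arcs: "finite bad_arcs"
  by (rule finite_subset[of _ "V \<times> V"]) (use finite_V arc_verts in \<open>auto simp: bad_arcs_def\<close>)

text \<open>A clique without a good pattern contains a bad arc, and by \<open>pair_weight\<close>
  little weight passes through each arc.\<close>

lemma bad_weight: "(\<Sum>K\<in>Q - good_cliques. f K) \<le> real (card bad_arcs) * real (card V) ^ (t - 2)"
proof -
  have "(\<Sum>K\<in>Q - good_cliques. f K) \<le> (\<Sum>K\<in>Q - good_cliques. \<Sum>e\<in>{e \<in> bad_arcs. fst e \<in> K \<and> snd e \<in> K}. f K)"
  proof (rule sum_mono)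
    fix K assume K: "K \<in> Q - good_cliques"
    have clique: "(x, y) \<in> parcs G" if "x \<in> K" "y \<in> K" "x \<noteq> y" for x y
      using K that by (auto simp: Q_def cliques_def)
    have "\<exists>x\<in>K. \<exists>y\<in>K. x \<noteq> y \<and> \<not> good_pair (p x) (p y)"
    proof (cases "inj_on p K")
      case False
      then show ?thesis by (auto simp: inj_on_def good_pair_def)
    next
      case True
      then have "card (p ` K) = card K" by (rule card_image)
      then have "\<not> (\<forall>i\<in>p ` K. \<forall>j\<in>p ` K. i \<noteq> j \<longrightarrow> good_pair i j)"
        using K True by (auto simp: good_cliques_def good_type_def Q_def)
      then obtain x y where "x \<in> K" "y \<in> K" "p x \<noteq> p y" "\<not> good_pair (p x) (p y)" by auto
      then show ?thesis by metis
    qed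
    then obtain x y where "x \<in> K" "y \<in> K" "(x, y) \<in> bad_arcs"
      using clique by (auto simp: bad_arcs_def)
    moreover have "0 \<le> f K" using K f_nonneg_Q by blast
    ultimately show "f K \<le> (\<Sum>e\<in>{e \<in> bad_arcs. fst e \<in> K \<and> snd e \<in> K}. f K)"
      using finite_bad_arcs by (intro member_le_sum[of "(x, y)" _ "\<lambda>_. f K"]) auto
  qed
  also have "\<dots> = (\<Sum>e\<in>bad_arcs. \<Sum>K\<in>{K \<in> Q - good_cliques. fst e \<in> K \<and> snd e \<in> K}. f K)"
    by (rule sum.swap_restrict) (use finite_Q finite_bad_arcs in auto)
  also have "\<dots> \<le> (\<Sum>e\<in>bad_arcs. real (card V) ^ (t - 2))"
  proof (rule sum_mono)
    fix e assume e: "e \<in> bad_arcs"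
    have "(\<Sum>K\<in>{K \<in> Q - good_cliques. fst e \<in> K \<and> snd e \<in> K}. f K) \<le> (\<Sum>K\<in>{K \<in> Q. fst e \<in> K \<and> snd e \<in> K}. f K)"
      using finite_Q f_nonneg_Q by (intro sum_mono2) auto
    also have "\<dots> \<le> real (card V) ^ (t - 2)"
      using e arc_verts[of "fst e" "snd e"] by (intro pair_weight) (auto simp: bad_arcs_def)
    finally show "(\<Sum>K\<in>{K \<in> Q - good_cliques. fst e \<in> K \<and> snd e \<in> K}. f K) \<le> real (card V) ^ (t - 2)" .
  qed
  finally show ?thesis by simp
qed

lemma cell_eq: "cell V p x = C (p x)"
  by (simp add: cell_def C_def)

text \<open>Sparse pairs of cells are a union of fibres of the product labelling. There adjacency
  may be replaced by its average, which is below \<open>d\<close>.\<close>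

lemma sparse_arcs:
  "real (card {(x, y) \<in> parcs G. dens adj (C (p x)) (C (p y)) < d}) \<le> d * (real (card V))\<^sup>2"
proof -
  let ?Z = "V \<times> V" and ?\<pi> = "map_prod p p"
  let ?g = "\<lambda>(x, y). of_bool (dens adj (C (p x)) (C (p y)) < d) :: real"
  have finZ: "finite ?Z" using finite_V by simp
  have "real (card {(x, y) \<in> parcs G. dens adj (C (p x)) (C (p y)) < d}) = (\<Sum>z\<in>{(x, y) \<in> parcs G. dens adj (C (p x)) (C (p y)) < d}. 1)"
    by simp
  also have "\<dots> = (\<Sum>z\<in>?Z. ?g z * case_prod adj z)"
    using finZ arc_verts by (intro sum.mono_neutral_cong_left) (auto simp: adj_def)
  also have "\<dots> = (\<Sum>z\<in>?Z. ?g z * avg ?Z ?\<pi> (case_prod adj) z)"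
    by (rule avg_inner[OF finZ, symmetric]) auto
  also have "\<dots> \<le> (\<Sum>z\<in>?Z. d)"
    using d by (intro sum_mono) (auto simp: avg_pair_eq_dens cell_eq)
  finally show ?thesis by (simp add: card_cartesian_product power2_eq_square mult_ac)
qed

lemma small_cells:
  assumes L: "p ` V \<subseteq> {..<L}"
  shows "real (card {x \<in> V. real (card (C (p x))) < \<mu> * real (card V)}) \<le> real L * \<mu> * real (card V)"
proof -
  let ?S = "{i \<in> {..<L}. real (card (C i)) < \<mu> * real (card V)}"
  have "card {x \<in> V. real (card (C (p x))) < \<mu> * real (card V)} \<le> card (\<Union>i\<in>?S. C i)"
    using L finite_C by (intro card_mono) (auto simp: C_def)
  also have "\<dots> \<le> (\<Sum>i\<in>?S. card (C i))" by (rule card_UN_le) simp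
  finally have "real (card {x \<in> V. real (card (C (p x))) < \<mu> * real (card V)}) \<le> (\<Sum>i\<in>?S. real (card (C i)))"
    by (simp only: of_nat_sum[symmetric] of_nat_le_iff)
  also have "\<dots> \<le> (\<Sum>i\<in>?S. \<mu> * real (card V))" by (rule sum_mono) auto
  also have "\<dots> = real (card ?S) * (\<mu> * real (card V))" by simp
  also have "\<dots> \<le> real L * (\<mu> * real (card V))"
    using card_mono[of "{..<L}" ?S] \<mu> by (intro mult_right_mono) auto
  finally show ?thesis by (simp add: mult.assoc)
qed

text \<open>An arc is bad because of a common cell, an irregular pair, a sparse pair, or a small
  cell at one of its two ends; the last case gives the factor 2.\<close>

lemma card_bad_arcs:
  assumes L: "p ` V \<subseteq> {..<L}"
  shows "real (card bad_arcs) \<le> real (card {(x, y) \<in> V \<times> V. p x = p y})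
     + real (card (irregular_pairs V adj \<epsilon> p)) + d * (real (card V))\<^sup>2 + 2 * real L * \<mu> * (real (card V))\<^sup>2"
proof -
  let ?S = "{x \<in> V. real (card (C (p x))) < \<mu> * real (card V)}"
  let ?A1 = "{(x, y) \<in> V \<times> V. p x = p y}" and ?A2 = "irregular_pairs V adj \<epsilon> p"
    and ?A3 = "{(x, y) \<in> parcs G. dens adj (C (p x)) (C (p y)) < d}"
  have "bad_arcs \<subseteq> ?A1 \<union> (?A2 \<union> (?A3 \<union> (?S \<times> V \<union> V \<times> ?S)))"
    using arc_verts by (auto simp: bad_arcs_def good_pair_def irregular_pairs_def cell_eq not_le)
  moreover have "finite (?A1 \<union> (?A2 \<union> (?A3 \<union> (?S \<times> V \<union> V \<times> ?S))))"
    by (rule finite_subset[of _ "V \<times> V"]) (use finite_V arc_verts in \<open>auto simp: irregular_pairs_def\<close>)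
  ultimately have "card bad_arcs \<le> card (?A1 \<union> (?A2 \<union> (?A3 \<union> (?S \<times> V \<union> V \<times> ?S))))"
    by (intro card_mono)
  also have "\<dots> \<le> card ?A1 + (card ?A2 + (card ?A3 + (card (?S \<times> V) + card (V \<times> ?S))))"
    by (intro order_trans[OF card_Un_le] add_left_mono order_refl)
  finally have "real (card bad_arcs) \<le> real (card ?A1) + real (card ?A2) + real (card ?A3) + 2 * (real (card ?S) * real (card V))"
    by (simp add: card_cartesian_product mult.commute flip: of_nat_add of_nat_mult)
  moreover have "real (card ?S) * real (card V) \<le> real L * \<mu> * real (card V) * real (card V)"
    using small_cells[OF L] by (rule mult_right_mono) simp
  ultimately show ?thesis using sparse_arcs by (simp add: power2_eq_square mult_ac)
qed

definition W :: "nat set \<Rightarrow> real" where "W I = (\<Sum>K\<in>typed I. f K)"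

definition N :: "nat set \<Rightarrow> real" where "N I = real (card (typed I))"

text \<open>On good patterns this is the average of \<open>f\<close> over the cliques of the same
  pattern; bad cliques are given up.\<close>

definition spread :: "'a set \<Rightarrow> real" where
  "spread K = (if K \<in> good_cliques then W (p ` K) / N (p ` K) else 0)"

lemma good_types_D:
  assumes "I \<in> good_types"
  shows "finite I" "I \<noteq> {}" "t < card I" "card I \<le> s" "I \<subseteq> p ` V"
    and "i \<in> I \<Longrightarrow> j \<in> I \<Longrightarrow> i \<noteq> j \<Longrightarrow> good_pair i j"
proof -
  show c: "t < card I" "card I \<le> s" "I \<subseteq> p ` V"
    "i \<in> I \<Longrightarrow> j \<in> I \<Longrightarrow> i \<noteq> j \<Longrightarrow> good_pair i j"
    using assms by (auto simp: good_types_def good_type_def)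
  show "finite I" using c(1) card.infinite by fastforce
  show "I \<noteq> {}" using c(1) by auto
qed

lemma finite_good_types: "finite good_types"
  using finite_V by (simp add: good_types_def)

lemma typed_card_eq: "K \<in> typed I \<Longrightarrow> card K = card I"
  by (auto simp: typed_def card_image)

lemma good_cliques_eq: "good_cliques = (\<Union>I\<in>good_types. typed I)"
proof (intro equalityI subsetI)
  fix K assume K: "K \<in> good_cliques"
  then have "K \<subseteq> V" by (auto simp: good_cliques_def Q_def cliques_def)
  then have "p ` K \<in> good_types" using K by (auto simp: good_cliques_def good_types_def)
  moreover have "K \<in> typed (p ` K)" using K by (simp add: good_cliques_def typed_def Q_def)
  ultimately show "K \<in> (\<Union>I\<in>good_types. typed I)" by blast
next
  fix K assume "K \<in> (\<Union>I\<in>good_types. typed I)"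
  then obtain I where I: "I \<in> good_types" "K \<in> typed I" by blast
  then show "K \<in> good_cliques"
    using good_types_D[OF I(1)] typed_card_eq[OF I(2)]
    by (auto simp: good_cliques_def typed_def Q_def good_types_def)
qed

lemma typed_type: "K \<in> typed I \<Longrightarrow> p ` K = I"
  by (simp add: typed_def)

lemma typed_disjoint: "I \<noteq> J \<Longrightarrow> typed I \<inter> typed J = {}"
  by (auto simp: typed_def)

lemma sum_good_cliques: "(\<Sum>K\<in>good_cliques. g K) = (\<Sum>I\<in>good_types. \<Sum>K\<in>typed I. g K)"
  unfolding good_cliques_eq
  by (rule sum.UNION_disjoint) (use finite_good_types finite_typed typed_disjoint in auto)

lemma spread_typed: "I \<in> good_types \<Longrightarrow> K \<in> typed I \<Longrightarrow> spread K = W I / N I"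
  using good_cliques_eq typed_type by (auto simp: spread_def)

lemma good_sub_Q: "good_cliques \<subseteq> Q" by (auto simp: good_cliques_def)

lemma W_nonneg: "I \<in> good_types \<Longrightarrow> 0 \<le> W I"
  unfolding W_def using good_cliques_eq good_sub_Q f_nonneg_Q by (intro sum_nonneg) blast

lemma N_nonneg: "0 \<le> N I" by (simp add: N_def)

lemma spread_nonneg: "0 \<le> spread K"
  unfolding spread_def using W_nonneg N_nonneg good_cliques_eq typed_type by auto

text \<open>The factor \<open>b\<close> sees only the size, which is constant on a pattern, and each
  good pattern keeps its total weight.\<close>

lemma spread_value:
  "(\<Sum>K\<in>Q. b (card K) * spread K) = (\<Sum>K\<in>good_cliques. b (card K) * f K)"
proof -
  have "(\<Sum>K\<in>Q. b (card K) * spread K) = (\<Sum>K\<in>good_cliques. b (card K) * spread K)"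
    using finite_Q good_sub_Q by (intro sum.mono_neutral_right) (auto simp: spread_def)
  also have "\<dots> = (\<Sum>I\<in>good_types. \<Sum>K\<in>typed I. b (card I) * (W I / N I))"
    unfolding sum_good_cliques using spread_typed typed_card_eq by (intro sum.cong refl) auto
  also have "\<dots> = (\<Sum>I\<in>good_types. b (card I) * W I)"
  proof (rule sum.cong[OF refl])
    fix I assume "I \<in> good_types"
    \<comment> \<open>Division by zero is harmless here: an empty pattern carries no weight.\<close>
    have "W I = 0" if "N I = 0" using that finite_typed[of I] by (simp add: N_def W_def)
    then have "N I * (W I / N I) = W I" by auto
    then show "(\<Sum>K\<in>typed I. b (card I) * (W I / N I)) = b (card I) * W I"
      by (simp flip: N_def) (metis mult.left_commute)
  qed
  also have "\<dots> = (\<Sum>K\<in>good_cliques. b (card K) * f K)"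
    unfolding sum_good_cliques W_def sum_distrib_left using typed_card_eq by (intro sum.cong refl) auto
  finally show ?thesis .
qed

lemma part_typed:
  assumes K: "K \<in> typed I" and J: "J \<subseteq> I" "J \<noteq> {}"
  shows "{x \<in> K. p x \<in> J} \<in> typed J"
    and "T \<in> typed J \<Longrightarrow> T \<subseteq> K \<Longrightarrow> T = {x \<in> K. p x \<in> J}"
proof -
  have K': "K \<in> cliques G" "inj_on p K" "p ` K = I" using K by (auto simp: typed_def)
  have im: "p ` {x \<in> K. p x \<in> J} = J" using K'(3) J by auto
  then have "{x \<in> K. p x \<in> J} \<noteq> {}" using J by auto
  then have "{x \<in> K. p x \<in> J} \<in> cliques G" by (intro subclique[OF K'(1)]) auto
  then show "{x \<in> K. p x \<in> J} \<in> typed J"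
    using K'(2) im by (auto simp: typed_def inj_on_def)
  assume T: "T \<in> typed J" "T \<subseteq> K"
  then have "p ` T = J" by (simp add: typed_def)
  then show "T = {x \<in> K. p x \<in> J}"
    using T(2) K'(2) by (auto simp: inj_on_def)
qed

lemma typed_t_cliques: "card J = t \<Longrightarrow> typed J \<subseteq> cliques_of_size t G"
  using typed_card_eq by (auto simp: cliques_of_size_def typed_def card_image)

text \<open>Each clique whose pattern contains \<open>J\<close> is charged to its part over
  \<open>J\<close>. Consequently the spread weights give the \<open>t\<close>-cliques of pattern
  \<open>J\<close> an average load of at most 1.\<close>

lemma weight_over_type:
  assumes J: "card J = t"
  shows "(\<Sum>I\<in>{I \<in> good_types. J \<subseteq> I}. W I) \<le> N J"
proof -
  let ?S = "\<Union>I\<in>{I \<in> good_types. J \<subseteq> I}. typed I"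
  have Jne: "J \<noteq> {}" using J t by auto
  have "(\<Sum>I\<in>{I \<in> good_types. J \<subseteq> I}. W I) = (\<Sum>K\<in>?S. f K)"
    unfolding W_def
    by (rule sum.UNION_disjoint[symmetric]) (use finite_good_types finite_typed typed_disjoint in auto)
  also have "\<dots> \<le> real (card (typed J))"
  proof (rule weight_le_card_subcliques)
    show "?S \<subseteq> Q" using good_cliques_eq good_sub_Q by blast
    show "typed J \<subseteq> cliques_of_size t G" by (rule typed_t_cliques[OF J])
    show "\<exists>T\<in>typed J. T \<subseteq> K" if K: "K \<in> ?S" for K
    proof -
      obtain I where I: "K \<in> typed I" "J \<subseteq> I" using K by auto
      show ?thesis by (rule bexI[OF _ part_typed(1)[OF I Jne]]) auto
    qed
  qed
  finally show ?thesis by (simp add: N_def)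
qed

lemma pairs_good:
  assumes "I \<in> good_types" "(i, j) \<in> pairs I"
  shows "good_pair i j"
  using assms good_types_D(6)[of I i j] by (auto simp: pairs_def)

lemma N_lower:
  assumes I: "I \<in> good_types"
  shows "\<kappa> * (\<Prod>k\<in>I. real (card (C k))) \<le> N I"
  unfolding \<kappa>_def N_def
  by (rule typed_card) (use good_types_D[OF I] pairs_good[OF I] \<epsilon> d in \<open>auto simp: good_pair_def\<close>)

lemma extensions_sum:
  assumes J: "J \<subseteq> I" "J \<noteq> {}"
  shows "(\<Sum>T\<in>typed J. real (card (extensions I T))) = N I"
proof -
  have "(\<Sum>T\<in>typed J. real (card (extensions I T))) = (\<Sum>T\<in>typed J. \<Sum>K\<in>{K \<in> typed I. T \<subseteq> K}. 1)"
    by (simp add: extensions_def)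
  also have "\<dots> = (\<Sum>K\<in>typed I. \<Sum>T\<in>{T \<in> typed J. T \<subseteq> K}. 1)"
    by (rule sum.swap_restrict[OF finite_typed finite_typed])
  also have "\<dots> = (\<Sum>K\<in>typed I. 1)"
  proof (rule sum.cong[OF refl])
    fix K assume K: "K \<in> typed I"
    have "{T \<in> typed J. T \<subseteq> K} = {{x \<in> K. p x \<in> J}}"
      using part_typed[OF K J] by blast
    then show "(\<Sum>T\<in>{T \<in> typed J. T \<subseteq> K}. (1::real)) = 1" by simp
  qed
  finally show ?thesis by (simp add: N_def)
qed

text \<open>\<open>extension_count\<close> supplies some centre \<open>m\<close>. Its distance from
  the true mean \<open>N I / N J\<close> is at most the average deviation, so recentring costs a
  factor 2. Then \<open>N_lower\<close> turns the product of cell sizes into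
  \<open>N I / \<kappa>\<close>.\<close>

lemma extension_deviation:
  assumes I: "I \<in> good_types" and J: "J \<subseteq> I" "J \<noteq> {}"
  shows "(\<Sum>T\<in>typed J. \<bar>real (card (extensions I T)) - N I / N J\<bar>) \<le> 8 * real (s\<^sup>2) * \<epsilon> / \<kappa> * N I"
proof -
  note D = good_types_D[OF I]
  obtain m where m: "(\<Sum>T\<in>typed J. \<bar>real (card (extensions I T)) - m\<bar>)
      \<le> 4 * real (s\<^sup>2) * \<epsilon> * (\<Prod>k\<in>I. real (card (C k)))"
    using extension_count[OF D(1,4) J \<epsilon>] pairs_good[OF I] by (auto simp: good_pair_def)
  let ?X = "\<Sum>T\<in>typed J. \<bar>real (card (extensions I T)) - m\<bar>"
  have mean: "N J * \<bar>m - N I / N J\<bar> \<le> ?X"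
  proof (cases "N J = 0")
    case True
    then show ?thesis by (simp add: sum_nonneg)
  next
    case False
    have "N J * \<bar>m - N I / N J\<bar> = \<bar>N J * (m - N I / N J)\<bar>"
      using N_nonneg[of J] by (simp add: abs_mult)
    also have "N J * (m - N I / N J) = N J * m - N I"
      using False by (simp add: right_diff_distrib)
    also have "N J * m - N I = - (\<Sum>T\<in>typed J. real (card (extensions I T)) - m)"
      using extensions_sum[OF J] by (simp add: sum_subtractf N_def)
    also have "\<bar>\<dots>\<bar> \<le> ?X" by (simp add: sum_abs)
    finally show ?thesis .
  qed
  have "(\<Sum>T\<in>typed J. \<bar>real (card (extensions I T)) - N I / N J\<bar>)
      \<le> (\<Sum>T\<in>typed J. \<bar>real (card (extensions I T)) - m\<bar> + \<bar>m - N I / N J\<bar>)"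
    by (rule sum_mono) linarith
  also have "\<dots> = ?X + N J * \<bar>m - N I / N J\<bar>" by (simp add: sum.distrib N_def)
  also have "\<dots> \<le> 2 * ?X" using mean by simp
  also have "\<dots> \<le> 8 * real (s\<^sup>2) * \<epsilon> * (\<Prod>k\<in>I. real (card (C k)))" using m by linarith
  also have "\<dots> \<le> 8 * real (s\<^sup>2) * \<epsilon> * (N I / \<kappa>)"
    using N_lower[OF I] \<kappa>_pos \<epsilon> by (intro mult_left_mono) (auto simp: pos_le_divide_eq mult.commute)
  finally show ?thesis by simp
qed

definition load :: "'a set \<Rightarrow> real" where
  "load T = (\<Sum>K\<in>{K \<in> Q. T \<subseteq> K}. spread K)"

lemma load_eq: "load T = (\<Sum>I\<in>good_types. W I / N I * real (card (extensions I T)))"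
proof -
  have "load T = (\<Sum>K\<in>good_cliques. if T \<subseteq> K then spread K else 0)"
    unfolding load_def using finite_Q good_sub_Q
    by (intro sum.mono_neutral_cong) (auto simp: spread_def finite_subset[OF good_sub_Q])
  also have "\<dots> = (\<Sum>I\<in>good_types. \<Sum>K\<in>typed I. if T \<subseteq> K then W I / N I else 0)"
    unfolding sum_good_cliques using spread_typed by (intro sum.cong refl) auto
  also have "\<dots> = (\<Sum>I\<in>good_types. W I / N I * real (card (extensions I T)))"
  proof (rule sum.cong[OF refl])
    fix I
    have "(\<Sum>K\<in>typed I. if T \<subseteq> K then W I / N I else 0) = (\<Sum>K\<in>extensions I T. W I / N I)"
      unfolding extensions_def using finite_typed by (intro sum.mono_neutral_cong_right) auto
    then show "(\<Sum>K\<in>typed I. if T \<subseteq> K then W I / N I else 0) = W I / N I * real (card (extensions I T))"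
      by simp
  qed
  finally show ?thesis .
qed

text \<open>If every extension count had its mean value, the load would be at most 1 by
  \<open>weight_over_type\<close>; only deviations create excess.\<close>

lemma load_excess_at:
  assumes J: "card J = t" and T: "T \<in> typed J"
  shows "max 0 (load T - 1) \<le> (\<Sum>I\<in>{I \<in> good_types. J \<subseteq> I}. W I / N I * \<bar>real (card (extensions I T)) - N I / N J\<bar>)"
proof -
  let ?GJ = "{I \<in> good_types. J \<subseteq> I}"
  let ?R = "\<Sum>I\<in>?GJ. W I / N I * \<bar>real (card (extensions I T)) - N I / N J\<bar>"
  have TJ: "p ` T = J" using T by (simp add: typed_def)
  have NJ: "0 < N J" using T finite_typed[of J] by (auto simp: N_def card_gt_0_iff)
  have "extensions I T = {}" if "\<not> J \<subseteq> I" for I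
    using that TJ by (auto simp: extensions_def typed_def)
  then have "load T = (\<Sum>I\<in>?GJ. W I / N I * real (card (extensions I T)))"
    unfolding load_eq using finite_good_types by (intro sum.mono_neutral_right) auto
  moreover have "(\<Sum>I\<in>?GJ. W I / N I * (N I / N J)) \<le> 1"
  proof -
    have "(\<Sum>I\<in>?GJ. W I / N I * (N I / N J)) \<le> (\<Sum>I\<in>?GJ. W I / N J)"
      using W_nonneg NJ by (intro sum_mono) (auto simp: field_simps)
    also have "\<dots> = (\<Sum>I\<in>?GJ. W I) / N J" by (simp add: sum_divide_distrib)
    also have "\<dots> \<le> 1" using weight_over_type[OF J] NJ by simp
    finally show ?thesis .
  qed
  ultimately have "load T - 1 \<le> (\<Sum>I\<in>?GJ. W I / N I * (real (card (extensions I T)) - N I / N J))"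
    by (simp add: sum_subtractf right_diff_distrib)
  also have "\<dots> \<le> ?R"
    using W_nonneg N_nonneg by (intro sum_mono mult_left_mono divide_nonneg_nonneg) auto
  finally have "load T - 1 \<le> ?R" .
  moreover have "0 \<le> ?R"
    using W_nonneg N_nonneg by (intro sum_nonneg mult_nonneg_nonneg divide_nonneg_nonneg) auto
  ultimately show ?thesis by simp
qed

lemma load_not_inj:
  assumes "\<not> inj_on p T"
  shows "load T = 0"
  unfolding load_def
proof (rule sum.neutral, rule ballI)
  fix K assume "K \<in> {K \<in> Q. T \<subseteq> K}"
  then have "\<not> inj_on p K" using assms inj_on_subset by auto
  then show "spread K = 0" by (simp add: spread_def good_cliques_def)
qed

text \<open>The factor \<open>N I\<close> in the deviation bound cancels the denominator of the
  spread weight. A good pattern has at most \<open>2 ^ s\<close> subpatterns, and the total weight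
  is at most \<open>card V ^ t\<close>.\<close>

lemma load_excess:
  "(\<Sum>T\<in>cliques_of_size t G. max 0 (load T - 1)) \<le> 8 * real (s\<^sup>2) * \<epsilon> / \<kappa> * 2 ^ s * real (card V) ^ t"
proof -
  let ?JT = "{J \<in> Pow (p ` V). card J = t}"
  define c where "c = 8 * real (s\<^sup>2) * \<epsilon> / \<kappa>"
  let ?dev = "\<lambda>I J T. \<bar>real (card (extensions I T)) - N I / N J\<bar>"
  have c0: "0 \<le> c" using \<epsilon> \<kappa>_pos by (simp add: c_def)
  have finJT: "finite ?JT" using finite_V by simp
  have un: "{T \<in> cliques_of_size t G. inj_on p T} = (\<Union>J\<in>?JT. typed J)"
  proof (intro equalityI subsetI)
    fix T assume T: "T \<in> {T \<in> cliques_of_size t G. inj_on p T}"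
    then have "T \<subseteq> V" "card (p ` T) = t" "T \<in> typed (p ` T)"
      by (auto simp: cliques_of_size_def cliques_def typed_def card_image)
    then show "T \<in> (\<Union>J\<in>?JT. typed J)" by (intro UN_I[of "p ` T"]) auto
  next
    fix T assume "T \<in> (\<Union>J\<in>?JT. typed J)"
    then show "T \<in> {T \<in> cliques_of_size t G. inj_on p T}"
      using typed_t_cliques by (auto simp: typed_def)
  qed
  have "(\<Sum>T\<in>cliques_of_size t G. max 0 (load T - 1)) = (\<Sum>T\<in>{T \<in> cliques_of_size t G. inj_on p T}. max 0 (load T - 1))"
    using finite_cliques_of_size load_not_inj by (intro sum.mono_neutral_right) auto
  also have "\<dots> = (\<Sum>J\<in>?JT. \<Sum>T\<in>typed J. max 0 (load T - 1))"
    unfolding un by (rule sum.UNION_disjoint) (use finJT finite_typed typed_disjoint in auto)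
  also have "\<dots> \<le> (\<Sum>J\<in>?JT. \<Sum>I\<in>{I \<in> good_types. J \<subseteq> I}. c * W I)"
  proof (rule sum_mono)
    fix J assume "J \<in> ?JT"
    then have J: "card J = t" by simp
    then have Jne: "J \<noteq> {}" using t by auto
    have "(\<Sum>T\<in>typed J. max 0 (load T - 1)) \<le> (\<Sum>T\<in>typed J. \<Sum>I\<in>{I \<in> good_types. J \<subseteq> I}. W I / N I * ?dev I J T)"
      by (intro sum_mono load_excess_at J)
    also have "\<dots> = (\<Sum>I\<in>{I \<in> good_types. J \<subseteq> I}. W I / N I * (\<Sum>T\<in>typed J. ?dev I J T))"
      unfolding sum_distrib_left by (rule sum.swap)
    also have "\<dots> \<le> (\<Sum>I\<in>{I \<in> good_types. J \<subseteq> I}. c * W I)"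
    proof (rule sum_mono)
      fix I assume I: "I \<in> {I \<in> good_types. J \<subseteq> I}"
      then have "W I / N I * (\<Sum>T\<in>typed J. ?dev I J T) \<le> W I / N I * (c * N I)"
        using W_nonneg N_nonneg extension_deviation[of I J, folded c_def] Jne
        by (intro mult_left_mono divide_nonneg_nonneg) auto
      also have "\<dots> \<le> c * W I"
        using I W_nonneg[of I] c0 by (cases "N I = 0") auto
      finally show "W I / N I * (\<Sum>T\<in>typed J. ?dev I J T) \<le> c * W I" .
    qed
    finally show "(\<Sum>T\<in>typed J. max 0 (load T - 1)) \<le> (\<Sum>I\<in>{I \<in> good_types. J \<subseteq> I}. c * W I)" .
  qed
  also have "\<dots> = (\<Sum>I\<in>good_types. \<Sum>J\<in>{J \<in> ?JT. J \<subseteq> I}. c * W I)"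
    by (rule sum.swap_restrict[OF finJT finite_good_types])
  also have "\<dots> \<le> (\<Sum>I\<in>good_types. 2 ^ s * (c * W I))"
  proof (rule sum_mono)
    fix I assume I: "I \<in> good_types"
    have "card {J \<in> ?JT. J \<subseteq> I} \<le> card (Pow I)"
      using good_types_D(1)[OF I] by (intro card_mono) auto
    also have "\<dots> \<le> 2 ^ s" using good_types_D[OF I] by (simp add: card_Pow)
    finally have "real (card {J \<in> ?JT. J \<subseteq> I}) \<le> real (2 ^ s)" by (simp only: of_nat_le_iff)
    then have "real (card {J \<in> ?JT. J \<subseteq> I}) * (c * W I) \<le> 2 ^ s * (c * W I)"
      using c0 W_nonneg[OF I] by (intro mult_right_mono mult_nonneg_nonneg) auto
    then show "(\<Sum>J\<in>{J \<in> ?JT. J \<subseteq> I}. c * W I) \<le> 2 ^ s * (c * W I)" by simp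
  qed
  also have "\<dots> = c * 2 ^ s * (\<Sum>I\<in>good_types. W I)"
    by (simp add: sum_distrib_left mult_ac)
  also have "\<dots> \<le> c * 2 ^ s * real (card V) ^ t"
  proof (rule mult_left_mono)
    have "(\<Sum>I\<in>good_types. W I) = (\<Sum>K\<in>good_cliques. f K)"
      by (simp add: W_def sum_good_cliques)
    also have "\<dots> \<le> (\<Sum>K\<in>Q. f K)"
      using finite_Q good_sub_Q f_nonneg_Q by (intro sum_mono2) auto
    finally show "(\<Sum>I\<in>good_types. W I) \<le> real (card V) ^ t" using total_weight by linarith
  qed (use c0 in simp)
  finally show ?thesis unfolding c_def .
qed

lemma N_le: "finite J \<Longrightarrow> J \<noteq> {} \<Longrightarrow> N J \<le> (\<Prod>k\<in>J. real (card (C k)))"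
proof -
  assume J: "finite J" "J \<noteq> {}"
  have "card (typed J) = card (transversals J)"
    using bij_betw_same_card[OF transversal_image_bij[OF J]] by simp
  also have "\<dots> \<le> card (PiE J C)"
    using J finite_C by (intro card_mono finite_PiE) (auto simp: transversals_def)
  also have "\<dots> = (\<Prod>k\<in>J. card (C k))" using J by (simp add: card_PiE)
  finally have "real (card (typed J)) \<le> real (\<Prod>k\<in>J. card (C k))" by (simp only: of_nat_le_iff)
  then show ?thesis by (simp add: N_def)
qed

text \<open>For a part \<open>J\<close> of \<open>I\<close> of size \<open>t\<close>,
  \<open>W I\<close> is at most the product of the cell sizes over \<open>J\<close>, while
  \<open>N I\<close> is at least \<kappa> times the product over \<open>I\<close>. The quotient
  leaves \<open>card I - t\<close> cells with at least \<open>\<mu> * card V\<close> vertices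
  each.\<close>

lemma spread_bound:
  assumes K: "K \<in> Q" and V: "V \<noteq> {}"
  shows "spread K * real (card V) ^ (card K - t) \<le> 1 / (\<kappa> * \<mu> ^ s)"
proof (cases "K \<in> good_cliques")
  case False
  then show ?thesis using \<kappa>_pos \<mu> by (simp add: spread_def)
next
  case True
  then obtain I where I: "I \<in> good_types" "K \<in> typed I" by (auto simp: good_cliques_eq)
  note D = good_types_D[OF I(1)]
  let ?n = "real (card V)" and ?m = "card I - t"
  have n: "0 < ?n" using V finite_V by (simp add: card_gt_0_iff)
  obtain J where J: "J \<subseteq> I" "card J = t"
    using obtain_subset_with_card_n[of t I] D(3) by auto
  have finJ: "finite J" "J \<noteq> {}" using J D(1) t finite_subset by auto
  let ?PJ = "\<Prod>k\<in>J. real (card (C k))" and ?PD = "\<Prod>k\<in>I - J. real (card (C k))"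
  have cells: "\<mu> * ?n \<le> real (card (C k))" if k: "k \<in> I" for k
  proof -
    \<comment> \<open>\<open>good_pair\<close> speaks of two different cells, so a second element of
      \<open>I\<close> is needed to read off the size of \<open>C k\<close>.\<close>
    have "\<not> I \<subseteq> {k}"
      using D(3) t card_mono[of "{k}" I] by auto
    then obtain j where "j \<in> I" "j \<noteq> k" by auto
    then show ?thesis using D(6)[OF k] by (auto simp: good_pair_def)
  qed
  have PJ: "0 < ?PJ"
    using cells J(1) n \<mu> by (intro prod_pos) (meson less_le_trans mult_pos_pos subsetD)
  have cardD: "card (I - J) = ?m" using J finJ by (simp add: card_Diff_subset)
  have "(\<mu> * ?n) ^ ?m = (\<Prod>k\<in>I - J. \<mu> * ?n)" by (simp add: cardD)
  also have "\<dots> \<le> ?PD" using cells \<mu> by (intro prod_mono) auto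
  finally have PD: "(\<mu> * ?n) ^ ?m \<le> ?PD" .
  have "W I \<le> (\<Sum>I\<in>{I \<in> good_types. J \<subseteq> I}. W I)"
    using I(1) J(1) finite_good_types W_nonneg by (intro member_le_sum) auto
  also have "\<dots> \<le> ?PJ" using weight_over_type[OF J(2)] N_le[OF finJ] by linarith
  finally have WI: "W I \<le> ?PJ" .
  have "?PJ * (\<kappa> * (\<mu> * ?n) ^ ?m) \<le> \<kappa> * (?PD * ?PJ)"
    using PD PJ \<kappa>_pos by (simp add: mult_ac)
  also have "?PD * ?PJ = (\<Prod>k\<in>I. real (card (C k)))"
    using prod.subset_diff[OF J(1) D(1), of "\<lambda>k. real (card (C k))"] by simp
  also have "\<kappa> * \<dots> \<le> N I" by (rule N_lower[OF I(1)])
  finally have NI: "?PJ * (\<kappa> * (\<mu> * ?n) ^ ?m) \<le> N I" .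
  have pos: "0 < \<kappa> * (\<mu> * ?n) ^ ?m" using \<kappa>_pos \<mu> n by simp
  then have NI0: "0 < N I" using NI PJ by (meson less_le_trans mult_pos_pos)
  have "W I * (\<kappa> * (\<mu> * ?n) ^ ?m) \<le> ?PJ * (\<kappa> * (\<mu> * ?n) ^ ?m)"
    using WI pos by (intro mult_right_mono) auto
  also have "\<dots> \<le> N I" by (rule NI)
  finally have "W I * ?n ^ ?m * (\<kappa> * \<mu> ^ ?m) \<le> N I"
    by (simp add: power_mult_distrib mult_ac)
  then have "W I / N I * ?n ^ ?m \<le> 1 / (\<kappa> * \<mu> ^ ?m)"
    using NI0 \<kappa>_pos \<mu> by (simp add: field_simps)
  also have "\<dots> \<le> 1 / (\<kappa> * \<mu> ^ s)"
  proof -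
    have "\<mu> ^ s \<le> \<mu> ^ ?m" using \<mu> D(4) by (intro power_decreasing) auto
    then have "\<kappa> * \<mu> ^ s \<le> \<kappa> * \<mu> ^ ?m" using \<kappa>_pos by simp
    then show ?thesis using \<kappa>_pos \<mu> by (intro divide_left_mono) auto
  qed
  finally show ?thesis
    using spread_typed[OF I] typed_card_eq[OF I(2)] by simp
qed

end

section \<open>From fractional to integral packings\<close>

definition mid_cliques :: "nat \<Rightarrow> nat \<Rightarrow> 'a pair_pre_digraph \<Rightarrow> 'a set set" where
  "mid_cliques t s G = {K \<in> cliques G. t < card K \<and> card K \<le> s}"

definition fractional_packing :: "nat \<Rightarrow> nat \<Rightarrow> 'a pair_pre_digraph \<Rightarrow> ('a set \<Rightarrow> real) \<Rightarrow> bool" where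
  "fractional_packing t s G f \<longleftrightarrow> (\<forall>K\<in>cliques G. 0 \<le> f K) \<and>
     (\<forall>T\<in>cliques_of_size t G. (\<Sum>K\<in>{K \<in> mid_cliques t s G. T \<subseteq> K}. f K) \<le> 1)"

text \<open>One \<open>w\<close> serves all value functions \<open>b\<close>. The bound \<delta>
  enters only through \<open>n0\<close>, because spreading makes codegrees inversely proportional to
  the number of vertices.\<close>

lemma spread_packing:
  fixes \<beta> \<delta> :: real
  assumes t: "2 \<le> t" "t < s" and \<beta>: "0 < \<beta>" and \<delta>: "0 < \<delta>"
  shows "\<exists>n0. \<forall>(G :: 'a pair_pre_digraph) f. pair_graph G \<longrightarrow> n0 < card (pverts G) \<longrightarrow> fractional_packing t s G f \<longrightarrow>
    (\<exists>w. (\<forall>K. 0 \<le> w K) \<and>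
      (\<Sum>T\<in>cliques_of_size t G. max 0 ((\<Sum>K\<in>{K \<in> mid_cliques t s G. T \<subseteq> K}. w K) - 1)) \<le> \<beta> * real (card (pverts G)) ^ t \<and>
      (\<forall>T\<in>cliques_of_size t G. \<forall>T'\<in>cliques_of_size t G. T \<noteq> T' \<longrightarrow>
        (\<Sum>K\<in>{K \<in> mid_cliques t s G. T \<subseteq> K \<and> T' \<subseteq> K}. w K) \<le> \<delta>) \<and>
      (\<forall>b. (\<forall>k. 0 \<le> b k \<and> b k \<le> 1) \<longrightarrow>
        (\<Sum>K\<in>mid_cliques t s G. b (card K) * f K) - \<beta> * real (card (pverts G)) ^ t
          \<le> (\<Sum>K\<in>mid_cliques t s G. b (card K) * w K)))"
proof -
  \<comment> \<open>Budget for bad arcs, in units of the squared number of vertices: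
    \<open>\<beta> / 4\<close> each for sparse pairs, small cells and the linear term in the count
    of pairs inside a cell, and \<open>\<beta> / 16\<close> each for irregular pairs and the
    quadratic term of that count.\<close>
  define d where "d = min 1 (\<beta> / 4)"
  define D where "D = d ^ s\<^sup>2"
  \<comment> \<open>The second bound makes \<kappa> at least \<open>D / 2\<close>; the third makes
    the coefficient in \<open>load_excess\<close> at most \<beta>.\<close>
  define \<epsilon> where "\<epsilon> = min (\<beta> / 16) (min (D / (16 * real (s\<^sup>2))) (\<beta> * D / (16 * real (s\<^sup>2) * 2 ^ s)))"
  have d: "0 < d" "d \<le> 1" "d \<le> \<beta> / 4" using \<beta> by (auto simp: d_def)
  have D: "0 < D" using d by (simp add: D_def)
  have s2: "0 < real (s\<^sup>2)" using t by simp
  have \<epsilon>: "0 < \<epsilon>" using \<beta> D s2 by (simp add: \<epsilon>_def)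
  have \<epsilon>1: "\<epsilon> \<le> \<beta> / 16" by (simp add: \<epsilon>_def)
  have "\<epsilon> \<le> D / (16 * real (s\<^sup>2))" by (simp add: \<epsilon>_def)
  then have \<epsilon>2: "4 * real (s\<^sup>2) * \<epsilon> \<le> D / 4" using s2 by (simp add: field_simps)
  have "\<epsilon> \<le> \<beta> * D / (16 * real (s\<^sup>2) * 2 ^ s)" by (simp add: \<epsilon>_def)
  then have \<epsilon>3: "8 * real (s\<^sup>2) * \<epsilon> * 2 ^ s \<le> \<beta> * (D / 2)" using s2 by (simp add: field_simps)
  from regular_partition[OF \<epsilon>, where 'a = 'a] obtain L where L: "0 < L" and part:
    "\<forall>(V :: 'a set) a. finite V \<longrightarrow> (\<forall>x y. 0 \<le> a x y \<and> a x y \<le> 1) \<longrightarrow>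
    (\<exists>p :: 'a \<Rightarrow> nat. p ` V \<subseteq> {..<L} \<and>
      real (card (irregular_pairs V a \<epsilon> p)) \<le> \<epsilon> * (real (card V))\<^sup>2 \<and>
      real (card {(x, y) \<in> V \<times> V. p x = p y}) \<le> \<epsilon> * (real (card V))\<^sup>2 + real (card V))"
    by (elim exE conjE)
  \<comment> \<open>Chosen after the number of cells \<open>L\<close>, since all small cells
    together must be negligible.\<close>
  define \<mu> where "\<mu> = min 1 (\<beta> / (8 * real L))"
  have \<mu>: "0 < \<mu>" "\<mu> \<le> 1" using \<beta> L by (auto simp: \<mu>_def)
  have "\<mu> \<le> \<beta> / (8 * real L)" by (simp add: \<mu>_def)
  then have L\<mu>: "2 * real L * \<mu> \<le> \<beta> / 4" using L by (simp add: field_simps)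
  define M where "M = 1 / ((D - 4 * real (s\<^sup>2) * \<epsilon>) * \<mu> ^ s)"
  have \<kappa>: "D / 2 \<le> D - 4 * real (s\<^sup>2) * \<epsilon>" using \<epsilon>2 D by linarith
  then have M: "0 < M" using D \<mu> by (simp add: M_def)
  \<comment> \<open>The first bound absorbs the linear term in the count of pairs inside a cell; the
    second brings the codegree, at most \<open>s * M\<close> over the number of vertices, below
    \<delta>.\<close>
  obtain n0 :: nat where n0: "max (4 / \<beta>) (real s * M / \<delta>) < real n0" using reals_Archimedean2 by blast
  show ?thesis
  proof (intro exI[of _ n0] allI impI)
    fix G :: "'a pair_pre_digraph" and f
    assume G: "pair_graph G" and n: "n0 < card (pverts G)" and f: "fractional_packing t s G f"
    let ?n = "real (card (pverts G))"
    have nn: "4 / \<beta> < ?n" "real s * M / \<delta> < ?n" "0 < ?n" using n n0 by auto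
    \<comment> \<open>A dummy labelling gives access to \<open>adj\<close>, which does not depend on
      labels, before the partition has been obtained.\<close>
    interpret labelled_graph G "\<lambda>_. 0" by (rule labelled_graph.intro[OF G])
    define a where "a = adj"
    have a: "\<forall>x y. 0 \<le> a x y \<and> a x y \<le> 1" using adj_range by (simp add: a_def)
    from part[rule_format, of V a] finite_V a obtain p :: "'a \<Rightarrow> nat" where p: "p ` V \<subseteq> {..<L}"
      "real (card (irregular_pairs V a \<epsilon> p)) \<le> \<epsilon> * ?n\<^sup>2"
      "real (card {(x, y) \<in> V \<times> V. p x = p y}) \<le> \<epsilon> * ?n\<^sup>2 + ?n" by auto
    interpret P: labelled_graph G p by (rule labelled_graph.intro[OF G])
    interpret S: spread_setup G p t s \<epsilon> d \<mu> f
    proof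
      show "4 * real (s\<^sup>2) * \<epsilon> < d ^ s\<^sup>2" using \<epsilon>2 D by (simp add: D_def)
      show "(\<Sum>K\<in>{K \<in> cliques G. t < card K \<and> card K \<le> s \<and> T \<subseteq> K}. f K) \<le> 1" if "T \<in> cliques_of_size t G" for T
        using f that by (simp add: fractional_packing_def mid_cliques_def conj_assoc)
      show "0 \<le> f K" if "K \<in> cliques G" for K
        using f that by (simp add: fractional_packing_def)
    qed (use t \<epsilon> d \<mu> in auto)
    have Q: "mid_cliques t s G = S.Q" by (simp add: mid_cliques_def S.Q_def)
    have aS: "a = P.adj" by (simp add: a_def)
    have M_eq: "1 / (S.\<kappa> * \<mu> ^ s) = M" by (simp add: M_def S.\<kappa>_def D_def)
    have bad: "real (card S.bad_arcs) \<le> \<beta> * ?n\<^sup>2"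
    proof -
      have "?n \<le> \<beta> / 4 * ?n\<^sup>2"
      proof -
        have "1 \<le> \<beta> / 4 * ?n" using nn(1) \<beta> by (simp add: field_simps)
        then have "1 * ?n \<le> \<beta> / 4 * ?n * ?n" using nn(3) by (intro mult_right_mono) auto
        then show ?thesis by (simp add: power2_eq_square mult.assoc)
      qed
      moreover have "d * ?n\<^sup>2 \<le> \<beta> / 4 * ?n\<^sup>2" using d by (intro mult_right_mono) auto
      moreover have "\<epsilon> * ?n\<^sup>2 \<le> \<beta> / 16 * ?n\<^sup>2" using \<epsilon>1 by (intro mult_right_mono) auto
      moreover have "2 * real L * \<mu> * ?n\<^sup>2 \<le> \<beta> / 4 * ?n\<^sup>2" using L\<mu> by (intro mult_right_mono) auto
      moreover have "0 \<le> \<beta> * ?n\<^sup>2" using \<beta> by simp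
      ultimately show ?thesis using S.card_bad_arcs[OF p(1)] p(2,3) unfolding aS by linarith
    qed
    show "\<exists>w. (\<forall>K. 0 \<le> w K) \<and>
      (\<Sum>T\<in>cliques_of_size t G. max 0 ((\<Sum>K\<in>{K \<in> mid_cliques t s G. T \<subseteq> K}. w K) - 1)) \<le> \<beta> * ?n ^ t \<and>
      (\<forall>T\<in>cliques_of_size t G. \<forall>T'\<in>cliques_of_size t G. T \<noteq> T' \<longrightarrow>
        (\<Sum>K\<in>{K \<in> mid_cliques t s G. T \<subseteq> K \<and> T' \<subseteq> K}. w K) \<le> \<delta>) \<and>
      (\<forall>b. (\<forall>k. 0 \<le> b k \<and> b k \<le> 1) \<longrightarrow>
        (\<Sum>K\<in>mid_cliques t s G. b (card K) * f K) - \<beta> * ?n ^ t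
          \<le> (\<Sum>K\<in>mid_cliques t s G. b (card K) * w K))"
      unfolding Q
    proof (intro exI[of _ S.spread] conjI allI ballI impI)
      show "0 \<le> S.spread K" for K by (rule S.spread_nonneg)
      have "8 * real (s\<^sup>2) * \<epsilon> / S.\<kappa> * 2 ^ s \<le> \<beta>"
      proof -
        have "\<beta> * (D / 2) \<le> \<beta> * S.\<kappa>" using \<kappa> \<beta> by (intro mult_left_mono) (auto simp: S.\<kappa>_def D_def)
        then have "8 * real (s\<^sup>2) * \<epsilon> * 2 ^ s \<le> \<beta> * S.\<kappa>" using \<epsilon>3 by linarith
        then show ?thesis using S.\<kappa>_pos by (simp add: pos_divide_le_eq)
      qed
      then have "8 * real (s\<^sup>2) * \<epsilon> / S.\<kappa> * 2 ^ s * ?n ^ t \<le> \<beta> * ?n ^ t" by (rule mult_right_mono) simp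
      then show "(\<Sum>T\<in>cliques_of_size t G. max 0 ((\<Sum>K\<in>{K \<in> S.Q. T \<subseteq> K}. S.spread K) - 1)) \<le> \<beta> * ?n ^ t"
        using S.load_excess unfolding S.load_def by linarith
    next
      fix b :: "nat \<Rightarrow> real" assume b: "\<forall>k. 0 \<le> b k \<and> b k \<le> 1"
      have "(\<Sum>K\<in>S.Q. b (card K) * f K) = (\<Sum>K\<in>S.good_cliques. b (card K) * f K) + (\<Sum>K\<in>S.Q - S.good_cliques. b (card K) * f K)"
        using sum.subset_diff[OF S.good_sub_Q S.finite_Q] by (simp add: add.commute)
      moreover have "(\<Sum>K\<in>S.Q - S.good_cliques. b (card K) * f K) \<le> (\<Sum>K\<in>S.Q - S.good_cliques. f K)"
        using b S.f_nonneg_Q by (intro sum_mono mult_left_le_one_le) auto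
      moreover have "(\<Sum>K\<in>S.Q - S.good_cliques. f K) \<le> \<beta> * ?n ^ t"
      proof -
        have "real (card S.bad_arcs) * ?n ^ (t - 2) \<le> \<beta> * ?n\<^sup>2 * ?n ^ (t - 2)"
          using bad by (rule mult_right_mono) simp
        moreover have "?n ^ t = ?n\<^sup>2 * ?n ^ (t - 2)"
          using t by (metis le_add_diff_inverse power_add)
        then have "\<beta> * ?n\<^sup>2 * ?n ^ (t - 2) = \<beta> * ?n ^ t" by (simp only: mult.assoc)
        ultimately show ?thesis using S.bad_weight by linarith
      qed
      ultimately show "(\<Sum>K\<in>S.Q. b (card K) * f K) - \<beta> * ?n ^ t \<le> (\<Sum>K\<in>S.Q. b (card K) * S.spread K)"
        unfolding S.spread_value by linarith
    next
      fix T T' assume T: "T \<in> cliques_of_size t G" "T' \<in> cliques_of_size t G" "T \<noteq> T'"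
      let ?A = "{K \<in> S.Q. T \<subseteq> K \<and> T' \<subseteq> K}"
      have TV: "T \<subseteq> V" "T' \<subseteq> V" "card T = t" "card T' = t" "finite T" "finite T'"
        using T finite_V finite_subset by (auto simp: cliques_of_size_def cliques_def)
      have "\<not> T' \<subseteq> T" using TV T(3) card_subset_eq[of T T'] by auto
      then obtain x where x: "x \<in> T'" "x \<notin> T" by auto
      \<comment> \<open>Every clique containing \<open>T\<close> and \<open>T'\<close> contains
        these \<open>t + 1\<close> vertices. For size \<open>m\<close> there are at most
        \<open>?n ^ (m - t - 1)\<close> such cliques of weight at most
        \<open>M / ?n ^ (m - t)\<close>, so each size contributes at most
        \<open>M / ?n\<close>.\<close>
      let ?U = "insert x T"
      have cU: "card ?U = t + 1" "?U \<subseteq> V" using x TV by auto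
      have sub: "?A \<subseteq> (\<Union>m\<in>{t + 1..s}. {K. ?U \<subseteq> K \<and> K \<subseteq> V \<and> card K = m})"
        using x by (auto simp: S.Q_def cliques_def)
      have finS: "finite {K. ?U \<subseteq> K \<and> K \<subseteq> V \<and> card K = m}" for m
        by (rule finite_subset[of _ "Pow V"]) (use finite_V in auto)
      have spread_le: "S.spread K \<le> M / ?n ^ (card K - t)" if "K \<in> S.Q" for K
      proof -
        have "V \<noteq> {}" using nn(3) by auto
        from S.spread_bound[OF that this] have "S.spread K * ?n ^ (card K - t) \<le> M" by (simp only: M_eq)
        then show ?thesis using nn(3) by (simp add: pos_le_divide_eq)
      qed
      have "(\<Sum>K\<in>?A. S.spread K) \<le> (\<Sum>K\<in>?A. M / ?n ^ (card K - t))"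
        by (rule sum_mono) (use spread_le in auto)
      also have "\<dots> \<le> (\<Sum>K\<in>(\<Union>m\<in>{t + 1..s}. {K. ?U \<subseteq> K \<and> K \<subseteq> V \<and> card K = m}). M / ?n ^ (card K - t))"
        using sub finS M by (intro sum_mono2) auto
      also have "\<dots> = (\<Sum>m\<in>{t + 1..s}. \<Sum>K\<in>{K. ?U \<subseteq> K \<and> K \<subseteq> V \<and> card K = m}. M / ?n ^ (card K - t))"
        by (rule sum.UNION_disjoint) (use finS in auto)
      also have "\<dots> \<le> (\<Sum>m\<in>{t + 1..s}. M / ?n)"
      proof (rule sum_mono)
        fix m assume m: "m \<in> {t + 1..s}"
        have "(\<Sum>K\<in>{K. ?U \<subseteq> K \<and> K \<subseteq> V \<and> card K = m}. M / ?n ^ (card K - t))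
            = (\<Sum>K\<in>{K. ?U \<subseteq> K \<and> K \<subseteq> V \<and> card K = m}. M / ?n ^ (m - t))"
          by (rule sum.cong) auto
        also have "\<dots> = real (card {K. ?U \<subseteq> K \<and> K \<subseteq> V \<and> card K = m}) * (M / ?n ^ (m - t))"
          by (rule sum_constant)
        also have "\<dots> \<le> real (card V ^ (m - card ?U)) * (M / ?n ^ (m - t))"
          using card_supersets_le[OF finite_V cU(2), of m] m cU(1) M
          by (intro mult_right_mono) (auto simp del: of_nat_power)
        also have "\<dots> = M / ?n"
        proof -
          have "m - t = Suc (m - card ?U)" using m cU(1) by auto
          then show ?thesis using nn(3) by simp
        qed
        finally show "(\<Sum>K\<in>{K. ?U \<subseteq> K \<and> K \<subseteq> V \<and> card K = m}. M / ?n ^ (card K - t)) \<le> M / ?n" .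
      qed
      also have "\<dots> = real (s - t) * (M / ?n)" by simp
      also have "\<dots> \<le> real s * (M / ?n)" using M nn(3) by (intro mult_right_mono) auto
      also have "\<dots> \<le> \<delta>" using nn(2,3) \<delta> by (simp add: field_simps)
      finally show "(\<Sum>K\<in>?A. S.spread K) \<le> \<delta>" .
    qed
  qed
qed

lemma clique_t_subsets:
  assumes "K \<in> cliques G" and "1 \<le> t"
  shows "{T \<in> cliques_of_size t G. T \<subseteq> K} = {T. T \<subseteq> K \<and> card T = t}"
proof -
  have "T \<in> cliques G" if "T \<subseteq> K" "card T = t" for T
  proof -
    have "T \<noteq> {}" using that(2) assms(2) by auto
    then show ?thesis by (rule subclique[OF assms(1) that(1)])
  qed
  then show ?thesis by (auto simp: cliques_of_size_def)
qed

lemma card_clique_t_subsets: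
  assumes "pair_graph G" "K \<in> cliques G" "1 \<le> t"
  shows "card {T \<in> cliques_of_size t G. T \<subseteq> K} = card K choose t"
  using clique_t_subsets[OF assms(2,3)] n_subsets[OF finite_clique(1)[OF assms(1,2)]] by simp

text \<open>Lets a clique be recovered from the set of its \<open>t\<close>-subsets, so that passing
  to hyperedges is injective.\<close>

lemma Union_t_subsets:
  assumes "finite K" "1 \<le> t" "t \<le> card K"
  shows "\<Union>{T. T \<subseteq> K \<and> card T = t} = K"
proof
  show "K \<subseteq> \<Union>{T. T \<subseteq> K \<and> card T = t}"
  proof
    fix x assume x: "x \<in> K"
    then obtain T where "{x} \<subseteq> T" "T \<subseteq> K" "card T = t"
      using exists_subset_between[of "{x}" t K] assms by auto
    then show "x \<in> \<Union>{T. T \<subseteq> K \<and> card T = t}" by auto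
  qed
qed auto

lemma integral_packing:
  fixes \<epsilon> :: real
  assumes t: "2 \<le> t" "t < s" and \<epsilon>: "0 < \<epsilon>"
  shows "\<exists>n0. \<forall>(G :: 'a pair_pre_digraph) f b. pair_graph G \<longrightarrow> n0 < card (pverts G) \<longrightarrow> fractional_packing t s G f \<longrightarrow>
    (\<forall>k. 0 \<le> b k \<and> b k \<le> 1) \<longrightarrow>
    (\<exists>M \<subseteq> mid_cliques t s G. (\<forall>T\<in>cliques_of_size t G. card {K \<in> M. T \<subseteq> K} \<le> 1) \<and>
      (\<Sum>K\<in>mid_cliques t s G. b (card K) * f K) - \<epsilon> * real (card (pverts G)) ^ t \<le> (\<Sum>K\<in>M. b (card K)))"
proof -
  \<comment> \<open>One third each for the value lost in spreading, the excess load that is trimmed,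
    and the deficit of the nibble.\<close>
  have \<epsilon>3: "0 < \<epsilon> / 3" using \<epsilon> by simp
  from nearly_perfect_matching[OF \<epsilon>3, where 'x = "'a set" and r = "2 ^ s"]
  obtain \<delta> where \<delta>: "0 < \<delta>" and nibble: "\<forall>(X :: 'a set set) E w b. weighted_hypergraph X E w (2 ^ s) \<delta> \<longrightarrow>
     (\<forall>e\<in>E. 0 \<le> b e \<and> b e \<le> 1) \<longrightarrow>
     (\<exists>M\<subseteq>E. pairwise disjnt M \<and> (\<Sum>e\<in>E. b e * w e) - \<epsilon> / 3 * real (card X) \<le> (\<Sum>e\<in>M. b e))"
    by (elim exE conjE)
  from spread_packing[OF t \<epsilon>3 \<delta>, where 'a = 'a] obtain n0 where spread:
    "\<forall>(G :: 'a pair_pre_digraph) f. pair_graph G \<longrightarrow> n0 < card (pverts G) \<longrightarrow> fractional_packing t s G f \<longrightarrow>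
    (\<exists>w. (\<forall>K. 0 \<le> w K) \<and>
      (\<Sum>T\<in>cliques_of_size t G. max 0 ((\<Sum>K\<in>{K \<in> mid_cliques t s G. T \<subseteq> K}. w K) - 1)) \<le> \<epsilon> / 3 * real (card (pverts G)) ^ t \<and>
      (\<forall>T\<in>cliques_of_size t G. \<forall>T'\<in>cliques_of_size t G. T \<noteq> T' \<longrightarrow>
        (\<Sum>K\<in>{K \<in> mid_cliques t s G. T \<subseteq> K \<and> T' \<subseteq> K}. w K) \<le> \<delta>) \<and>
      (\<forall>b. (\<forall>k. 0 \<le> b k \<and> b k \<le> 1) \<longrightarrow>
        (\<Sum>K\<in>mid_cliques t s G. b (card K) * f K) - \<epsilon> / 3 * real (card (pverts G)) ^ t
          \<le> (\<Sum>K\<in>mid_cliques t s G. b (card K) * w K)))"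
    by (elim exE)
  show ?thesis
  proof (intro exI[of _ n0] allI impI)
    fix G :: "'a pair_pre_digraph" and f and b :: "nat \<Rightarrow> real"
    assume G: "pair_graph G" and n: "n0 < card (pverts G)" and f: "fractional_packing t s G f"
      and b: "\<forall>k. 0 \<le> b k \<and> b k \<le> 1"
    let ?n = "real (card (pverts G))" and ?Q = "mid_cliques t s G" and ?X = "cliques_of_size t G"
    from spread[rule_format, OF G n f] obtain w where w: "\<forall>K. 0 \<le> w K"
      and excess: "(\<Sum>T\<in>?X. max 0 ((\<Sum>K\<in>{K \<in> ?Q. T \<subseteq> K}. w K) - 1)) \<le> \<epsilon> / 3 * ?n ^ t"
      and codeg: "\<forall>T\<in>?X. \<forall>T'\<in>?X. T \<noteq> T' \<longrightarrow> (\<Sum>K\<in>{K \<in> ?Q. T \<subseteq> K \<and> T' \<subseteq> K}. w K) \<le> \<delta>"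
      and val: "\<forall>b. (\<forall>k. 0 \<le> b k \<and> b k \<le> 1) \<longrightarrow> (\<Sum>K\<in>?Q. b (card K) * f K) - \<epsilon> / 3 * ?n ^ t \<le> (\<Sum>K\<in>?Q. b (card K) * w K)"
      by (elim exE conjE)
    \<comment> \<open>Vertices of the hypergraph are \<open>t\<close>-cliques and \<open>e K\<close>
      is the hyperedge of \<open>K\<close>, so a matching is a packing. Its size
      \<open>card K choose t\<close> lies between \<open>t + 1\<close> and
      \<open>2 ^ s\<close>.\<close>
    define e where "e K = {T \<in> ?X. T \<subseteq> K}" for K
    have t1: "1 \<le> t" using t by simp
    have QK: "K \<in> cliques G" "finite K" "t < card K" "card K \<le> s" if "K \<in> ?Q" for K
      using that finite_clique(1)[OF G] by (auto simp: mid_cliques_def)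
    have Ue: "\<Union>(e K) = K" if "K \<in> ?Q" for K
      using Union_t_subsets[of K t] clique_t_subsets[of K G t] QK[OF that] t1 by (simp add: e_def)
    have inj: "inj_on e ?Q" by (rule inj_on_inverseI[of _ Union]) (rule Ue)
    have finX: "finite ?X" and finQ: "finite ?Q"
      using finite_cliques[OF G] by (auto simp: cliques_of_size_def mid_cliques_def)
    have card_e: "2 \<le> card (e K) \<and> card (e K) \<le> 2 ^ s" if K: "K \<in> ?Q" for K
    proof -
      have "card (e K) = card K choose t"
        unfolding e_def by (rule card_clique_t_subsets[OF G QK(1)[OF K] t1])
      moreover have "card K choose t \<le> 2 ^ s"
        using binomial_le_pow2[of "card K" t] power_increasing[OF QK(4)[OF K], of "2::nat"] by linarith
      moreover have "t + 1 \<le> card K choose t"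
      proof -
        have "Suc t choose t \<le> card K choose t"
          using QK(3)[OF K] by (intro binomial_right_mono) auto
        then show ?thesis by simp
      qed
      ultimately show ?thesis using t by linarith
    qed
    let ?E = "e ` ?Q"
    have EX: "?E \<subseteq> Pow ?X" by (auto simp: e_def)
    define w1 where "w1 g = w (\<Union>g)" for g
    define b1 where "b1 g = b (card (\<Union>g))" for g :: "'a set set"
    have reindex: "(\<Sum>g\<in>{g \<in> ?E. P g}. h g) = (\<Sum>K\<in>{K \<in> ?Q. P (e K)}. h (e K))" for P and h :: "_ \<Rightarrow> real"
    proof -
      have "{g \<in> ?E. P g} = e ` {K \<in> ?Q. P (e K)}" by auto
      moreover have "inj_on e {K \<in> ?Q. P (e K)}" by (rule inj_on_subset[OF inj]) auto
      ultimately show ?thesis by (simp add: sum.reindex)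
    qed
    have load1: "(\<Sum>g\<in>{g \<in> ?E. T \<in> g}. w1 g) = (\<Sum>K\<in>{K \<in> ?Q. T \<subseteq> K}. w K)" if T: "T \<in> ?X" for T
      unfolding reindex using T Ue by (intro sum.cong) (auto simp: e_def w1_def)
    have val1: "(\<Sum>g\<in>?E. b1 g * w1 g) = (\<Sum>K\<in>?Q. b (card K) * w K)"
      using inj Ue by (simp add: sum.reindex b1_def w1_def)
    have "\<forall>g\<in>?E. 0 \<le> w1 g" "\<forall>g\<in>?E. 0 \<le> b1 g \<and> b1 g \<le> 1" using w b by (auto simp: w1_def b1_def)
    \<comment> \<open>Spread weights may still overload some \<open>t\<close>-cliques. Trimming
      restores the load bound and only lowers codegrees.\<close>
    from exists_trimmed_weight[OF finX EX this] obtain w2 where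
      w2: "\<forall>g\<in>?E. 0 \<le> w2 g \<and> w2 g \<le> w1 g" "\<forall>x\<in>?X. (\<Sum>g\<in>{g \<in> ?E. x \<in> g}. w2 g) \<le> 1"
        "(\<Sum>g\<in>?E. b1 g * w1 g) - (\<Sum>x\<in>?X. max 0 ((\<Sum>g\<in>{g \<in> ?E. x \<in> g}. w1 g) - 1)) \<le> (\<Sum>g\<in>?E. b1 g * w2 g)"
      by (elim exE conjE)
    have hyp: "weighted_hypergraph ?X ?E w2 (2 ^ s) \<delta>"
    proof
      show "g \<subseteq> ?X \<and> 2 \<le> card g \<and> card g \<le> 2 ^ s" if "g \<in> ?E" for g
        using that card_e EX by auto
      show "(\<Sum>g\<in>{g \<in> ?E. x \<in> g \<and> y \<in> g}. w2 g) \<le> \<delta>" if xy: "x \<in> ?X" "y \<in> ?X" "x \<noteq> y" for x y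
      proof -
        have "(\<Sum>g\<in>{g \<in> ?E. x \<in> g \<and> y \<in> g}. w2 g) \<le> (\<Sum>g\<in>{g \<in> ?E. x \<in> g \<and> y \<in> g}. w1 g)"
          by (rule sum_mono) (use w2(1) in auto)
        also have "\<dots> = (\<Sum>K\<in>{K \<in> ?Q. x \<subseteq> K \<and> y \<subseteq> K}. w K)"
          unfolding reindex using xy Ue by (intro sum.cong) (auto simp: e_def w1_def)
        also have "\<dots> \<le> \<delta>" using codeg xy by blast
        finally show ?thesis .
      qed
    qed (use finX w2 \<delta> in auto)
    have "\<forall>g\<in>?E. 0 \<le> b1 g \<and> b1 g \<le> 1" using b by (simp add: b1_def)
    with hyp have "\<exists>M1\<subseteq>?E. pairwise disjnt M1 \<and> (\<Sum>g\<in>?E. b1 g * w2 g) - \<epsilon> / 3 * real (card ?X) \<le> (\<Sum>g\<in>M1. b1 g)"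
      by (rule nibble[THEN spec, THEN spec, THEN spec, THEN spec, THEN mp, THEN mp])
    then obtain M1 where M1: "M1 \<subseteq> ?E" "pairwise disjnt M1"
      "(\<Sum>g\<in>?E. b1 g * w2 g) - \<epsilon> / 3 * real (card ?X) \<le> (\<Sum>g\<in>M1. b1 g)"
      by (elim exE conjE)
    define M where "M = {K \<in> ?Q. e K \<in> M1}"
    have M1M: "M1 = e ` M" using M1(1) by (auto simp: M_def)
    have injM: "inj_on e M" by (rule inj_on_subset[OF inj]) (auto simp: M_def)
    show "\<exists>M \<subseteq> ?Q. (\<forall>T\<in>?X. card {K \<in> M. T \<subseteq> K} \<le> 1) \<and>
      (\<Sum>K\<in>?Q. b (card K) * f K) - \<epsilon> * ?n ^ t \<le> (\<Sum>K\<in>M. b (card K))"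
    proof (intro exI[of _ M] conjI ballI)
      show "M \<subseteq> ?Q" by (auto simp: M_def)
      fix T assume T: "T \<in> ?X"
      have "K = K'" if "K \<in> M" "K' \<in> M" "T \<subseteq> K" "T \<subseteq> K'" for K K'
      proof (rule ccontr)
        assume "K \<noteq> K'"
        then have "e K \<noteq> e K'" using injM that by (auto simp: inj_on_def)
        then have "disjnt (e K) (e K')" using pairwiseD[OF M1(2)] that by (auto simp: M_def)
        moreover have "T \<in> e K" "T \<in> e K'" using T that by (auto simp: e_def)
        ultimately show False by (auto simp: disjnt_def)
      qed
      moreover have "finite {K \<in> M. T \<subseteq> K}" using finQ by (simp add: M_def)
      ultimately show "card {K \<in> M. T \<subseteq> K} \<le> 1" by (auto simp: card_le_Suc0_iff_eq)
    next
      have "(\<Sum>g\<in>M1. b1 g) = (\<Sum>K\<in>M. b (card K))"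
        unfolding M1M using injM Ue by (simp add: sum.reindex b1_def M_def)
      moreover have "\<epsilon> / 3 * real (card ?X) \<le> \<epsilon> / 3 * ?n ^ t"
      proof -
        have "real (card ?X) \<le> real (card (pverts G) ^ t)"
          by (simp only: of_nat_le_iff card_cliques_of_size_le[OF G])
        then show ?thesis using \<epsilon> by (intro mult_left_mono) auto
      qed
      moreover have "(\<Sum>x\<in>?X. max 0 ((\<Sum>g\<in>{g \<in> ?E. x \<in> g}. w1 g) - 1)) \<le> \<epsilon> / 3 * ?n ^ t"
        using excess load1 by simp
      moreover have "(\<Sum>K\<in>?Q. b (card K) * f K) - \<epsilon> / 3 * ?n ^ t \<le> (\<Sum>K\<in>?Q. b (card K) * w K)"
        using val b by blast
      ultimately show "(\<Sum>K\<in>?Q. b (card K) * f K) - \<epsilon> * ?n ^ t \<le> (\<Sum>K\<in>M. b (card K))"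
        using M1(3) w2(3) val1 by linarith
    qed
  qed
qed

section \<open>Costs, savings and truncation to cliques of bounded size\<close>

definition gain :: "nat \<Rightarrow> (nat \<Rightarrow> real) \<Rightarrow> nat \<Rightarrow> real" where
  "gain t c k = real (k choose t) * c t - c k"

lemma cost_le_linear:
  fixes c :: "nat \<Rightarrow> real"
  assumes "\<forall>i\<ge>t. c (i + 1) - c i \<le> c t" and "t \<le> i"
  shows "c i \<le> real (i - t + 1) * c t"
  using assms(2)
proof (induction i rule: dec_induct)
  case (step i)
  then have "c (Suc i) \<le> c i + c t" using assms(1)[rule_format, of i] by simp
  with step show ?case by (simp add: Suc_diff_le algebra_simps)
qed simp

text \<open>As \<open>t \<ge> 2\<close>, the number \<open>s choose t = s choose (s - t)\<close> is
  at least \<open>(s - t + 2) choose (s - t)\<close>, the number of pairs in a set of size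
  \<open>s - t + 2\<close>.\<close>

lemma choose_quadratic:
  assumes t: "2 \<le> t" "t \<le> s"
  shows "real (s - t + 1) * real (s - t + 2) \<le> 2 * real (s choose t)"
proof -
  let ?m = "s - t + 2"
  have "?m choose (s - t) \<le> s choose (s - t)"
    using t by (intro binomial_right_mono) auto
  moreover have "?m choose (s - t) = ?m choose 2"
    using binomial_symmetric[of "s - t" ?m] by simp
  moreover have "s choose (s - t) = s choose t"
    using binomial_symmetric[of t s] t by simp
  moreover have "2 * (?m choose 2) = ?m * (?m - 1)"
    unfolding choose_two by (rule dvd_mult_div_cancel) simp
  ultimately have "(s - t + 1) * ?m \<le> 2 * (s choose t)" by (simp add: mult.commute)
  then have "real ((s - t + 1) * ?m) \<le> real (2 * (s choose t))" by (simp only: of_nat_le_iff)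
  then show ?thesis by (simp only: of_nat_mult of_nat_numeral)
qed

lemma card_between:
  assumes K: "finite K" and U: "U \<subseteq> K" "card U \<le> s"
  shows "card {L. U \<subseteq> L \<and> L \<subseteq> K \<and> card L = s} = (card K - card U) choose (s - card U)"
proof -
  have finU: "finite U" using K U finite_subset by auto
  have "bij_betw (\<lambda>B. B \<union> U) {B. B \<subseteq> K - U \<and> card B = s - card U} {L. U \<subseteq> L \<and> L \<subseteq> K \<and> card L = s}"
  proof (rule bij_betwI[where g = "\<lambda>L. L - U"])
    show "(\<lambda>B. B \<union> U) \<in> {B. B \<subseteq> K - U \<and> card B = s - card U} \<rightarrow> {L. U \<subseteq> L \<and> L \<subseteq> K \<and> card L = s}"
    proof
      fix B assume B: "B \<in> {B. B \<subseteq> K - U \<and> card B = s - card U}"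
      then have "finite B" using K finite_subset[of B K] by auto
      then have "card (B \<union> U) = card B + card U"
        using B finU by (intro card_Un_disjoint) auto
      then show "B \<union> U \<in> {L. U \<subseteq> L \<and> L \<subseteq> K \<and> card L = s}" using B U by auto
    qed
    show "(\<lambda>L. L - U) \<in> {L. U \<subseteq> L \<and> L \<subseteq> K \<and> card L = s} \<rightarrow> {B. B \<subseteq> K - U \<and> card B = s - card U}"
      using finU by (auto simp: card_Diff_subset)
  qed auto
  then have "card {L. U \<subseteq> L \<and> L \<subseteq> K \<and> card L = s} = card {B. B \<subseteq> K - U \<and> card B = s - card U}"
    by (rule bij_betw_same_card[symmetric])
  also have "\<dots> = card (K - U) choose (s - card U)" using K by (intro n_subsets) auto
  finally show ?thesis using U finU by (simp add: card_Diff_subset)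
qed

text \<open>Double counting, as every \<open>t\<close>-clique is covered with total weight 1. It
  makes cost and total saving add up to a constant.\<close>

lemma count_t_cliques:
  assumes G: "pair_graph G" and f: "fractional_clique_decomposition t G f" and t: "1 \<le> t"
  shows "(\<Sum>K\<in>cliques G. real (card K choose t) * f K) = real (card (cliques_of_size t G))"
proof -
  have fin: "finite (cliques G)" "finite (cliques_of_size t G)"
    using finite_cliques[OF G] by (auto simp: cliques_of_size_def)
  have "(\<Sum>K\<in>cliques G. real (card K choose t) * f K) = (\<Sum>K\<in>cliques G. \<Sum>T\<in>{T \<in> cliques_of_size t G. T \<subseteq> K}. f K)"
    using card_clique_t_subsets[OF G _ t] by (intro sum.cong) auto
  also have "\<dots> = (\<Sum>T\<in>cliques_of_size t G. \<Sum>K\<in>{K \<in> cliques G. T \<subseteq> K}. f K)"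
    by (rule sum.swap_restrict[OF fin])
  also have "\<dots> = (\<Sum>T\<in>cliques_of_size t G. 1)"
    using f by (intro sum.cong) (auto simp: fractional_clique_decomposition_def covers_cliques_once_def)
  finally show ?thesis by simp
qed

text \<open>A clique with more than \<open>s\<close> vertices is replaced by a uniform weighting of its \<open>s\<close>-subsets. As costs grow at most
  linearly while the number of \<open>t\<close>-subsets grows at least quadratically, this is cheap for large \<open>s\<close>.\<close>

lemma truncate_to_mid_cliques:
  assumes G: "pair_graph G" and f: "fractional_clique_decomposition t G f" and t: "2 \<le> t" "t < s"
    and c: "\<forall>i\<ge>t. c (i + 1) - c i \<le> c t" "0 \<le> c t" "\<And>i. t \<le> i \<Longrightarrow> 0 \<le> c i"
  shows "\<exists>f'. fractional_packing t s G f' \<and>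
    (\<Sum>K\<in>{K \<in> cliques G. t < card K}. gain t c (card K) * f K) - 2 * c t / real (s - t + 2) * real (card (cliques_of_size t G))
      \<le> (\<Sum>K\<in>mid_cliques t s G. gain t c (card K) * f' K)"
proof -
  let ?Q = "mid_cliques t s G" and ?\<tau> = "2 * c t / real (s - t + 2)"
  define Big where "Big = {K \<in> cliques G. s < card K}"
  \<comment> \<open>A \<open>t\<close>-subset of \<open>K\<close> lies in
    \<open>(card K - t) choose (s - t)\<close> of its \<open>s\<close>-subsets, so with this
    normalisation the load coming from \<open>K\<close> is unchanged.\<close>
  define \<beta> where "\<beta> K = f K / real ((card K - t) choose (s - t))" for K :: "'a set"
  define f' where "f' L = f L + (if card L = s then \<Sum>K\<in>{K \<in> Big. L \<subseteq> K}. \<beta> K else 0)" for L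
  have f0: "0 \<le> f K" if "K \<in> cliques G" for K
    using f that by (simp add: fractional_clique_decomposition_def)
  have fin: "finite (cliques G)" by (rule finite_cliques[OF G])
  have finQ: "finite ?Q" and finB: "finite Big" using fin by (auto simp: mid_cliques_def Big_def)
  have \<beta>0: "0 \<le> \<beta> K" if "K \<in> Big" for K
    using f0[of K] that by (simp add: \<beta>_def Big_def)
  have sub: "L \<in> cliques G" if "K \<in> cliques G" "L \<subseteq> K" "card L = s" for K L
    using that t clique_t_subsets[of K G s] by (auto simp: cliques_of_size_def)
  \<comment> \<open>Applied with \<open>U\<close> a \<open>t\<close>-clique for the loads and with
    \<open>U\<close> empty for the value.\<close>
  have redistribute: "(\<Sum>L\<in>{L \<in> ?Q. U \<subseteq> L \<and> card L = s}. \<Sum>K\<in>{K \<in> Big. L \<subseteq> K}. \<beta> K)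
      = (\<Sum>K\<in>{K \<in> Big. U \<subseteq> K}. real ((card K - card U) choose (s - card U)) * \<beta> K)" if U: "card U \<le> s" for U
  proof -
    let ?S = "{L \<in> ?Q. U \<subseteq> L \<and> card L = s}"
    have "(\<Sum>L\<in>?S. \<Sum>K\<in>{K \<in> Big. L \<subseteq> K}. \<beta> K) = (\<Sum>K\<in>Big. \<Sum>L\<in>{L \<in> ?S. L \<subseteq> K}. \<beta> K)"
      by (rule sum.swap_restrict) (use finQ finB in auto)
    also have "\<dots> = (\<Sum>K\<in>{K \<in> Big. U \<subseteq> K}. real ((card K - card U) choose (s - card U)) * \<beta> K)"
    proof (rule sum.mono_neutral_cong_right[OF finB])
      show "\<forall>K\<in>Big - {K \<in> Big. U \<subseteq> K}. (\<Sum>L\<in>{L \<in> ?S. L \<subseteq> K}. \<beta> K) = 0"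
      proof
        fix K assume "K \<in> Big - {K \<in> Big. U \<subseteq> K}"
        then have empty: "{L \<in> ?S. L \<subseteq> K} = {}" by auto
        show "(\<Sum>L\<in>{L \<in> ?S. L \<subseteq> K}. \<beta> K) = 0" unfolding empty by simp
      qed
      fix K assume K: "K \<in> {K \<in> Big. U \<subseteq> K}"
      then have KG: "K \<in> cliques G" "U \<subseteq> K" by (auto simp: Big_def)
      have "{L \<in> ?S. L \<subseteq> K} = {L. U \<subseteq> L \<and> L \<subseteq> K \<and> card L = s}"
        using sub[OF KG(1)] t by (auto simp: mid_cliques_def)
      then show "(\<Sum>L\<in>{L \<in> ?S. L \<subseteq> K}. \<beta> K) = real ((card K - card U) choose (s - card U)) * \<beta> K"
        using card_between[OF finite_clique(1)[OF G KG(1)] KG(2) U] by simp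
    qed auto
    finally show ?thesis .
  qed
  have extra: "(\<Sum>L\<in>{L \<in> ?Q. P L}. h L * f' L) = (\<Sum>L\<in>{L \<in> ?Q. P L}. h L * f L)
      + (\<Sum>L\<in>{L \<in> ?Q. P L \<and> card L = s}. h L * (\<Sum>K\<in>{K \<in> Big. L \<subseteq> K}. \<beta> K))" for P and h :: "'a set \<Rightarrow> real"
  proof -
    have "(\<Sum>L\<in>{L \<in> ?Q. P L}. h L * f' L) = (\<Sum>L\<in>{L \<in> ?Q. P L}. h L * f L)
      + (\<Sum>L\<in>{L \<in> ?Q. P L}. if card L = s then h L * (\<Sum>K\<in>{K \<in> Big. L \<subseteq> K}. \<beta> K) else 0)"
      unfolding f'_def sum.distrib[symmetric] by (intro sum.cong refl) (simp add: distrib_left)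
    also have "(\<Sum>L\<in>{L \<in> ?Q. P L}. if card L = s then h L * (\<Sum>K\<in>{K \<in> Big. L \<subseteq> K}. \<beta> K) else 0)
      = (\<Sum>L\<in>{L \<in> ?Q. P L \<and> card L = s}. h L * (\<Sum>K\<in>{K \<in> Big. L \<subseteq> K}. \<beta> K))"
      using finQ by (intro sum.mono_neutral_cong_right) auto
    finally show ?thesis .
  qed
  have pack: "fractional_packing t s G f'"
    unfolding fractional_packing_def
  proof (intro conjI ballI)
    show "0 \<le> f' K" if "K \<in> cliques G" for K
      unfolding f'_def using f0[OF that] \<beta>0 by (auto intro!: add_nonneg_nonneg sum_nonneg)
    fix T assume T: "T \<in> cliques_of_size t G"
    then have cT: "card T = t" by (simp add: cliques_of_size_def)
    have "(\<Sum>L\<in>{L \<in> ?Q. T \<subseteq> L}. f' L) = (\<Sum>L\<in>{L \<in> ?Q. T \<subseteq> L}. f L)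
        + (\<Sum>K\<in>{K \<in> Big. T \<subseteq> K}. real ((card K - card T) choose (s - card T)) * \<beta> K)"
      using extra[where P = "\<lambda>L. T \<subseteq> L" and h = "\<lambda>_. 1"] redistribute[of T] cT t by simp
    also have "(\<Sum>K\<in>{K \<in> Big. T \<subseteq> K}. real ((card K - card T) choose (s - card T)) * \<beta> K) = (\<Sum>K\<in>{K \<in> Big. T \<subseteq> K}. f K)"
      by (intro sum.cong refl) (auto simp: \<beta>_def cT Big_def)
    also have "(\<Sum>L\<in>{L \<in> ?Q. T \<subseteq> L}. f L) + \<dots> = (\<Sum>K\<in>{L \<in> ?Q. T \<subseteq> L} \<union> {K \<in> Big. T \<subseteq> K}. f K)"
      using fin by (intro sum.union_disjoint[symmetric]) (auto simp: mid_cliques_def Big_def)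
    also have "\<dots> \<le> (\<Sum>K\<in>{K \<in> cliques G. T \<subseteq> K}. f K)"
      using fin f0 by (intro sum_mono2) (auto simp: mid_cliques_def Big_def)
    also have "\<dots> = 1"
      using f T by (simp add: fractional_clique_decomposition_def covers_cliques_once_def)
    finally show "(\<Sum>L\<in>{L \<in> ?Q. T \<subseteq> L}. f' L) \<le> 1" .
  qed
  \<comment> \<open>The linear bound on costs against the quadratic bound on
    \<open>s choose t\<close>: an \<open>s\<close>-clique costs at most \<open>?\<tau>\<close> per
    \<open>t\<close>-subset.\<close>
  have cs: "c s \<le> ?\<tau> * real (s choose t)"
  proof -
    have "c s \<le> real (s - t + 1) * c t" using cost_le_linear[OF c(1)] t by simp
    then have "c s * real (s - t + 2) \<le> (real (s - t + 1) * real (s - t + 2)) * c t"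
      using mult_right_mono[of _ _ "real (s - t + 2)"] by (simp add: mult_ac)
    also have "\<dots> \<le> (2 * real (s choose t)) * c t"
      using choose_quadratic[of t s] t c(2) by (intro mult_right_mono) auto
    finally show ?thesis by (simp add: field_simps)
  qed
  have big: "(gain t c (card K) - ?\<tau> * real (card K choose t)) * f K \<le> gain t c s * (real (card K choose s) * \<beta> K)"
    if K: "K \<in> Big" for K
  proof -
    let ?k = "card K"
    have k: "t \<le> s" "s \<le> ?k" using K t by (auto simp: Big_def)
    have pos: "0 < real ((?k - t) choose (s - t))" "0 < real (s choose t)" using k by auto
    \<comment> \<open>Chains of a \<open>t\<close>-set inside an \<open>s\<close>-set inside
      \<open>K\<close>, counted in two ways.\<close>
    have "real ((?k choose s) * (s choose t)) = real ((?k choose t) * ((?k - t) choose (s - t)))"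
      using choose_mult[OF k] by simp
    then have scale: "real (?k choose s) * \<beta> K = real (?k choose t) * f K / real (s choose t)"
      using pos by (simp add: \<beta>_def field_simps)
    have "gain t c s * (real (?k choose s) * \<beta> K) = (c t - c s / real (s choose t)) * (real (?k choose t) * f K)"
      unfolding scale gain_def using pos by (simp add: field_simps)
    also have "\<dots> \<ge> (c t - ?\<tau>) * (real (?k choose t) * f K)"
      using cs pos f0[of K] K by (intro mult_right_mono) (auto simp: Big_def pos_divide_le_eq)
    finally have "(c t - ?\<tau>) * (real (?k choose t) * f K) \<le> gain t c s * (real (?k choose s) * \<beta> K)" .
    moreover have "(gain t c ?k - ?\<tau> * real (?k choose t)) * f K \<le> ((c t - ?\<tau>) * real (?k choose t)) * f K"
      using f0[of K] K c(3)[of ?k] k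
      by (intro mult_right_mono) (auto simp: gain_def Big_def algebra_simps)
    ultimately show ?thesis by (simp add: mult.assoc)
  qed
  have "(\<Sum>K\<in>{K \<in> cliques G. t < card K}. gain t c (card K) * f K)
      = (\<Sum>K\<in>?Q. gain t c (card K) * f K) + (\<Sum>K\<in>Big. gain t c (card K) * f K)"
  proof -
    have un: "{K \<in> cliques G. t < card K} = ?Q \<union> Big" and "?Q \<inter> Big = {}"
      using t by (auto simp: mid_cliques_def Big_def)
    then show ?thesis unfolding un using finQ finB by (intro sum.union_disjoint)
  qed
  moreover have "(\<Sum>K\<in>?Q. gain t c (card K) * f' K)
      = (\<Sum>K\<in>?Q. gain t c (card K) * f K) + gain t c s * (\<Sum>K\<in>Big. real (card K choose s) * \<beta> K)"
  proof -
    have "(\<Sum>L\<in>{L \<in> ?Q. card L = s}. gain t c (card L) * (\<Sum>K\<in>{K \<in> Big. L \<subseteq> K}. \<beta> K))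
        = gain t c s * (\<Sum>L\<in>{L \<in> ?Q. card L = s}. \<Sum>K\<in>{K \<in> Big. L \<subseteq> K}. \<beta> K)"
      by (simp add: sum_distrib_left)
    then show ?thesis
      using extra[where P = "\<lambda>_. True" and h = "\<lambda>L. gain t c (card L)"] redistribute[of "{}"] by simp
  qed
  moreover have "gain t c s * (\<Sum>K\<in>Big. real (card K choose s) * \<beta> K)
      \<ge> (\<Sum>K\<in>Big. gain t c (card K) * f K) - ?\<tau> * (\<Sum>K\<in>Big. real (card K choose t) * f K)"
    using sum_mono[OF big] unfolding sum_distrib_left sum_subtractf[symmetric]
    by (simp add: left_diff_distrib mult.assoc)
  moreover have "?\<tau> * (\<Sum>K\<in>Big. real (card K choose t) * f K) \<le> ?\<tau> * real (card (cliques_of_size t G))"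
  proof (rule mult_left_mono)
    have "(\<Sum>K\<in>Big. real (card K choose t) * f K) \<le> (\<Sum>K\<in>cliques G. real (card K choose t) * f K)"
      using fin f0 by (intro sum_mono2) (auto simp: Big_def)
    then show "(\<Sum>K\<in>Big. real (card K choose t) * f K) \<le> real (card (cliques_of_size t G))"
      using count_t_cliques[OF G f] t by simp
  qed (use c(2) in simp)
  ultimately show ?thesis using pack by (intro exI[of _ f']) auto
qed

lemma clique_cost_ge_gain:
  assumes G: "pair_graph G" and f: "fractional_clique_decomposition t G f" and t: "1 \<le> t" and c: "\<And>i. 1 \<le> i \<Longrightarrow> 0 \<le> c i"
  shows "c t * real (card (cliques_of_size t G)) - (\<Sum>K\<in>{K \<in> cliques G. t < card K}. gain t c (card K) * f K) \<le> clique_cost G c f"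
proof -
  have fin: "finite (cliques G)" by (rule finite_cliques[OF G])
  have "c t * real (card (cliques_of_size t G)) - clique_cost G c f = (\<Sum>K\<in>cliques G. gain t c (card K) * f K)"
    unfolding count_t_cliques[OF G f t, symmetric] clique_cost_def sum_distrib_left sum_subtractf[symmetric]
    by (intro sum.cong refl) (simp add: gain_def algebra_simps)
  also have "\<dots> \<le> (\<Sum>K\<in>cliques G. if t < card K then gain t c (card K) * f K else 0)"
  proof (rule sum_mono)
    fix K assume K: "K \<in> cliques G"
    have "gain t c (card K) * f K \<le> 0" if "\<not> t < card K"
    proof (cases "card K = t")
      case True
      then show ?thesis by (simp add: gain_def)
    next
      case False
      then have "gain t c (card K) \<le> 0"
        using that c[OF finite_clique(2)[OF G K]] by (simp add: gain_def binomial_eq_0)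
      then show ?thesis using f K by (intro mult_nonpos_nonneg) (auto simp: fractional_clique_decomposition_def)
    qed
    then show "gain t c (card K) * f K \<le> (if t < card K then gain t c (card K) * f K else 0)" by simp
  qed
  also have "\<dots> = (\<Sum>K\<in>{K \<in> cliques G. t < card K}. gain t c (card K) * f K)"
    using fin by (simp add: sum.inter_filter)
  finally show ?thesis by simp
qed

text \<open>The \<open>t\<close>-cliques left uncovered are added as cliques of their own, so each
  member of \<open>M\<close> replaces exactly its own \<open>t\<close>-subsets.\<close>

lemma packing_to_decomposition:
  assumes G: "pair_graph G" and t: "1 \<le> t" and M: "M \<subseteq> mid_cliques t s G"
    and disj: "\<forall>T\<in>cliques_of_size t G. card {K \<in> M. T \<subseteq> K} \<le> 1"
  shows "dec t G c \<le> c t * real (card (cliques_of_size t G)) - (\<Sum>K\<in>M. gain t c (card K))"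
proof -
  let ?X = "cliques_of_size t G"
  have fin: "finite (cliques G)" by (rule finite_cliques[OF G])
  have finX: "finite ?X" using fin by (simp add: cliques_of_size_def)
  have MG: "M \<subseteq> cliques G" and Mt: "\<And>K. K \<in> M \<Longrightarrow> t < card K" using M by (auto simp: mid_cliques_def)
  have finM: "finite M" using MG fin finite_subset by auto
  define cov where "cov T = card {K \<in> M. T \<subseteq> K}" for T
  define U where "U = {T \<in> ?X. cov T = 0}"
  define g where "g K = (of_bool (K \<in> M) + of_bool (K \<in> U) :: real)" for K
  have UM: "U \<inter> M = {}" using Mt by (force simp: U_def cliques_of_size_def)
  have UG: "U \<subseteq> cliques G" by (auto simp: U_def cliques_of_size_def)
  have sum_g: "(\<Sum>K\<in>{K \<in> cliques G. P K}. h K * g K) = (\<Sum>K\<in>{K \<in> M. P K}. h K) + (\<Sum>K\<in>{K \<in> U. P K}. h K)" for P and h :: "'a set \<Rightarrow> real"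
  proof -
    have "(\<Sum>K\<in>{K \<in> cliques G. P K}. h K * g K)
        = (\<Sum>K\<in>{K \<in> cliques G. P K}. h K * of_bool (K \<in> M)) + (\<Sum>K\<in>{K \<in> cliques G. P K}. h K * of_bool (K \<in> U))"
      by (simp add: g_def distrib_left sum.distrib)
    also have "(\<Sum>K\<in>{K \<in> cliques G. P K}. h K * of_bool (K \<in> M)) = (\<Sum>K\<in>{K \<in> M. P K}. h K)"
      using fin MG by (intro sum.mono_neutral_cong_right) auto
    also have "(\<Sum>K\<in>{K \<in> cliques G. P K}. h K * of_bool (K \<in> U)) = (\<Sum>K\<in>{K \<in> U. P K}. h K)"
      using fin UG by (intro sum.mono_neutral_cong_right) auto
    finally show ?thesis .
  qed
  have "clique_decomposition t G g"
    unfolding clique_decomposition_def covers_cliques_once_def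
  proof (intro conjI ballI)
    show "g K \<in> {0, 1}" for K using UM by (auto simp: g_def)
    fix T assume T: "T \<in> ?X"
    have uniq: "T' = T" if "T' \<in> U" "T \<subseteq> T'" for T'
    proof -
      have "T' \<in> cliques G" "card T' = card T" using that T by (auto simp: U_def cliques_of_size_def)
      then show ?thesis using card_subset_eq[OF finite_clique(1)[OF G] that(2)] by auto
    qed
    have "{K \<in> U. T \<subseteq> K} = (if cov T = 0 then {T} else {})"
    proof (cases "cov T = 0")
      case True
      then have "T \<in> U" using T by (simp add: U_def)
      then show ?thesis using True uniq by auto
    next
      case False
      then have "T \<notin> U" by (simp add: U_def)
      then show ?thesis using False uniq by auto
    qed
    moreover have "cov T \<le> 1" using disj T by (simp add: cov_def)
    ultimately show "(\<Sum>K\<in>{K \<in> cliques G. T \<subseteq> K}. g K) = 1"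
      using sum_g[where P = "\<lambda>K. T \<subseteq> K" and h = "\<lambda>_. 1"] by (auto simp: le_Suc_eq cov_def[symmetric])
  qed
  then have "dec t G c \<le> clique_cost G c g" by (rule dec_is_min(2)[OF G])
  also have "clique_cost G c g = (\<Sum>K\<in>M. c (card K)) + c t * real (card U)"
    using sum_g[where P = "\<lambda>_. True" and h = "\<lambda>K. c (card K)"] by (simp add: clique_cost_def U_def cliques_of_size_def)
  also have "real (card U) = real (card ?X) - (\<Sum>K\<in>M. real (card K choose t))"
  proof -
    have "real (card U) = (\<Sum>T\<in>?X. of_bool (cov T = 0))"
      using finX by (simp add: U_def sum.inter_filter[symmetric] of_bool_def)
    also have "\<dots> = (\<Sum>T\<in>?X. 1 - real (cov T))"
      using disj by (intro sum.cong refl) (auto simp: le_Suc_eq cov_def[symmetric])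
    also have "\<dots> = real (card ?X) - (\<Sum>T\<in>?X. \<Sum>K\<in>{K \<in> M. T \<subseteq> K}. 1)"
      by (simp add: sum_subtractf cov_def)
    also have "(\<Sum>T\<in>?X. \<Sum>K\<in>{K \<in> M. T \<subseteq> K}. (1::real)) = (\<Sum>K\<in>M. \<Sum>T\<in>{T \<in> ?X. T \<subseteq> K}. 1)"
      by (rule sum.swap_restrict[OF finX finM])
    also have "\<dots> = (\<Sum>K\<in>M. real (card K choose t))"
      using card_clique_t_subsets[OF G _ t] MG by (intro sum.cong) auto
    finally show ?thesis .
  qed
  finally show ?thesis
    by (simp add: gain_def sum_subtractf sum_distrib_left algebra_simps)
qed

theorem theorem1p10:
  fixes t :: nat and \<rho> \<gamma> :: real
  assumes "t \<ge> 2" and "\<rho> > 0"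
  shows "\<exists>n0::nat. \<forall>c::nat \<Rightarrow> real.
           (\<forall>i\<ge>1. 0 \<le> c i) \<and> (\<forall>i\<ge>t. 1 \<le> c i \<and> c (i + 1) - c i \<le> c t) \<and> c t = \<gamma> \<longrightarrow>
           (\<forall>n>n0. \<forall>G::'a pair_pre_digraph. pair_graph G \<and> card (pverts G) = n \<longrightarrow>
              dec t G c \<le> frac_dec t G c + \<rho> * real n ^ t)"
proof (cases "1 \<le> \<gamma>")
  case False
  \<comment> \<open>The hypotheses force \<open>c t \<ge> 1\<close>, so no cost sequence is
    left.\<close>
  then show ?thesis by (intro exI[of _ 0]) auto
next
  case \<gamma>: True
  \<comment> \<open>Makes the truncation loss per \<open>t\<close>-clique at most
    \<open>\<rho> / 2\<close>, with an \<open>s\<close> that depends only on \<open>t\<close>,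
    \<gamma> and \<rho>.\<close>
  obtain m :: nat where m: "4 * \<gamma> / \<rho> < real m" using reals_Archimedean2 by blast
  define s where "s = t + m + 1"
  have ts: "t < s" by (simp add: s_def)
  have \<tau>: "2 * \<gamma> / real (s - t + 2) \<le> \<rho> / 2"
  proof -
    have "4 * \<gamma> < real m * \<rho>" using m assms(2) by (simp add: pos_divide_less_eq)
    also have "\<dots> \<le> real (s - t + 2) * \<rho>" using assms(2) by (intro mult_right_mono) (auto simp: s_def)
    finally show ?thesis by (simp add: field_simps)
  qed
  \<comment> \<open>An upper bound for all savings at sizes from \<open>t\<close> to
    \<open>s\<close>, depending on the costs through \<gamma> only. Dividing by it makes
    \<open>n0\<close> the same for all admissible \<open>c\<close>.\<close>
  define B where "B = 2 ^ s * \<gamma>"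
  have B: "0 < B" using \<gamma> by (simp add: B_def)
  have "0 < \<rho> / (2 * B)" using assms(2) B by simp
  from integral_packing[OF assms(1) ts this, where 'a = 'a] obtain n0 where ip:
    "\<forall>(G :: 'a pair_pre_digraph) f b. pair_graph G \<longrightarrow> n0 < card (pverts G) \<longrightarrow> fractional_packing t s G f \<longrightarrow>
    (\<forall>k. 0 \<le> b k \<and> b k \<le> 1) \<longrightarrow>
    (\<exists>M \<subseteq> mid_cliques t s G. (\<forall>T\<in>cliques_of_size t G. card {K \<in> M. T \<subseteq> K} \<le> 1) \<and>
      (\<Sum>K\<in>mid_cliques t s G. b (card K) * f K) - \<rho> / (2 * B) * real (card (pverts G)) ^ t \<le> (\<Sum>K\<in>M. b (card K)))"
    by (elim exE)
  show ?thesis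
  proof (intro exI[of _ n0] allI impI)
    fix c :: "nat \<Rightarrow> real" and n and G :: "'a pair_pre_digraph"
    assume c: "(\<forall>i\<ge>1. 0 \<le> c i) \<and> (\<forall>i\<ge>t. 1 \<le> c i \<and> c (i + 1) - c i \<le> c t) \<and> c t = \<gamma>"
      and n: "n0 < n" and "pair_graph G \<and> card (pverts G) = n"
    then have G: "pair_graph G" and V: "card (pverts G) = n" by auto
    have c0: "0 \<le> c i" if "1 \<le> i" for i using c that by blast
    have ct: "c t = \<gamma>" using c by blast
    have ci: "\<forall>i\<ge>t. c (i + 1) - c i \<le> c t" using c by blast
    have t1: "1 \<le> t" using assms(1) by simp
    let ?X = "cliques_of_size t G" and ?Q = "mid_cliques t s G"
    obtain f where f: "fractional_clique_decomposition t G f" and f_cost: "clique_cost G c f = frac_dec t G c"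
      using frac_dec_is_min(1)[OF G t1, of c] c0 by auto
    have "\<exists>f'. fractional_packing t s G f' \<and>
      (\<Sum>K\<in>{K \<in> cliques G. t < card K}. gain t c (card K) * f K) - 2 * c t / real (s - t + 2) * real (card ?X)
      \<le> (\<Sum>K\<in>?Q. gain t c (card K) * f' K)"
      by (rule truncate_to_mid_cliques[OF G f assms(1) ts ci]) (use c0 t1 in auto)
    then obtain f' where f': "fractional_packing t s G f'" and trunc:
      "(\<Sum>K\<in>{K \<in> cliques G. t < card K}. gain t c (card K) * f K) - 2 * c t / real (s - t + 2) * real (card ?X)
      \<le> (\<Sum>K\<in>?Q. gain t c (card K) * f' K)"
      by (elim exE conjE)
    \<comment> \<open>The value 0 outside the range keeps \<open>b\<close> in the unit interval at
      sizes where the saving may be negative or exceed \<open>B\<close>.\<close>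
    define b where "b k = (if t \<le> k \<and> k \<le> s then gain t c k / B else 0)" for k
    have b01: "\<forall>k. 0 \<le> b k \<and> b k \<le> 1"
    proof
      fix k
      show "0 \<le> b k \<and> b k \<le> 1"
      proof (cases "t \<le> k \<and> k \<le> s")
        case True
        have "c k \<le> real (k - t + 1) * c t" using cost_le_linear[OF ci] True by simp
        also have "\<dots> \<le> real (k choose t) * c t"
        proof (rule mult_right_mono)
          \<comment> \<open>Weakening the quadratic bound by \<open>k - t + 2 \<ge> 2\<close> gives
            the linear one that makes savings nonnegative.\<close>
          have "real (k - t + 1) * real (k - t + 2) \<le> 2 * real (k choose t)"
            using choose_quadratic[OF assms(1)] True by simp
          moreover have "real (k - t + 1) * 2 \<le> real (k - t + 1) * real (k - t + 2)"
            by (intro mult_left_mono) auto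
          ultimately have "real (k - t + 1) * 2 \<le> 2 * real (k choose t)" by (rule order_trans[rotated])
          then show "real (k - t + 1) \<le> real (k choose t)" by simp
        qed (use ct \<gamma> in simp)
        finally have "0 \<le> gain t c k" by (simp add: gain_def)
        moreover have "gain t c k \<le> B"
        proof -
          have "k choose t \<le> 2 ^ s"
            using binomial_le_pow2[of k t] power_increasing[of k s "2::nat"] True by linarith
          then have "real (k choose t) \<le> 2 ^ s" by (metis of_nat_le_iff of_nat_numeral of_nat_power)
          then have "real (k choose t) * \<gamma> \<le> B" unfolding B_def using \<gamma> by (intro mult_right_mono) auto
          then show ?thesis using c0[of k] True t1 ct by (simp add: gain_def)
        qed
        ultimately show ?thesis using True B by (simp add: b_def)
      next
        case False
        then show ?thesis by (auto simp: b_def)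
      qed
    qed
    have "n0 < card (pverts G)" using n V by simp
    from ip[THEN spec, THEN spec, THEN spec, THEN mp, THEN mp, THEN mp, THEN mp, OF G this f' b01]
    obtain M where M: "M \<subseteq> ?Q" "\<forall>T\<in>?X. card {K \<in> M. T \<subseteq> K} \<le> 1"
      and gainM: "(\<Sum>K\<in>?Q. b (card K) * f' K) - \<rho> / (2 * B) * real (card (pverts G)) ^ t \<le> (\<Sum>K\<in>M. b (card K))"
      by (elim exE conjE)
    have bQ: "B * b (card K) = gain t c (card K)" if "K \<in> ?Q" for K
      using that B by (auto simp: b_def mid_cliques_def)
    \<comment> \<open>Scaling back by \<open>B\<close> returns to the savings; the rounding loss
      becomes the second half of the error.\<close>
    have "B * ((\<Sum>K\<in>?Q. b (card K) * f' K) - \<rho> / (2 * B) * real n ^ t) \<le> B * (\<Sum>K\<in>M. b (card K))"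
      using gainM B V by (intro mult_left_mono) auto
    moreover have "B * (\<Sum>K\<in>?Q. b (card K) * f' K) = (\<Sum>K\<in>?Q. gain t c (card K) * f' K)"
      unfolding sum_distrib_left using bQ by (intro sum.cong refl) (simp flip: mult.assoc)
    moreover have "B * (\<Sum>K\<in>M. b (card K)) = (\<Sum>K\<in>M. gain t c (card K))"
      unfolding sum_distrib_left using bQ M(1) by (intro sum.cong refl) auto
    moreover have "B * (\<rho> / (2 * B) * real n ^ t) = \<rho> / 2 * real n ^ t" using B by simp
    ultimately have gains: "(\<Sum>K\<in>?Q. gain t c (card K) * f' K) - \<rho> / 2 * real n ^ t \<le> (\<Sum>K\<in>M. gain t c (card K))"
      by (simp add: right_diff_distrib)
    have "2 * c t / real (s - t + 2) * real (card ?X) \<le> \<rho> / 2 * real n ^ t"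
    proof -
      have "real (card ?X) \<le> real (n ^ t)"
        using card_cliques_of_size_le[OF G, of t] unfolding V of_nat_le_iff .
      then show ?thesis using \<tau> ct assms(2) \<gamma> by (intro mult_mono) auto
    qed
    moreover have "dec t G c \<le> c t * real (card ?X) - (\<Sum>K\<in>M. gain t c (card K))"
      by (rule packing_to_decomposition[OF G t1 M])
    moreover have "c t * real (card ?X) - (\<Sum>K\<in>{K \<in> cliques G. t < card K}. gain t c (card K) * f K) \<le> frac_dec t G c"
      using clique_cost_ge_gain[OF G f t1, of c] c0 f_cost by simp
    ultimately show "dec t G c \<le> frac_dec t G c + \<rho> * real n ^ t"
      using gains trunc by linarith
  qed
qed

end
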